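(* Let $n\ge2$ and let $\mathrm N_{n,3}=F_n/\gamma_4F_n$ be the free nilpotent group of rank $n$ and step $3$ with basis $x_1,\dots,x_n$. The group of central palindromic automorphisms of $\mathrm N_{n,3}$ is generated by the automorphisms $\varphi_{ab,i}$ and $\varphi_{abc,i}$, where $1\le b<a\le n$, $1\le b\le c\le n$ and $1\le i\le n$, which act on the generators by $$\varphi_{ab,i}:\ x_i\mapsto x_i[x_a,x_b,x_i][x_a,x_b,x_b][x_a,x_b,x_a],\quad x_j\mapsto x_j\ (j\ne i),$$ $$\varphi_{abc,i}:\ x_i\mapsto x_i[x_a,x_b,x_c]^2,\quad x_j\mapsto x_j\ (j\ne i).$$ The quotient of the group of central automorphisms of $\mathrm N_{n,3}$ by the subgroup of central palindromic automorphisms is isomorphic to $\mathbb Z_2^{nq}$, where $\mathbb Z_2=\mathbb Z/2\mathbb Z$ and $$q=\dim(\gamma_3\mathrm N_{n,3})-\dim(\gamma_2\mathrm N_{n,3}/\gamma_3\mathrm N_{n,3})=\frac{n(n^2-1)}{3}-\frac{n(n-1)}{2}.$$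
   Context: $F_n$ is the free group on $x_1,\dots,x_n$ and $\gamma_mG$ is the $m$-th term of the lower central series of $G$ ($\gamma_1G=G$). The images of the $x_i$ in $\mathrm N_{n,3}$ are again denoted $x_i$. Commutators: $[g,h]=g^{-1}h^{-1}gh$ and $[g_1,g_2,g_3]=[[g_1,g_2],g_3]$. $\dim$ denotes the rank of a free abelian group. A word in $x_1^{\pm1},\dots,x_n^{\pm1}$ is a palindrome if it coincides letter by letter with its reverse word; an element of $\mathrm N_{n,3}$ is a palindrome if it is represented by some palindromic word. An automorphism $\phi$ is palindromic if the image $x_i^{\phi}$ is a palindrome for every $1\le i\le n$. An automorphism of a group $G$ is central if it induces the identity on $G/Z(G)$, where $Z(G)$ is the center. A central palindromic automorphism is one that is both central and palindromic. *)

theory Defs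
  imports "HOL-Algebra.Algebra"
begin

section \<open>Free groups\<close>

text \<open>The letter \<open>(i, True)\<close> stands for \<open>x\<^sub>i\<close> and \<open>(i, False)\<close> for its inverse. The free
  group of rank \<open>n\<close> is realised on the reduced words in the letters with index in \<open>{1..n}\<close>;
  \<open>cons_red a w\<close> is the reduced form of \<open>a # w\<close> for reduced \<open>w\<close>.\<close>

type_synonym letter = "nat \<times> bool"

definition inv_letter :: "letter \<Rightarrow> letter" where
  "inv_letter a = (fst a, \<not> snd a)"

definition words :: "nat \<Rightarrow> letter list set" where
  "words n = {w. fst ` set w \<subseteq> {1..n}}"

definition reduced :: "letter list \<Rightarrow> bool" where
  "reduced w \<longleftrightarrow> successively (\<lambda>a b. b \<noteq> inv_letter a) w"

fun cons_red :: "letter \<Rightarrow> letter list \<Rightarrow> letter list" where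
  "cons_red a [] = [a]"
| "cons_red a (b # w) = (if b = inv_letter a then w else a # b # w)"

definition free_group :: "nat \<Rightarrow> letter list monoid" where
  "free_group n = \<lparr>carrier = {w \<in> words n. reduced w},
                   monoid.mult = (\<lambda>u v. foldr cons_red u v), one = []\<rparr>"


section \<open>Commutators, lower central series, centre\<close>

definition commutator :: "('a, 'b) monoid_scheme \<Rightarrow> 'a \<Rightarrow> 'a \<Rightarrow> 'a" where
  "commutator G g h = inv\<^bsub>G\<^esub> g \<otimes>\<^bsub>G\<^esub> inv\<^bsub>G\<^esub> h \<otimes>\<^bsub>G\<^esub> g \<otimes>\<^bsub>G\<^esub> h"

definition commutator3 :: "('a, 'b) monoid_scheme \<Rightarrow> 'a \<Rightarrow> 'a \<Rightarrow> 'a \<Rightarrow> 'a" where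
  "commutator3 G g1 g2 g3 = commutator G (commutator G g1 g2) g3"

text \<open>\<open>lower_central G m\<close> is \<open>\<gamma>\<^sub>m G\<close>, indexed from \<open>\<gamma>\<^sub>1 G = G\<close>; the value at \<open>0\<close> is a dummy.\<close>

fun lower_central :: "('a, 'b) monoid_scheme \<Rightarrow> nat \<Rightarrow> 'a set" where
  "lower_central G 0 = carrier G"
| "lower_central G (Suc 0) = carrier G"
| "lower_central G (Suc (Suc m)) =
     generate G {commutator G g h | g h. g \<in> lower_central G (Suc m) \<and> h \<in> carrier G}"

definition center :: "('a, 'b) monoid_scheme \<Rightarrow> 'a set" where
  "center G = {z \<in> carrier G. \<forall>g \<in> carrier G. z \<otimes>\<^bsub>G\<^esub> g = g \<otimes>\<^bsub>G\<^esub> z}"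


section \<open>Rank of a free abelian group of finite rank\<close>

definition fin_free_abelian :: "('a, 'b) monoid_scheme \<Rightarrow> bool" where
  "fin_free_abelian A \<longleftrightarrow> (\<exists>r::nat. A \<cong> free_Abelian_group {..<r})"

definition free_abelian_rank :: "('a, 'b) monoid_scheme \<Rightarrow> nat" where
  "free_abelian_rank A = (THE r::nat. A \<cong> free_Abelian_group {..<r})"


section \<open>The free nilpotent group of step 3\<close>

definition N3 :: "nat \<Rightarrow> letter list set monoid" where
  "N3 n = free_group n Mod lower_central (free_group n) 4"

definition gen :: "nat \<Rightarrow> nat \<Rightarrow> letter list set" where
  "gen n i = lower_central (free_group n) 4 #>\<^bsub>free_group n\<^esub> [(i, True)]"

definition gamma2_N3 :: "nat \<Rightarrow> letter list set monoid" where
  "gamma2_N3 n = (N3 n)\<lparr>carrier := lower_central (N3 n) 2\<rparr>"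

definition gamma3_N3 :: "nat \<Rightarrow> letter list set monoid" where
  "gamma3_N3 n = (N3 n)\<lparr>carrier := lower_central (N3 n) 3\<rparr>"

definition letter_value :: "nat \<Rightarrow> letter \<Rightarrow> letter list set" where
  "letter_value n a = (if snd a then gen n (fst a) else inv\<^bsub>N3 n\<^esub> gen n (fst a))"

definition word_value :: "nat \<Rightarrow> letter list \<Rightarrow> letter list set" where
  "word_value n w = foldr (\<lambda>a g. letter_value n a \<otimes>\<^bsub>N3 n\<^esub> g) w \<one>\<^bsub>N3 n\<^esub>"

text \<open>The palindromic word representing an element need not be reduced.\<close>

definition palindrome :: "nat \<Rightarrow> letter list set \<Rightarrow> bool" where
  "palindrome n g \<longleftrightarrow> (\<exists>w \<in> words n. rev w = w \<and> g = word_value n w)"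


section \<open>Central and palindromic automorphisms\<close>

definition central_autos :: "('a, 'b) monoid_scheme \<Rightarrow> ('a \<Rightarrow> 'a) set" where
  "central_autos G =
     {\<phi> \<in> auto G. \<forall>g \<in> carrier G. center G #>\<^bsub>G\<^esub> \<phi> g = center G #>\<^bsub>G\<^esub> g}"

definition palindromic_autos :: "nat \<Rightarrow> (letter list set \<Rightarrow> letter list set) set" where
  "palindromic_autos n = {\<phi> \<in> auto (N3 n). \<forall>i \<in> {1..n}. palindrome n (\<phi> (gen n i))}"

definition central_palindromic_autos :: "nat \<Rightarrow> (letter list set \<Rightarrow> letter list set) set" where
  "central_palindromic_autos n = central_autos (N3 n) \<inter> palindromic_autos n"

definition CentralAutGroup :: "nat \<Rightarrow> (letter list set \<Rightarrow> letter list set) monoid" where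
  "CentralAutGroup n = (AutoGroup (N3 n))\<lparr>carrier := central_autos (N3 n)\<rparr>"

definition aut_moving :: "nat \<Rightarrow> nat \<Rightarrow> letter list set \<Rightarrow> (letter list set \<Rightarrow> letter list set) \<Rightarrow> bool" where
  "aut_moving n i y \<phi> \<longleftrightarrow> \<phi> \<in> auto (N3 n) \<and> \<phi> (gen n i) = y \<and>
     (\<forall>j \<in> {1..n} - {i}. \<phi> (gen n j) = gen n j)"

definition phi_ab_image :: "nat \<Rightarrow> nat \<Rightarrow> nat \<Rightarrow> nat \<Rightarrow> letter list set" where
  "phi_ab_image n a b i =
     gen n i \<otimes>\<^bsub>N3 n\<^esub> commutator3 (N3 n) (gen n a) (gen n b) (gen n i)
             \<otimes>\<^bsub>N3 n\<^esub> commutator3 (N3 n) (gen n a) (gen n b) (gen n b)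
             \<otimes>\<^bsub>N3 n\<^esub> commutator3 (N3 n) (gen n a) (gen n b) (gen n a)"

definition phi_abc_image :: "nat \<Rightarrow> nat \<Rightarrow> nat \<Rightarrow> nat \<Rightarrow> nat \<Rightarrow> letter list set" where
  "phi_abc_image n a b c i =
     gen n i \<otimes>\<^bsub>N3 n\<^esub> commutator3 (N3 n) (gen n a) (gen n b) (gen n c) [^]\<^bsub>N3 n\<^esub> (2::nat)"

definition phi_ab :: "nat \<Rightarrow> nat \<Rightarrow> nat \<Rightarrow> nat \<Rightarrow> letter list set \<Rightarrow> letter list set" where
  "phi_ab n a b i = (THE \<phi>. aut_moving n i (phi_ab_image n a b i) \<phi>)"

definition phi_abc :: "nat \<Rightarrow> nat \<Rightarrow> nat \<Rightarrow> nat \<Rightarrow> nat \<Rightarrow> letter list set \<Rightarrow> letter list set" where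
  "phi_abc n a b c i = (THE \<phi>. aut_moving n i (phi_abc_image n a b c i) \<phi>)"

end

theory Submission
  imports Defs
begin

text \<open>
Let \<open>G\<close> be the free nilpotent group of rank \<open>n\<close> and class three, with lower central terms
\<open>\<gamma>\<^sub>2\<close> and \<open>\<gamma>\<^sub>3\<close>.

\<^bold>\<open>Central automorphisms.\<close> The centre of \<open>G\<close> is \<open>\<gamma>\<^sub>3\<close> (\<open>center_eq\<close>), so a central automorphism
sends \<open>x\<^sub>i\<close> to \<open>x\<^sub>i z\<^sub>i\<close> with \<open>z\<^sub>i \<in> \<gamma>\<^sub>3\<close>. Every family \<open>z\<close> occurs: if \<open>e\<^sub>i(g)\<close> is the exponent sum of
\<open>x\<^sub>i\<close> in \<open>g\<close>, then multiplying each \<open>g\<close> by the product of the \<open>z\<^sub>i ^ e\<^sub>i(g)\<close> is an automorphism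
(\<open>transvection_auto\<close>). Such maps fix \<open>\<gamma>\<^sub>3\<close> pointwise, hence composing them multiplies the families, and the central automorphisms form the
group \<open>\<gamma>\<^sub>3\<^sup>n\<close>.

\<^bold>\<open>Palindromes.\<close> Reversing a word with value \<open>u\<close> gives a word with value \<open>\<theta>(u)\<^sup>-\<^sup>1\<close>, where \<open>\<theta>\<close> is the
endomorphism inverting each generator. Counting exponents, a palindrome in \<open>x\<^sub>i \<gamma>\<^sub>3\<close> has the form
\<open>u x\<^sub>i \<theta>(u)\<^sup>-\<^sup>1\<close> with \<open>u \<in> \<gamma>\<^sub>2\<close>; a middle letter \<open>x\<^sub>i\<^sup>-\<^sup>1\<close> can be absorbed into \<open>u\<close>. So \<open>x\<^sub>i z\<close> is a
palindrome iff \<open>z = x\<^sub>i\<^sup>-\<^sup>1 u x\<^sub>i \<theta>(u)\<^sup>-\<^sup>1\<close> for some \<open>u \<in> \<gamma>\<^sub>2\<close>. As \<open>\<gamma>\<^sub>2\<close> is abelian, the right hand side is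
a homomorphism of \<open>u\<close>. It squares the elements of \<open>\<gamma>\<^sub>3\<close>, where \<open>\<theta>\<close> is inversion, and it sends
\<open>[x\<^sub>a, x\<^sub>b]\<close> to \<open>[x\<^sub>a, x\<^sub>b, x\<^sub>i] [x\<^sub>a, x\<^sub>b, x\<^sub>b] [x\<^sub>a, x\<^sub>b, x\<^sub>a]\<close>. Since \<open>\<gamma>\<^sub>2\<close> is generated by the commutators
\<open>[x\<^sub>a, x\<^sub>b]\<close> and \<open>[x\<^sub>a, x\<^sub>b, x\<^sub>c]\<close> with \<open>b < a\<close>, \<open>b \<le> c\<close>, the admissible \<open>z\<close> form exactly the subgroup
generated by the elements in the theorem (\<open>palindromic_iff\<close>).

\<^bold>\<open>The quotient.\<close> The group \<open>\<gamma>\<^sub>3\<close> is free abelian on the \<open>[x\<^sub>a, x\<^sub>b, x\<^sub>c]\<close> above. In this basis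
\<open>[x\<^sub>a, x\<^sub>b, x\<^sub>b]\<close> (or \<open>[x\<^sub>a, x\<^sub>b, x\<^sub>a]\<close>, if \<open>i = b\<close>) may be replaced by the image of \<open>[x\<^sub>a, x\<^sub>b]\<close>, in
which it has coefficient one, while it does not occur in the images of the other pairs. Admissibility of
\<open>z\<close> then says that the coordinates of \<open>z\<close> at the unreplaced basis elements are even
(\<open>Pal_iff_even\<close>). There are \<open>q = dim \<gamma>\<^sub>3 - dim \<gamma>\<^sub>2/\<gamma>\<^sub>3\<close> of them for each \<open>i\<close>, so their residues define a
surjection of the group of central automorphisms onto \<open>\<int>\<^sub>2\<^sup>n\<^sup>q\<close> whose kernel consists of the
palindromic ones.

\<^bold>\<open>Why the commutators form a basis.\<close> They generate by multilinearity and the Hall--Witt identity.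
They are independent because \<open>x\<^sub>i \<mapsto> 1 + X\<^sub>i\<close> maps \<open>G\<close> to noncommutative power series truncated after
degree three, where suitable coefficients are integer homomorphisms dual to the proposed basis. The
two halves meet in \<open>dual_coordinates_kernel\<close>, applied to \<open>G/\<gamma>\<^sub>2\<close>, \<open>\<gamma>\<^sub>2/\<gamma>\<^sub>3\<close> and \<open>\<gamma>\<^sub>3\<close>.
\<close>

section \<open>Commutators and the lower central series\<close>

lemma (in group) commutator_closed [simp]:
  assumes "g \<in> carrier G" "h \<in> carrier G"
  shows "commutator G g h \<in> carrier G"
  using assms by (simp add: commutator_def)

lemma (in group_hom) hom_commutator:
  assumes "x \<in> carrier G" "y \<in> carrier G"
  shows "h (commutator G x y) = commutator H (h x) (h y)"
  using assms by (simp add: commutator_def)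

text \<open>Together with associativity and the rule for inverting a product, these two rules rewrite every group
word to its freely reduced form. So simplification by \<open>free_reduction\<close> decides the identities that hold in
all groups, such as the commutator identities below.\<close>
lemma (in group) inv_cancel_left:
  assumes "x \<in> carrier G" "y \<in> carrier G"
  shows "x \<otimes> (inv x \<otimes> y) = y" and "inv x \<otimes> (x \<otimes> y) = y"
  using assms by (simp_all flip: m_assoc)

lemmas (in group) free_reduction = m_assoc inv_mult_group inv_cancel_left

lemma (in group) lower_central_subset: "lower_central G m \<subseteq> carrier G"
proof (induction m rule: nat_induct)
  case (Suc m)
  then have "generate G {commutator G g h |g h. g \<in> lower_central G m \<and> h \<in> carrier G} \<subseteq> carrier G"
    by (intro generate_incl) force
  then show ?case
    by (cases m) auto
qed simp

lemma (in group) commutator_conj: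
  assumes "g \<in> carrier G" "x \<in> carrier G" "y \<in> carrier G"
  shows "g \<otimes> commutator G x y \<otimes> inv g = commutator G (g \<otimes> x \<otimes> inv g) (g \<otimes> y \<otimes> inv g)"
  using assms by (simp add: commutator_def free_reduction)

lemma (in group) lower_central_normal: "lower_central G m \<lhd> G"
proof (induction m rule: nat_induct)
  case (Suc m)
  show ?case
  proof (cases m)
    case [simp]: (Suc k)
    let ?C = "{commutator G g h |g h. g \<in> lower_central G (Suc k) \<and> h \<in> carrier G}"
    note sub = subsetD [OF lower_central_subset]
    have "generate G ?C \<lhd> G"
    proof (rule normal_generateI)
      show "?C \<subseteq> carrier G"
        using sub by force
      fix c g
      assume "c \<in> ?C" and g: "g \<in> carrier G"
      then obtain x y where c: "c = commutator G x y"
        and x: "x \<in> lower_central G (Suc k)" and y: "y \<in> carrier G"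
        by blast
      have "g \<otimes> x \<otimes> inv g \<in> lower_central G (Suc k)"
        using Suc.IH g x by (simp add: normal_inv_iff)
      moreover have "g \<otimes> y \<otimes> inv g \<in> carrier G"
        using g y by simp
      moreover have "g \<otimes> c \<otimes> inv g = commutator G (g \<otimes> x \<otimes> inv g) (g \<otimes> y \<otimes> inv g)"
        unfolding c using g y sub [OF x] by (simp add: commutator_conj)
      ultimately show "g \<otimes> c \<otimes> inv g \<in> ?C"
        by blast
    qed
    then show ?thesis by simp
  qed (simp add: normal_self)
qed (simp add: normal_self)

lemma (in group_hom) lower_central_hom: "h ` lower_central G m \<subseteq> lower_central H m"
proof (induction m rule: nat_induct)
  case (Suc m)
  show ?case
  proof (cases m)
    case [simp]: (Suc k)
    let ?C = "{commutator G g h |g h. g \<in> lower_central G (Suc k) \<and> h \<in> carrier G}"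
    note sub = subsetD [OF G.lower_central_subset]
    have "?C \<subseteq> carrier G"
      using sub by force
    then have "h ` generate G ?C = generate H (h ` ?C)"
      by (simp add: generate_img)
    moreover have "h ` ?C \<subseteq> {commutator H g h |g h. g \<in> lower_central H (Suc k) \<and> h \<in> carrier H}"
      using Suc.IH sub by (fastforce simp: hom_commutator)
    ultimately show ?thesis
      using H.mono_generate by simp
  qed auto
qed auto

text \<open>For quotient maps this computes the lower central series of the quotient; in particular \<open>\<gamma>\<^sub>4\<close> of a
group modulo its \<open>\<gamma>\<^sub>4\<close> is trivial.\<close>
lemma (in group_hom) lower_central_surj_hom:
  assumes "h ` carrier G = carrier H"
  shows "lower_central H m = h ` lower_central G m"
proof (induction m rule: nat_induct)
  case (Suc m)
  show ?case
  proof (cases m)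
    case [simp]: (Suc k)
    let ?C = "{commutator G g h |g h. g \<in> lower_central G (Suc k) \<and> h \<in> carrier G}"
    let ?D = "{commutator H g h |g h. g \<in> lower_central H (Suc k) \<and> h \<in> carrier H}"
    note sub = subsetD [OF G.lower_central_subset]
    have "?D = {commutator H (h g) (h k') |g k'. g \<in> lower_central G (Suc k) \<and> k' \<in> carrier G}"
      using Suc.IH unfolding assms [symmetric] by force
    also have "\<dots> = h ` ?C"
      using sub by (force simp: hom_commutator)
    finally have "generate H ?D = h ` generate G ?C"
      using sub by (subst generate_img [symmetric]) auto
    then show ?thesis by simp
  qed (simp add: assms)
qed (simp add: assms)

context group begin

lemma lower_central_2:
  "lower_central G 2 = generate G {commutator G g h |g h. g \<in> carrier G \<and> h \<in> carrier G}"
  by (simp add: numeral_2_eq_2)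

lemma lower_central_3:
  "lower_central G 3 = generate G {commutator G g h |g h. g \<in> lower_central G 2 \<and> h \<in> carrier G}"
  by (simp add: numeral_3_eq_3 numeral_2_eq_2)

lemma lower_central_subgroup: "subgroup (lower_central G m) G"
  by (rule normal_imp_subgroup [OF lower_central_normal])

lemma lower_central_carrier: "u \<in> lower_central G m \<Longrightarrow> u \<in> carrier G"
  using lower_central_subset by blast

lemma commutator_lower_central_2:
  "g \<in> carrier G \<Longrightarrow> h \<in> carrier G \<Longrightarrow> commutator G g h \<in> lower_central G 2"
  unfolding lower_central_2 by (blast intro: generate.incl)

lemma commutator_lower_central_3:
  "u \<in> lower_central G 2 \<Longrightarrow> h \<in> carrier G \<Longrightarrow> commutator G u h \<in> lower_central G 3"
  unfolding lower_central_3 by (blast intro: generate.incl)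

lemma commutator_eq_one_iff:
  assumes "g \<in> carrier G" "h \<in> carrier G"
  shows "commutator G g h = \<one> \<longleftrightarrow> g \<otimes> h = h \<otimes> g"
proof -
  have eq: "(h \<otimes> g) \<otimes> commutator G g h = g \<otimes> h"
    using assms by (simp add: commutator_def free_reduction)
  show ?thesis
  proof
    assume "commutator G g h = \<one>"
    then show "g \<otimes> h = h \<otimes> g" using eq assms by simp
  next
    assume "g \<otimes> h = h \<otimes> g"
    then have "(h \<otimes> g) \<otimes> commutator G g h = (h \<otimes> g) \<otimes> \<one>" using eq assms by simp
    then show "commutator G g h = \<one>" using assms l_cancel [of "h \<otimes> g" "commutator G g h" "\<one>"] by simp
  qed
qed

lemma inv_commutator:
  assumes "g \<in> carrier G" "h \<in> carrier G"
  shows "inv (commutator G g h) = commutator G h g"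
  using assms by (simp add: commutator_def free_reduction)

lemma commutator_self: "g \<in> carrier G \<Longrightarrow> commutator G g g = \<one>"
  by (simp add: commutator_eq_one_iff)

lemma commutator_mult_right:
  assumes "u \<in> carrier G" "g \<in> carrier G" "h \<in> carrier G"
  shows "commutator G u (g \<otimes> h) = commutator G u h \<otimes> commutator G u g \<otimes> commutator3 G u g h"
  using assms by (simp add: commutator3_def commutator_def free_reduction)

lemma commutator_mult_left:
  assumes "u \<in> carrier G" "v \<in> carrier G" "h \<in> carrier G"
  shows "commutator G (u \<otimes> v) h = commutator G u h \<otimes> commutator3 G u h v \<otimes> commutator G v h"
  using assms by (simp add: commutator3_def commutator_def free_reduction)

text \<open>An identity of the free group. In class three the conjugations disappear and the inverses can be taken
out of the commutators, which leaves the Jacobi identity.\<close>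
lemma Hall_Witt:
  assumes "x \<in> carrier G" "y \<in> carrier G" "z \<in> carrier G"
  shows "(inv y \<otimes> commutator3 G x (inv y) z \<otimes> y) \<otimes> (inv z \<otimes> commutator3 G y (inv z) x \<otimes> z) \<otimes>
    (inv x \<otimes> commutator3 G z (inv x) y \<otimes> x) = \<one>"
  using assms by (simp add: commutator3_def commutator_def free_reduction)

end

text \<open>The canonical projection carries commutators of representatives to commutators of cosets.\<close>
lemma (in group) comm_group_FactGroup_commutators:
  assumes K: "K \<lhd> G" and comm: "\<And>g h. g \<in> carrier G \<Longrightarrow> h \<in> carrier G \<Longrightarrow> commutator G g h \<in> K"
  shows "comm_group (G Mod K)"
proof -
  interpret K: normal K G by (rule K)
  have grp: "group (G Mod K)" by (rule K.factorgroup_is_group)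
  interpret p: group_hom G "G Mod K" "\<lambda>y. K #> y"
    using K.r_coset_hom_Mod grp by (simp add: group_hom_def group_hom_axioms_def)
  show ?thesis
  proof (rule p.H.group_comm_groupI)
    fix A B assume "A \<in> carrier (G Mod K)" "B \<in> carrier (G Mod K)"
    then obtain g h where g: "g \<in> carrier G" "h \<in> carrier G" "A = K #> g" "B = K #> h"
      by (auto simp: carrier_FactGroup)
    then have "commutator (G Mod K) A B = K #> commutator G g h"
      using p.hom_commutator by simp
    also have "\<dots> = \<one>\<^bsub>G Mod K\<^esub>"
      using comm g K.rcos_const by simp
    finally show "A \<otimes>\<^bsub>G Mod K\<^esub> B = B \<otimes>\<^bsub>G Mod K\<^esub> A"
      using p.H.commutator_eq_one_iff [of A B] g p.hom_closed by simp
  qed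
qed

section \<open>Coordinates dual to a generating family\<close>

lemma (in group_hom) subgroup_contains_image_of_generate:
  assumes "S \<subseteq> carrier G" "subgroup K H" "h ` S \<subseteq> K" "x \<in> generate G S"
  shows "h x \<in> K"
  using H.generate_subgroup_incl [OF assms(3,2)] generate_img [OF assms(1)] assms(4) by blast

lemma hom_eq_on_generate:
  assumes "group G" "group H" "f \<in> hom G H" "g \<in> hom G H" "S \<subseteq> carrier G"
    and "\<And>s. s \<in> S \<Longrightarrow> f s = g s" and "x \<in> generate G S"
  shows "f x = g x"
proof -
  interpret f: group_hom G H f
    using assms by (simp add: group_hom_def group_hom_axioms_def)
  interpret g: group_hom G H g
    using assms by (simp add: group_hom_def group_hom_axioms_def)
  have "x \<in> carrier G \<and> f x = g x"
    using assms(7)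
  proof (induction rule: generate.induct)
    case (eng h1 h2)
    then show ?case by simp
  qed (use assms(5,6) in auto)
  then show ?thesis ..
qed

lemma integer_hom_group_hom:
  assumes "group G" "f \<in> hom G integer_group"
  shows "group_hom G integer_group f"
  using assms by (simp add: group_hom_def group_hom_axioms_def)

lemma (in comm_group) finprod_mem_subgroup:
  assumes "subgroup K G" "\<And>i. i \<in> I \<Longrightarrow> f i \<in> K"
  shows "finprod G f I \<in> K"
  using assms(2)
proof (induction I rule: infinite_finite_induct)
  case (insert i I)
  then have "f \<in> I \<rightarrow> carrier G" "f i \<in> carrier G"
    using subgroup.mem_carrier [OF assms(1)] by auto
  with insert show ?case
    by (simp add: subgroup.m_closed [OF assms(1)])
qed (use subgroup.one_closed [OF assms(1)] in simp_all)

lemma (in comm_group) integer_hom_finprod: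
  assumes "d \<in> hom G integer_group" "f \<in> I \<rightarrow> carrier G"
  shows "d (finprod G f I) = (\<Sum>i\<in>I. d (f i))"
proof -
  interpret d: group_hom G integer_group d
    using assms by (simp add: integer_hom_group_hom)
  show ?thesis
    using assms(2) d.hom_one
    by (induction I rule: infinite_finite_induct) simp_all
qed

text \<open>The elements \<open>b\<^sub>i\<close> generate the abelian group \<open>G/K\<close>. The map \<open>E\<close>, which sends \<open>y\<close> to the product of
the cosets of \<open>b\<^sub>i\<close> raised to \<open>d\<^sub>i(y)\<close>, is a homomorphism into \<open>G/K\<close> and agrees with the canonical
projection on the generators, hence everywhere. If all \<open>d\<^sub>i\<close> vanish at \<open>x\<close>, the coset of \<open>x\<close> is therefore
an empty product. The coordinates live on \<open>G\<close> so that Magnus coefficients can be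
used directly, without descending to the quotient.\<close>
lemma (in group) dual_coordinates_kernel:
  assumes K: "K \<lhd> G" and ab: "comm_group (G Mod K)" and I: "finite I"
    and b: "b \<in> I \<rightarrow> carrier G" and gen: "carrier G = generate G (b ` I \<union> K)"
    and d: "\<And>i. i \<in> I \<Longrightarrow> d i \<in> hom G integer_group"
    and dK: "\<And>i x. i \<in> I \<Longrightarrow> x \<in> K \<Longrightarrow> d i x = 0"
    and dual: "\<And>i j. i \<in> I \<Longrightarrow> j \<in> I \<Longrightarrow> d i (b j) = (if i = j then 1 else 0)"
    and x: "x \<in> carrier G" and dx: "\<And>i. i \<in> I \<Longrightarrow> d i x = 0"
  shows "x \<in> K"
proof -
  interpret K: normal K G by (rule K)
  interpret Q: comm_group "G Mod K" by (rule ab)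
  have coset: "K #> y \<in> carrier (G Mod K)" if "y \<in> carrier G" for y
    using that by (auto simp: carrier_FactGroup)
  have cosets: "(\<lambda>i. K #> b i) \<in> I \<rightarrow> carrier (G Mod K)"
    using b coset by auto
  define E where "E y = finprod (G Mod K) (\<lambda>i. (K #> b i) [^]\<^bsub>G Mod K\<^esub> d i y) I" for y
  have fam: "(\<lambda>i. (K #> b i) [^]\<^bsub>G Mod K\<^esub> d i y) \<in> I \<rightarrow> carrier (G Mod K)" for y
    using b coset by auto
  have "E \<in> hom G (G Mod K)"
  proof (rule homI)
    fix y z assume yz: "y \<in> carrier G" "z \<in> carrier G"
    have "E (y \<otimes> z) = finprod (G Mod K)
        (\<lambda>i. (K #> b i) [^]\<^bsub>G Mod K\<^esub> d i y \<otimes>\<^bsub>G Mod K\<^esub> (K #> b i) [^]\<^bsub>G Mod K\<^esub> d i z) I"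
      unfolding E_def
    proof (rule Q.finprod_cong')
      fix i assume i: "i \<in> I"
      have "d i (y \<otimes> z) = d i y + d i z"
        using hom_mult [OF d [OF i] yz] by simp
      moreover have "K #> b i \<in> carrier (G Mod K)"
        using coset b i by auto
      ultimately show "(K #> b i) [^]\<^bsub>G Mod K\<^esub> d i (y \<otimes> z) =
         (K #> b i) [^]\<^bsub>G Mod K\<^esub> d i y \<otimes>\<^bsub>G Mod K\<^esub> (K #> b i) [^]\<^bsub>G Mod K\<^esub> d i z"
        using Q.int_pow_mult by metis
    qed (use fam [of y] fam [of z] Q.m_closed in \<open>simp_all add: Pi_iff del: mult_FactGroup\<close>)
    also have "\<dots> = E y \<otimes>\<^bsub>G Mod K\<^esub> E z"
      unfolding E_def using fam by (rule Q.finprod_multf) (use b coset in auto)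
    finally show "E (y \<otimes> z) = E y \<otimes>\<^bsub>G Mod K\<^esub> E z" .
  qed (use fam in \<open>simp add: E_def\<close>)
  moreover have "(\<lambda>y. K #> y) \<in> hom G (G Mod K)"
    by (rule K.r_coset_hom_Mod)
  moreover have "E s = K #> s" if s: "s \<in> b ` I \<union> K" for s
  proof (cases "s \<in> K")
    case True
    then have "E s = finprod (G Mod K) (\<lambda>i. \<one>\<^bsub>G Mod K\<^esub>) I"
      unfolding E_def by (intro Q.finprod_cong') (use dK Q.one_closed in auto)
    then show ?thesis
      using True Q.finprod_one by (simp add: K.rcos_const)
  next
    case False
    with s obtain j where j: "j \<in> I" "s = b j" by auto
    have cj: "K #> b j \<in> carrier (G Mod K)"
      using coset b j by auto
    have "E s = finprod (G Mod K) (\<lambda>i. if j = i then K #> b i else \<one>\<^bsub>G Mod K\<^esub>) I"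
      unfolding E_def
    proof (rule Q.finprod_cong')
      fix i assume "i \<in> I"
      then show "(K #> b i) [^]\<^bsub>G Mod K\<^esub> d i s = (if j = i then K #> b i else \<one>\<^bsub>G Mod K\<^esub>)"
        using j dual cj Q.int_pow_1 by auto
    qed (use cosets Q.one_closed in \<open>simp_all add: Pi_iff\<close>)
    also have "\<dots> = K #> b j"
      using j cosets I by (intro Q.finprod_singleton) simp_all
    finally show ?thesis using j by simp
  qed
  moreover have "b ` I \<union> K \<subseteq> carrier G"
    using b K.subset by auto
  ultimately have "E x = K #> x"
    using hom_eq_on_generate [OF is_group Q.is_group, of E "\<lambda>y. K #> y" "b ` I \<union> K" x] x gen
    by blast
  moreover have "E x = finprod (G Mod K) (\<lambda>i. \<one>\<^bsub>G Mod K\<^esub>) I"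
    unfolding E_def by (intro Q.finprod_cong') (use dx Q.one_closed in auto)
  ultimately have "K #> x = K"
    using Q.finprod_one [of I] by (metis one_FactGroup)
  then show ?thesis
    using rcos_self [OF x K.subgroup_axioms] by simp
qed

text \<open>The witness is the product of the \<open>b\<^sub>i\<close> raised to the prescribed coordinates. The subgroup \<open>K\<close>
records membership: it is the whole group when only existence matters, and the subgroup of palindromic
elements in the parity criterion below.\<close>
lemma (in comm_group) dual_coordinates_prescribed:
  assumes I: "finite I" and b: "b \<in> I \<rightarrow> carrier G"
    and d: "\<And>i. i \<in> I \<Longrightarrow> d i \<in> hom G integer_group"
    and dual: "\<And>i j. i \<in> I \<Longrightarrow> j \<in> I \<Longrightarrow> d i (b j) = (if i = j then 1 else 0)"
    and K: "subgroup K G" "\<And>i. i \<in> I \<Longrightarrow> b i [^] (k i :: int) \<in> K"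
  obtains x where "x \<in> K" "\<And>i. i \<in> I \<Longrightarrow> d i x = k i"
proof
  have fam: "(\<lambda>i. b i [^] k i) \<in> I \<rightarrow> carrier G"
    using b by auto
  show "finprod G (\<lambda>i. b i [^] k i) I \<in> K"
    using K by (rule finprod_mem_subgroup)
  fix i assume i: "i \<in> I"
  then interpret d: group_hom G integer_group "d i"
    using d by (simp add: integer_hom_group_hom)
  have "d i (finprod G (\<lambda>i. b i [^] k i) I) = (\<Sum>j\<in>I. d i (b j [^] k j))"
    by (rule integer_hom_finprod [OF d [OF i] fam])
  also have "\<dots> = (\<Sum>j\<in>I. if i = j then k j else 0)"
    using b dual i by (intro sum.cong) (auto simp: d.hom_int_pow Pi_iff)
  finally show "d i (finprod G (\<lambda>i. b i [^] k i) I) = k i"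
    using I i by simp
qed

text \<open>Collecting the coordinates \<open>d\<^sub>i\<close> into one formal sum gives a surjection onto the free abelian group,
and its kernel is \<open>K\<close> by \<open>dual_coordinates_kernel\<close>.\<close>
lemma (in comm_group) dual_coordinates_free_abelian:
  assumes K: "subgroup K G" and I: "finite I"
    and b: "b \<in> I \<rightarrow> carrier G" and gen: "carrier G = generate G (b ` I \<union> K)"
    and d: "\<And>i. i \<in> I \<Longrightarrow> d i \<in> hom G integer_group"
    and dK: "\<And>i x. i \<in> I \<Longrightarrow> x \<in> K \<Longrightarrow> d i x = 0"
    and dual: "\<And>i j. i \<in> I \<Longrightarrow> j \<in> I \<Longrightarrow> d i (b j) = (if i = j then 1 else 0)"
  shows "G Mod K \<cong> free_Abelian_group {..<card I}"
proof -
  obtain e where e: "bij_betw e I {..<card I}"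
    using I ex_bij_betw_finite_nat [of I] by (auto simp: atLeast0LessThan)
  then have inj: "inj_on e I" and im: "e ` I = {..<card I}"
    by (auto simp: bij_betw_def)
  let ?F = "free_Abelian_group {..<card I}"
  define \<Phi> where "\<Phi> x = (\<Sum>i\<in>I. frag_cmul (d i x) (frag_of (e i)))" for x
  have look: "poly_mapping.lookup (\<Phi> x) (e i) = d i x" if i: "i \<in> I" for x i
  proof -
    have "poly_mapping.lookup (\<Phi> x) (e i) = (\<Sum>j\<in>I. if i = j then d j x else 0)"
      unfolding \<Phi>_def lookup_sum
      using i inj by (intro sum.cong) (auto simp: inj_on_def)
    then show ?thesis using I i by simp
  qed
  have carr: "\<Phi> x \<in> carrier ?F" for x
    unfolding \<Phi>_def
  proof (rule sum_closed_free_Abelian_group)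
    fix i assume "i \<in> I"
    then show "frag_cmul (d i x) (frag_of (e i)) \<in> carrier ?F"
      using im by auto
  qed
  interpret \<Phi>: group_hom G ?F \<Phi>
  proof (intro group_hom.intro group_hom_axioms.intro homI)
    fix x y assume "x \<in> carrier G" "y \<in> carrier G"
    then have "d i (x \<otimes> y) = d i x + d i y" if "i \<in> I" for i
      using hom_mult [OF d [OF that]] by simp
    then show "\<Phi> (x \<otimes> y) = \<Phi> x \<otimes>\<^bsub>?F\<^esub> \<Phi> y"
      by (simp add: \<Phi>_def frag_cmul_distrib sum.distrib)
  qed (use carr in auto)
  have "kernel G ?F \<Phi> = K"
  proof (intro equalityI subsetI)
    fix x assume "x \<in> kernel G ?F \<Phi>"
    then have x: "x \<in> carrier G" "\<And>i. i \<in> I \<Longrightarrow> d i x = 0"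
      by (auto simp: kernel_def simp flip: look)
    show "x \<in> K"
      using K I b gen d dK dual x
      by (intro dual_coordinates_kernel [of K I b d x] subgroup_imp_normal abelian_FactGroup)
  next
    fix x assume "x \<in> K"
    then show "x \<in> kernel G ?F \<Phi>"
      using dK K by (auto simp: kernel_def \<Phi>_def subgroup.mem_carrier)
  qed
  moreover have "\<Phi> ` carrier G = carrier ?F"
  proof (intro equalityI subsetI)
    fix y assume y: "y \<in> carrier ?F"
    obtain x where x: "x \<in> carrier G" "\<And>i. i \<in> I \<Longrightarrow> d i x = poly_mapping.lookup y (e i)"
      using dual_coordinates_prescribed [OF I b d dual subgroup_self, of "\<lambda>i. poly_mapping.lookup y (e i)"] b
      by (auto simp: Pi_iff)
    have "\<Phi> x = y"
    proof (rule poly_mapping_eqI)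
      fix j
      show "poly_mapping.lookup (\<Phi> x) j = poly_mapping.lookup y j"
      proof (cases "j < card I")
        case True
        then obtain i where "i \<in> I" "j = e i" using im by auto
        then show ?thesis using look x by simp
      next
        case False
        then have "j \<notin> Poly_Mapping.keys y" "j \<notin> Poly_Mapping.keys (\<Phi> x)"
          using y carr [of x] by auto
        then show ?thesis by (simp add: in_keys_iff)
      qed
    qed
    then show "y \<in> \<Phi> ` carrier G" using x by auto
  qed (use carr in auto)
  ultimately show ?thesis
    using \<Phi>.FactGroup_iso by simp
qed

text \<open>Invariance of rank by reduction modulo two. A subset \<open>S\<close> of the target basis defines the parity of the
sum of the coordinates in \<open>S\<close>. Its pullback along \<open>f\<close> is determined by the set \<open>\<Theta> S\<close> of source basis
elements where it is odd, and \<open>\<Theta>\<close> is injective as \<open>f\<close> is onto. Thus \<open>2\<^sup>s \<le> 2\<^sup>r\<close>.\<close>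
lemma rank_le_of_surj_hom:
  assumes f: "f \<in> hom (free_Abelian_group {..<r::nat}) (free_Abelian_group {..<s::nat})"
    and surj: "f ` carrier (free_Abelian_group {..<r}) = carrier (free_Abelian_group {..<s})"
  shows "s \<le> r"
proof -
  interpret f: group_hom "free_Abelian_group {..<r}" "free_Abelian_group {..<s}" f
    using f by (simp add: group_hom_def group_hom_axioms_def)
  define p :: "nat set \<Rightarrow> (nat \<Rightarrow>\<^sub>0 int) \<Rightarrow> int"
    where "p S y = (\<Sum>i\<in>S. poly_mapping.lookup y i)" for S y
  have p_diff: "p S (x - y) = p S x - p S y" for S x y
    by (simp add: p_def lookup_minus sum_subtractf)
  have f_diff: "f (x - y) = f x - f y"
    if "Poly_Mapping.keys x \<subseteq> {..<r}" "Poly_Mapping.keys y \<subseteq> {..<r}" for x y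
  proof -
    have y: "- y \<in> carrier (free_Abelian_group {..<r})" "y \<in> carrier (free_Abelian_group {..<r})"
      using that by auto
    have "f (x + - y) = f x + f (- y)"
      using f.hom_mult [of x "- y"] that by simp
    moreover have "f (- y) = - f y"
      using f.hom_inv [OF y(2)] f.hom_closed [OF y(2)] that by simp
    ultimately show ?thesis by simp
  qed
  define \<Theta> where "\<Theta> S = {j. j < r \<and> odd (p S (f (frag_of j)))}" for S
  have "inj_on \<Theta> (Pow {..<s})"
  proof (rule inj_onI)
    fix S S' assume S: "S \<in> Pow {..<s}" "S' \<in> Pow {..<s}" and eq: "\<Theta> S = \<Theta> S'"
    have par: "even (p S (f x)) = even (p S' (f x))" if "Poly_Mapping.keys x \<subseteq> {..<r}" for x
    proof (rule free_Abelian_group_induct [OF that])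
      show "even (p S (f 0)) = even (p S' (f 0))"
        using f.hom_one by (simp add: p_def)
    next
      fix j assume "j \<in> {..<r}"
      then show "even (p S (f (frag_of j))) = even (p S' (f (frag_of j)))"
        using eq by (auto simp: \<Theta>_def set_eq_iff)
    qed (simp add: f_diff p_diff)
    have "i \<in> S \<longleftrightarrow> i \<in> S'" if "i < s" for i
    proof -
      have "frag_of i \<in> f ` carrier (free_Abelian_group {..<r})"
        using that by (simp add: surj)
      then have "even (p S (frag_of i)) = even (p S' (frag_of i))"
        using par by auto
      moreover have "p A (frag_of i) = (if i \<in> A then 1 else 0)" if "A \<in> Pow {..<s}" for A
        using that finite_subset [of A "{..<s}"] by (simp add: p_def)
      ultimately show ?thesis using S by (auto split: if_splits)
    qed
    then show "S = S'" using S by blast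
  qed
  moreover have "\<Theta> ` Pow {..<s} \<subseteq> Pow {..<r}"
    by (auto simp: \<Theta>_def)
  ultimately have "card (Pow {..<s}) \<le> card (Pow {..<r})"
    by (intro card_inj_on_le) auto
  then show ?thesis
    by (simp add: card_Pow)
qed

lemma free_abelian_rank_eqI:
  assumes "group A" "A \<cong> free_Abelian_group {..<r}"
  shows "free_abelian_rank A = r"
  unfolding free_abelian_rank_def
proof (rule the_equality)
  fix s :: nat assume s: "A \<cong> free_Abelian_group {..<s}"
  have le: "s' \<le> r'" if "A \<cong> free_Abelian_group {..<r'}" "A \<cong> free_Abelian_group {..<s'}" for r' s' :: nat
  proof -
    have "free_Abelian_group {..<r'} \<cong> free_Abelian_group {..<s'}"
      using that group.iso_sym [OF assms(1)] iso_trans by blast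
    then obtain f where "f \<in> iso (free_Abelian_group {..<r'}) (free_Abelian_group {..<s'})"
      by (auto simp: is_iso_def)
    then show ?thesis
      by (intro rank_le_of_surj_hom [of f]) (auto simp: iso_def bij_betw_def)
  qed
  show "s = r"
    using le [OF s assms(2)] le [OF assms(2) s] by simp
qed (rule assms(2))

section \<open>Free groups and their universal property\<close>

lemma inv_letter_inv_letter [simp]: "inv_letter (inv_letter a) = a"
  by (simp add: inv_letter_def)

lemma fst_inv_letter [simp]: "fst (inv_letter a) = fst a"
  by (simp add: inv_letter_def)

lemma words_simps [simp]:
  "[] \<in> words n" "a # w \<in> words n \<longleftrightarrow> fst a \<in> {1..n} \<and> w \<in> words n"
  "u @ v \<in> words n \<longleftrightarrow> u \<in> words n \<and> v \<in> words n" "rev w \<in> words n \<longleftrightarrow> w \<in> words n"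
  by (auto simp: words_def)

lemma reduced_Nil [simp]: "reduced []"
  by (simp add: reduced_def)

lemma reduced_Cons: "reduced (a # w) \<longleftrightarrow> reduced w \<and> (w = [] \<or> hd w \<noteq> inv_letter a)"
  by (cases w) (auto simp: reduced_def)

lemma cons_red_reduced: "reduced w \<Longrightarrow> reduced (cons_red a w)"
  by (cases w) (auto simp: reduced_Cons)

lemma cons_red_words: "fst a \<in> {1..n} \<Longrightarrow> w \<in> words n \<Longrightarrow> cons_red a w \<in> words n"
  by (cases w) auto

lemma cons_red_inv: "reduced w \<Longrightarrow> cons_red (inv_letter a) (cons_red a w) = w"
  by (cases w; cases "tl w") (auto simp: reduced_Cons)

lemma cons_red_inv': "reduced w \<Longrightarrow> cons_red a (cons_red (inv_letter a) w) = w"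
  using cons_red_inv [of w "inv_letter a"] by simp

lemma foldr_cons_red_reduced: "reduced v \<Longrightarrow> reduced (foldr cons_red u v)"
  by (induction u) (auto simp: cons_red_reduced)

lemma foldr_cons_red_words: "u \<in> words n \<Longrightarrow> v \<in> words n \<Longrightarrow> foldr cons_red u v \<in> words n"
  by (induction u) (auto intro!: cons_red_words)

lemma foldr_cons_red_cons_red:
  assumes "reduced w"
  shows "foldr cons_red (cons_red a v) w = cons_red a (foldr cons_red v w)"
  using assms by (cases v) (auto simp: cons_red_inv' foldr_cons_red_reduced)

text \<open>Prefixing a letter acts on reduced words, and opposite letters act as inverse permutations, so reducing
the left factor beforehand does not change its action. This makes concatenation with reduction
associative.\<close>
lemma foldr_cons_red_assoc:
  assumes "reduced w"
  shows "foldr cons_red (foldr cons_red u v) w = foldr cons_red u (foldr cons_red v w)"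
  by (induction u) (simp_all add: assms foldr_cons_red_cons_red)

lemma foldr_cons_red_inverse: "foldr cons_red (map inv_letter (rev u)) u = []"
  by (induction u) auto

lemma group_free_group: "group (free_group n)"
proof (rule groupI)
  fix u assume u: "u \<in> carrier (free_group n)"
  define v where "v = foldr cons_red (map inv_letter (rev u)) []"
  have "map inv_letter (rev u) \<in> words n"
    using u by (auto simp: words_def free_group_def)
  then have "v \<in> carrier (free_group n)"
    by (simp add: v_def free_group_def foldr_cons_red_reduced foldr_cons_red_words)
  moreover have "v \<otimes>\<^bsub>free_group n\<^esub> u = \<one>\<^bsub>free_group n\<^esub>"
    using u by (simp add: v_def free_group_def foldr_cons_red_assoc foldr_cons_red_inverse)
  ultimately show "\<exists>v\<in>carrier (free_group n). v \<otimes>\<^bsub>free_group n\<^esub> u = \<one>\<^bsub>free_group n\<^esub>" ..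
qed (auto simp: free_group_def foldr_cons_red_reduced foldr_cons_red_words foldr_cons_red_assoc)

text \<open>Evaluation of words in an arbitrary group; the evaluation in the free nilpotent group used to define
palindromes is the instance for \<open>gen\<close>.\<close>
definition letter_val :: "('a, 'b) monoid_scheme \<Rightarrow> (nat \<Rightarrow> 'a) \<Rightarrow> letter \<Rightarrow> 'a" where
  "letter_val H f a = (if snd a then f (fst a) else inv\<^bsub>H\<^esub> f (fst a))"

definition word_val :: "('a, 'b) monoid_scheme \<Rightarrow> (nat \<Rightarrow> 'a) \<Rightarrow> letter list \<Rightarrow> 'a" where
  "word_val H f w = foldr (\<lambda>a g. letter_val H f a \<otimes>\<^bsub>H\<^esub> g) w \<one>\<^bsub>H\<^esub>"

lemma word_val_simps [simp]:
  "word_val H f [] = \<one>\<^bsub>H\<^esub>"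
  "word_val H f (a # w) = letter_val H f a \<otimes>\<^bsub>H\<^esub> word_val H f w"
  by (simp_all add: word_val_def)

context group begin

lemma letter_val_closed:
  assumes "f \<in> {1..n} \<rightarrow> carrier G" "fst a \<in> {1..n}"
  shows "letter_val G f a \<in> carrier G"
  using assms by (auto simp: letter_val_def)

lemma word_val_closed:
  assumes "f \<in> {1..n} \<rightarrow> carrier G"
  shows "w \<in> words n \<Longrightarrow> word_val G f w \<in> carrier G"
  by (induction w) (simp_all add: letter_val_closed [OF assms])

lemma word_val_append:
  assumes "f \<in> {1..n} \<rightarrow> carrier G" "v \<in> words n"
  shows "u \<in> words n \<Longrightarrow> word_val G f (u @ v) = word_val G f u \<otimes> word_val G f v"
  using assms
  by (induction u) (simp_all add: m_assoc letter_val_closed [OF assms(1)] word_val_closed [OF assms(1)])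

lemma letter_val_inv_letter:
  assumes "f \<in> {1..n} \<rightarrow> carrier G" "fst a \<in> {1..n}"
  shows "letter_val G f (inv_letter a) = inv (letter_val G f a)"
  using assms by (auto simp: letter_val_def inv_letter_def Pi_iff)

lemma word_val_cons_red:
  assumes f: "f \<in> {1..n} \<rightarrow> carrier G" and a: "fst a \<in> {1..n}" and w: "w \<in> words n"
  shows "word_val G f (cons_red a w) = letter_val G f a \<otimes> word_val G f w"
proof (cases w)
  case (Cons b w')
  then show ?thesis
    using w letter_val_closed [OF f a] word_val_closed [OF f, of w'] letter_val_inv_letter [OF f a]
    by (simp add: inv_cancel_left)
qed simp

lemma word_val_foldr_cons_red:
  assumes f: "f \<in> {1..n} \<rightarrow> carrier G" and v: "v \<in> words n"
  shows "u \<in> words n \<Longrightarrow> word_val G f (foldr cons_red u v) = word_val G f u \<otimes> word_val G f v"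
  using v by (induction u)
    (simp_all add: word_val_cons_red [OF f] foldr_cons_red_words m_assoc letter_val_closed [OF f] word_val_closed [OF f])

lemma word_val_hom:
  assumes "f \<in> {1..n} \<rightarrow> carrier G"
  shows "word_val G f \<in> hom (free_group n) G"
  by (rule homI) (simp_all add: free_group_def word_val_closed [OF assms] word_val_foldr_cons_red [OF assms])

end

lemma group_N3: "group (N3 n)"
proof -
  interpret F: group "free_group n" by (rule group_free_group)
  show ?thesis
    unfolding N3_def by (rule normal.factorgroup_is_group [OF F.lower_central_normal])
qed

lemma N3_projection:
  "group_hom (free_group n) (N3 n) (\<lambda>w. lower_central (free_group n) 4 #>\<^bsub>free_group n\<^esub> w)"
proof -
  interpret F: group "free_group n" by (rule group_free_group)
  show ?thesis
    using normal.r_coset_hom_Mod [OF F.lower_central_normal] group_free_group group_N3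
    unfolding N3_def group_hom_def group_hom_axioms_def by blast
qed

lemma carrier_N3:
  "carrier (N3 n) = (\<lambda>w. lower_central (free_group n) 4 #>\<^bsub>free_group n\<^esub> w) ` carrier (free_group n)"
  by (simp add: N3_def carrier_FactGroup)

lemma lower_central_4_N3: "lower_central (N3 n) 4 = {\<one>\<^bsub>N3 n\<^esub>}"
proof -
  interpret p: group_hom "free_group n" "N3 n" "\<lambda>w. lower_central (free_group n) 4 #>\<^bsub>free_group n\<^esub> w"
    by (rule N3_projection)
  let ?K = "lower_central (free_group n) 4"
  have K: "subgroup ?K (free_group n)"
    using p.G.lower_central_normal normal_imp_subgroup by blast
  have "lower_central (N3 n) 4 = (\<lambda>w. ?K #>\<^bsub>free_group n\<^esub> w) ` ?K"
    using p.lower_central_surj_hom carrier_N3 by metis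
  also have "\<dots> = {?K}"
    using p.G.coset_join2 [OF _ K] subgroup.mem_carrier [OF K] subgroup.one_closed [OF K] by blast
  finally show ?thesis
    by (simp add: N3_def)
qed

lemma gen_closed: "gen n \<in> {1..n} \<rightarrow> carrier (N3 n)"
  unfolding carrier_N3 by (auto simp: gen_def free_group_def reduced_Cons intro!: imageI)

lemma letter_value_eq: "letter_value n = letter_val (N3 n) (gen n)"
  by (simp add: fun_eq_iff letter_value_def letter_val_def)

lemma word_value_eq: "word_value n = word_val (N3 n) (gen n)"
  by (simp add: fun_eq_iff word_value_def word_val_def letter_value_eq)

text \<open>Evaluation of words is a homomorphism from the free group. It maps \<open>\<gamma>\<^sub>4\<close> into \<open>\<gamma>\<^sub>4 H = 1\<close>, so it
factors through the quotient.\<close>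
lemma N3_universal:
  assumes H: "group H" "lower_central H 4 = {\<one>\<^bsub>H\<^esub>}" and f: "f \<in> {1..n} \<rightarrow> carrier H"
  obtains h where "h \<in> hom (N3 n) H" "\<And>i. i \<in> {1..n} \<Longrightarrow> h (gen n i) = f i"
proof -
  interpret F: group "free_group n" by (rule group_free_group)
  interpret w: group_hom "free_group n" H "word_val H f"
    using group.word_val_hom [OF H(1) f] H by (simp add: group_hom_def group_hom_axioms_def group_free_group)
  have "word_val H f ` lower_central (free_group n) 4 \<subseteq> {\<one>\<^bsub>H\<^esub>}"
    using w.lower_central_hom H(2) by blast
  then have "lower_central (free_group n) 4 \<subseteq> kernel (free_group n) H (word_val H f)"
    using F.lower_central_subset by (auto simp: kernel_def)
  then obtain h where h: "h \<in> hom (N3 n) H"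
    "\<And>w. w \<in> carrier (free_group n) \<Longrightarrow>
      h (lower_central (free_group n) 4 #>\<^bsub>free_group n\<^esub> w) = word_val H f w"
    using w.FactGroup_universal_kernel [OF F.lower_central_normal] unfolding N3_def by metis
  show thesis
  proof
    fix i assume i: "i \<in> {1..n}"
    then have "h (gen n i) = word_val H f [(i, True)]"
      unfolding gen_def by (intro h) (simp add: free_group_def reduced_Cons)
    then show "h (gen n i) = f i"
      using f i H(1) by (auto simp: letter_val_def group.is_monoid monoid.r_one Pi_iff)
  qed (rule h)
qed

text \<open>The representing word is the reduced word itself: on words of the free group the projection and the
evaluation agree, letter by letter.\<close>
lemma N3_surj_word_value:
  assumes "g \<in> carrier (N3 n)"
  obtains w where "w \<in> words n" "g = word_value n w"
proof -
  interpret p: group_hom "free_group n" "N3 n" "\<lambda>w. lower_central (free_group n) 4 #>\<^bsub>free_group n\<^esub> w"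
    by (rule N3_projection)
  let ?p = "\<lambda>w. lower_central (free_group n) 4 #>\<^bsub>free_group n\<^esub> w"
  have *: "w \<in> words n \<Longrightarrow> reduced w \<Longrightarrow> ?p w = word_value n w" for w
  proof (induction w)
    case Nil
    then show ?case
      using p.hom_one by (simp add: word_value_eq free_group_def)
  next
    case (Cons a w)
    have gi: "?p [(i, True)] = gen n i" for i
      by (simp add: gen_def)
    have a: "fst a \<in> {1..n}" "[a] \<in> carrier (free_group n)" "[(fst a, True)] \<in> carrier (free_group n)"
      using Cons.prems by (auto simp: free_group_def reduced_Cons)
    have w: "w \<in> carrier (free_group n)" 
      using Cons.prems by (auto simp: free_group_def reduced_Cons)
    have "?p [a] = letter_value n a"
    proof (cases "snd a")
      case True
      then show ?thesis
        by (cases a) (simp add: letter_value_def gen_def)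
    next
      case False
      have "[a] \<otimes>\<^bsub>free_group n\<^esub> [(fst a, True)] = \<one>\<^bsub>free_group n\<^esub>"
        using False by (cases a) (simp add: free_group_def inv_letter_def)
      then have "[a] = inv\<^bsub>free_group n\<^esub> [(fst a, True)]"
        using a p.G.inv_equality by metis
      then show ?thesis
        using a False by (simp add: letter_value_def gi)
    qed
    moreover have "a # w = [a] \<otimes>\<^bsub>free_group n\<^esub> w"
      using Cons.prems by (cases w) (auto simp: free_group_def reduced_Cons)
    then have "?p (a # w) = ?p [a] \<otimes>\<^bsub>N3 n\<^esub> ?p w"
      using p.hom_mult [OF a(2) w] by simp
    ultimately show ?case
      using Cons by (auto simp: word_value_eq letter_value_eq reduced_Cons)
  qed
  from assms obtain w where "w \<in> words n" "reduced w" "g = ?p w"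
    unfolding carrier_N3 by (auto simp: free_group_def)
  then show thesis
    using * that by metis
qed

lemma N3_generated: "carrier (N3 n) = generate (N3 n) (gen n ` {1..n})"
proof
  interpret N: group "N3 n" by (rule group_N3)
  show "generate (N3 n) (gen n ` {1..n}) \<subseteq> carrier (N3 n)"
    using gen_closed by (intro N.generate_incl) auto
  have "word_value n w \<in> generate (N3 n) (gen n ` {1..n})" if "w \<in> words n" for w
    using that
  proof (induction w)
    case (Cons a w)
    then have "letter_value n a \<in> generate (N3 n) (gen n ` {1..n})"
      by (auto simp: letter_value_def intro: generate.intros)
    with Cons show ?case
      by (auto simp: word_value_eq letter_value_eq intro: generate.eng)
  qed (simp add: word_value_eq generate.one)
  then show "carrier (N3 n) \<subseteq> generate (N3 n) (gen n ` {1..n})"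
    using N3_surj_word_value by (metis subsetI)
qed

section \<open>The Magnus group of power series truncated after degree three\<close>

text \<open>The coefficients of degree one, two and three of a power series with constant term one in noncommuting
variables \<open>X\<^sub>1, X\<^sub>2, \<dots>\<close>; terms of degree at least four are discarded.\<close>
type_synonym series3 = "(nat \<Rightarrow> int) \<times> (nat \<Rightarrow> nat \<Rightarrow> int) \<times> (nat \<Rightarrow> nat \<Rightarrow> nat \<Rightarrow> int)"

definition deg1 :: "series3 \<Rightarrow> nat \<Rightarrow> int" where "deg1 f = fst f"
definition deg2 :: "series3 \<Rightarrow> nat \<Rightarrow> nat \<Rightarrow> int" where "deg2 f = fst (snd f)"
definition deg3 :: "series3 \<Rightarrow> nat \<Rightarrow> nat \<Rightarrow> nat \<Rightarrow> int" where "deg3 f = snd (snd f)"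

definition magnus :: "series3 monoid" where
  "magnus = \<lparr>carrier = UNIV,
     monoid.mult = (\<lambda>f g.
       (\<lambda>i. deg1 f i + deg1 g i,
        \<lambda>i j. deg2 f i j + deg1 f i * deg1 g j + deg2 g i j,
        \<lambda>i j k. deg3 f i j k + deg2 f i j * deg1 g k + deg1 f i * deg2 g j k + deg3 g i j k)),
     one = (\<lambda>_. 0, \<lambda>_ _. 0, \<lambda>_ _ _. 0)\<rparr>"

text \<open>The series \<open>1 + X\<^sub>a\<close>.\<close>
definition magnus_gen :: "nat \<Rightarrow> series3" where
  "magnus_gen a = (\<lambda>i. of_bool (i = a), \<lambda>_ _. 0, \<lambda>_ _ _. 0)"

lemma series3_eqI:
  assumes "\<And>i. deg1 f i = deg1 g i" "\<And>i j. deg2 f i j = deg2 g i j" "\<And>i j k. deg3 f i j k = deg3 g i j k"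
  shows "f = g"
  using assms by (simp add: prod_eq_iff deg1_def deg2_def deg3_def fun_eq_iff)

lemma carrier_magnus [simp]: "carrier magnus = UNIV"
  by (simp add: magnus_def)

lemma deg_mult [simp]:
  "deg1 (f \<otimes>\<^bsub>magnus\<^esub> g) i = deg1 f i + deg1 g i"
  "deg2 (f \<otimes>\<^bsub>magnus\<^esub> g) i j = deg2 f i j + deg1 f i * deg1 g j + deg2 g i j"
  "deg3 (f \<otimes>\<^bsub>magnus\<^esub> g) i j k =
     deg3 f i j k + deg2 f i j * deg1 g k + deg1 f i * deg2 g j k + deg3 g i j k"
  by (simp_all add: magnus_def deg1_def deg2_def deg3_def)

lemma deg_one [simp]:
  "deg1 \<one>\<^bsub>magnus\<^esub> i = 0" "deg2 \<one>\<^bsub>magnus\<^esub> i j = 0" "deg3 \<one>\<^bsub>magnus\<^esub> i j k = 0"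
  by (simp_all add: magnus_def deg1_def deg2_def deg3_def)

lemma deg_magnus_gen [simp]:
  "deg1 (magnus_gen a) i = of_bool (i = a)"
  "deg2 (magnus_gen a) i j = 0" "deg3 (magnus_gen a) i j k = 0"
  by (simp_all add: magnus_gen_def deg1_def deg2_def deg3_def)

lemma group_magnus: "group magnus"
proof (rule groupI)
  fix f :: series3
  define g :: series3 where "g = (\<lambda>i. - deg1 f i, \<lambda>i j. deg1 f i * deg1 f j - deg2 f i j,
    \<lambda>i j k. deg1 f i * deg2 f j k + deg2 f i j * deg1 f k - deg1 f i * deg1 f j * deg1 f k - deg3 f i j k)"
  have g: "deg1 g i = - deg1 f i" "deg2 g i j = deg1 f i * deg1 f j - deg2 f i j"
    "deg3 g i j k = deg1 f i * deg2 f j k + deg2 f i j * deg1 f k - deg1 f i * deg1 f j * deg1 f k - deg3 f i j k" for i j k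
    by (simp_all add: g_def deg1_def deg2_def deg3_def)
  have "g \<otimes>\<^bsub>magnus\<^esub> f = \<one>\<^bsub>magnus\<^esub>"
    by (intro series3_eqI) (simp_all only: deg_mult deg_one g, simp_all add: algebra_simps)
  then show "\<exists>g\<in>carrier magnus. g \<otimes>\<^bsub>magnus\<^esub> f = \<one>\<^bsub>magnus\<^esub>"
    by (intro bexI [of _ g]) simp_all
qed (auto intro!: series3_eqI simp: algebra_simps)

interpretation magnus: group magnus
  by (rule group_magnus)

text \<open>Comparing coefficients in \<open>g f [f, g] = f g\<close> yields the commutator without computing inverses.\<close>
lemma deg_commutator:
  "deg1 (commutator magnus f g) i = 0"
  "deg2 (commutator magnus f g) i j = deg1 f i * deg1 g j - deg1 g i * deg1 f j"
proof -
  have *: "(g \<otimes>\<^bsub>magnus\<^esub> f) \<otimes>\<^bsub>magnus\<^esub> commutator magnus f g = f \<otimes>\<^bsub>magnus\<^esub> g"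
    by (simp add: commutator_def magnus.free_reduction)
  show 1: "deg1 (commutator magnus f g) i = 0" for i
    using arg_cong [OF *, of "\<lambda>f. deg1 f i"] by simp
  show "deg2 (commutator magnus f g) i j = deg1 f i * deg1 g j - deg1 g i * deg1 f j"
    using arg_cong [OF *, of "\<lambda>f. deg2 f i j"] by (simp add: 1)
qed

lemma deg3_commutator:
  assumes f: "\<And>i. deg1 f i = 0"
  shows "deg3 (commutator magnus f g) i j k = deg2 f i j * deg1 g k - deg1 g i * deg2 f j k"
proof -
  have *: "(g \<otimes>\<^bsub>magnus\<^esub> f) \<otimes>\<^bsub>magnus\<^esub> commutator magnus f g = f \<otimes>\<^bsub>magnus\<^esub> g"
    by (simp add: commutator_def magnus.free_reduction)
  show ?thesis
    using arg_cong [OF *, of "\<lambda>f. deg3 f i j k"] by (simp add: deg_commutator f)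
qed

lemma commutator_magnus_trivial:
  assumes "\<And>i. deg1 f i = 0" "\<And>i j. deg2 f i j = 0"
  shows "commutator magnus f g = \<one>\<^bsub>magnus\<^esub>"
  using assms by (intro series3_eqI) (simp_all add: deg_commutator deg3_commutator)

lemma deg_inv:
  "deg1 (inv\<^bsub>magnus\<^esub> f) i = - deg1 f i"
  "deg2 (inv\<^bsub>magnus\<^esub> f) i j = deg1 f i * deg1 f j - deg2 f i j"
proof -
  have *: "inv\<^bsub>magnus\<^esub> f \<otimes>\<^bsub>magnus\<^esub> f = \<one>\<^bsub>magnus\<^esub>"
    by simp
  show 1: "deg1 (inv\<^bsub>magnus\<^esub> f) i = - deg1 f i" for i
    using arg_cong [OF *, of "\<lambda>f. deg1 f i"] unfolding deg_mult deg_one by linarith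
  show "deg2 (inv\<^bsub>magnus\<^esub> f) i j = deg1 f i * deg1 f j - deg2 f i j"
    using arg_cong [OF *, of "\<lambda>f. deg2 f i j"] unfolding deg_mult deg_one 1 by linarith
qed

lemma lower_central_2_magnus: "f \<in> lower_central magnus 2 \<Longrightarrow> deg1 f i = 0"
proof -
  have "subgroup {f. \<forall>i. deg1 f i = 0} magnus"
    by (rule subgroup.intro) (auto simp: deg_inv)
  then have "lower_central magnus 2 \<subseteq> {f. \<forall>i. deg1 f i = 0}"
    unfolding magnus.lower_central_2
    by (intro magnus.generate_subgroup_incl) (auto simp: deg_commutator)
  then show "f \<in> lower_central magnus 2 \<Longrightarrow> deg1 f i = 0" by blast
qed

lemma lower_central_3_magnus: "f \<in> lower_central magnus 3 \<Longrightarrow> deg1 f i = 0 \<and> deg2 f i j = 0"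
proof -
  have "subgroup {f. (\<forall>i. deg1 f i = 0) \<and> (\<forall>i j. deg2 f i j = 0)} magnus"
    by (rule subgroup.intro) (auto simp: deg_inv)
  then have "lower_central magnus 3 \<subseteq> {f. (\<forall>i. deg1 f i = 0) \<and> (\<forall>i j. deg2 f i j = 0)}"
    unfolding magnus.lower_central_3
    by (intro magnus.generate_subgroup_incl) (auto simp: deg_commutator lower_central_2_magnus)
  then show "f \<in> lower_central magnus 3 \<Longrightarrow> deg1 f i = 0 \<and> deg2 f i j = 0" by blast
qed

text \<open>Each commutator with an element of the group raises the degree of the lowest nonconstant term, and
after three steps nothing is left below degree four.\<close>
lemma lower_central_4_magnus: "lower_central magnus 4 = {\<one>\<^bsub>magnus\<^esub>}"
proof -
  have "lower_central magnus (Suc (Suc (Suc (Suc 0)))) \<subseteq> {\<one>\<^bsub>magnus\<^esub>}"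
    unfolding lower_central.simps(3) [of magnus "Suc (Suc 0)"]
    using magnus.triv_subgroup lower_central_3_magnus [unfolded numeral_3_eq_3]
    by (intro magnus.generate_subgroup_incl) (auto intro!: commutator_magnus_trivial)
  moreover have "(4::nat) = Suc (Suc (Suc (Suc 0)))" by simp
  ultimately show ?thesis
    using subgroup.one_closed [OF normal_imp_subgroup [OF magnus.lower_central_normal [of 4]]]
    by (simp only:) blast
qed

section \<open>Commutator calculus in class three\<close>

locale class3_group = group +
  assumes lower_central_4: "lower_central G 4 = {\<one>}"
begin

abbreviation T where "T \<equiv> commutator3 G"

lemma lower_central_3_subset_2: "lower_central G 3 \<subseteq> lower_central G 2"
  unfolding lower_central_3
  by (rule generate_subgroup_incl [OF _ lower_central_subgroup])
     (auto intro: commutator_lower_central_2 lower_central_carrier)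

lemma lower_central_3_central:
  assumes "z \<in> lower_central G 3" "g \<in> carrier G"
  shows "z \<otimes> g = g \<otimes> z"
proof -
  have eq: "(4::nat) = Suc (Suc (Suc (Suc 0)))" by simp
  have "commutator G z g \<in> lower_central G 4"
    using assms unfolding eq lower_central.simps(3) [of G "Suc (Suc 0)"] numeral_3_eq_3
    by (blast intro: generate.incl)
  then show ?thesis
    using assms lower_central_4 lower_central_carrier by (simp add: commutator_eq_one_iff)
qed

lemma commutator_lower_central_3_one:
  "z \<in> lower_central G 3 \<Longrightarrow> g \<in> carrier G \<Longrightarrow> commutator G z g = \<one>"
  by (simp add: commutator_eq_one_iff lower_central_3_central lower_central_carrier)

lemma commutator3_lower_central:
  "g \<in> carrier G \<Longrightarrow> h \<in> carrier G \<Longrightarrow> k \<in> carrier G \<Longrightarrow> T g h k \<in> lower_central G 3"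
  by (simp add: commutator3_def commutator_lower_central_2 commutator_lower_central_3)

lemma commutator3_closed [simp]:
  "g \<in> carrier G \<Longrightarrow> h \<in> carrier G \<Longrightarrow> k \<in> carrier G \<Longrightarrow> T g h k \<in> carrier G"
  by (simp add: commutator3_def)

text \<open>The correction term \<open>[u, g, h]\<close> in \<open>[u, gh] = [u, h] [u, g] [u, g, h]\<close> lies in \<open>\<gamma>\<^sub>4\<close> when
\<open>u \<in> \<gamma>\<^sub>2\<close>.\<close>
lemma commutator_hom_right:
  assumes u: "u \<in> lower_central G 2"
  shows "commutator G u \<in> hom G G"
proof (rule homI)
  fix g h assume gh: "g \<in> carrier G" "h \<in> carrier G"
  have u': "u \<in> carrier G" using u lower_central_carrier by blast
  have "T u g h = \<one>"
    using u gh by (simp add: commutator3_def commutator_lower_central_3 commutator_lower_central_3_one)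
  moreover have "commutator G u h \<otimes> commutator G u g = commutator G u g \<otimes> commutator G u h"
    using u u' gh by (intro lower_central_3_central) (simp_all add: commutator_lower_central_3)
  ultimately show "commutator G u (g \<otimes> h) = commutator G u g \<otimes> commutator G u h"
    using u' gh by (simp add: commutator_mult_right)
qed (use u lower_central_carrier in auto)

text \<open>Commuting with \<open>u \<in> \<gamma>\<^sub>2\<close> is measured by the homomorphism \<open>[u, -]\<close> into the centre. It kills all
commutators, hence \<open>\<gamma>\<^sub>2\<close>.\<close>
lemma lower_central_2_commutes:
  assumes u: "u \<in> lower_central G 2" and v: "v \<in> lower_central G 2"
  shows "u \<otimes> v = v \<otimes> u"
proof -
  have u': "u \<in> carrier G" using u lower_central_carrier by blast
  interpret c: group_hom G G "commutator G u"
    using commutator_hom_right [OF u] by (simp add: group_hom_def group_hom_axioms_def)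
  have "commutator G u v \<in> {\<one>}"
  proof (rule c.subgroup_contains_image_of_generate)
    show "v \<in> generate G {commutator G g h |g h. g \<in> carrier G \<and> h \<in> carrier G}"
      using v by (simp add: lower_central_2)
    show "commutator G u ` {commutator G g h |g h. g \<in> carrier G \<and> h \<in> carrier G} \<subseteq> {\<one>}"
      using u u' by (auto simp: c.hom_commutator commutator_lower_central_3 commutator_lower_central_3_one)
  qed (auto intro: triv_subgroup)
  then show ?thesis
    using u' v lower_central_carrier by (simp add: commutator_eq_one_iff)
qed

abbreviation \<Gamma>\<^sub>2 where "\<Gamma>\<^sub>2 \<equiv> G\<lparr>carrier := lower_central G 2\<rparr>"
abbreviation \<Gamma>\<^sub>3 where "\<Gamma>\<^sub>3 \<equiv> G\<lparr>carrier := lower_central G 3\<rparr>"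

lemma comm_group_\<Gamma>\<^sub>2: "comm_group \<Gamma>\<^sub>2"
  by (rule group.group_comm_groupI [OF subgroup_imp_group [OF lower_central_subgroup]])
     (simp add: lower_central_2_commutes)

lemma comm_group_\<Gamma>\<^sub>3: "comm_group \<Gamma>\<^sub>3"
  by (rule group.group_comm_groupI [OF subgroup_imp_group [OF lower_central_subgroup]])
     (simp add: lower_central_3_central lower_central_carrier)

lemma commutator_hom_left:
  assumes h: "h \<in> carrier G"
  shows "(\<lambda>u. commutator G u h) \<in> hom \<Gamma>\<^sub>2 G"
proof (rule homI)
  fix u v assume uv: "u \<in> carrier \<Gamma>\<^sub>2" "v \<in> carrier \<Gamma>\<^sub>2"
  then have uv': "u \<in> carrier G" "v \<in> carrier G" 
    using lower_central_carrier by auto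
  have "T u h v = \<one>"
    using uv h uv' by (simp add: commutator3_def commutator_lower_central_3 commutator_lower_central_3_one)
  then show "commutator G (u \<otimes>\<^bsub>\<Gamma>\<^sub>2\<^esub> v) h = commutator G u h \<otimes> commutator G v h"
    using uv' h by (simp add: commutator_mult_left)
qed (use h lower_central_carrier in auto)

lemma commutator_hom_left_mult:
  assumes "h \<in> carrier G" "u \<in> lower_central G 2" "v \<in> lower_central G 2"
  shows "commutator G (u \<otimes> v) h = commutator G u h \<otimes> commutator G v h"
  using hom_mult [OF commutator_hom_left [OF assms(1)], of u v] assms by simp

lemma commutator3_hom_1:
  assumes "h \<in> carrier G" "k \<in> carrier G"
  shows "(\<lambda>g. T g h k) \<in> hom G G"
proof (rule homI)
  fix g g' assume g: "g \<in> carrier G" "g' \<in> carrier G"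
  have c: "commutator G g h \<in> lower_central G 2" "commutator G g' h \<in> lower_central G 2"
    "T g h g' \<in> lower_central G 2"
    using assms g commutator_lower_central_2 commutator3_lower_central lower_central_3_subset_2
    by blast+
  then have "commutator G g h \<otimes> T g h g' \<in> lower_central G 2"
    by (simp add: subgroup.m_closed [OF lower_central_subgroup])
  note c = c this
  have "commutator G (T g h g') k = \<one>"
    using assms g by (simp add: commutator3_lower_central commutator_lower_central_3_one)
  then have "commutator G (commutator G g h \<otimes> T g h g' \<otimes> commutator G g' h) k
      = commutator G (commutator G g h) k \<otimes> commutator G (commutator G g' h) k"
    using assms(2) c assms g by (simp add: commutator_hom_left_mult)
  then show "T (g \<otimes> g') h k = T g h k \<otimes> T g' h k"
    using commutator_mult_left [OF g assms(1)]
    by (simp add: commutator3_def [of G "g \<otimes> g'" h k] commutator3_def [of G g h k]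
        commutator3_def [of G g' h k])
qed (use assms in auto)

text \<open>The commutator with \<open>k\<close> is a homomorphism on \<open>\<gamma>\<^sub>2\<close>, and \<open>[h, g] = [g, h]\<^sup>-\<^sup>1\<close>.\<close>
lemma commutator3_antisym:
  assumes "g \<in> carrier G" "h \<in> carrier G" "k \<in> carrier G"
  shows "T h g k = inv (T g h k)"
proof -
  have *: "commutator G (inv u) k = inv (commutator G u k)" if "u \<in> lower_central G 2" for u
  proof -
    interpret c: group_hom \<Gamma>\<^sub>2 G "\<lambda>u. commutator G u k"
      using commutator_hom_left assms subgroup_imp_group [OF lower_central_subgroup]
      by (simp add: group_hom_def group_hom_axioms_def)
    show ?thesis
      using c.hom_inv [of u] that m_inv_consistent [OF lower_central_subgroup that] by simp
  qed
  show ?thesis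
    using * [of "commutator G g h"] assms
    by (simp add: commutator3_def inv_commutator commutator_lower_central_2)
qed

lemma commutator3_same: "g \<in> carrier G \<Longrightarrow> k \<in> carrier G \<Longrightarrow> T g g k = \<one>"
  by (simp add: commutator3_def commutator_self commutator_eq_one_iff)

lemma commutator3_hom_2:
  assumes "g \<in> carrier G" "k \<in> carrier G"
  shows "(\<lambda>h. T g h k) \<in> hom G G"
proof (rule homI)
  fix h h' assume h: "h \<in> carrier G" "h' \<in> carrier G"
  have "T (h \<otimes> h') g k = T h g k \<otimes> T h' g k"
    using hom_mult [OF commutator3_hom_1] assms h by simp
  moreover have "T h' g k \<otimes> T h g k = T h g k \<otimes> T h' g k"
    using assms h by (intro lower_central_3_central commutator3_lower_central) auto
  ultimately have "T (h \<otimes> h') g k = T h' g k \<otimes> T h g k"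
    by simp
  then show "T g (h \<otimes> h') k = T g h k \<otimes> T g h' k"
    using assms h by (simp add: commutator3_antisym [of _ g k] inv_mult_group)
qed (use assms in auto)

lemma commutator3_hom_3:
  assumes "g \<in> carrier G" "h \<in> carrier G"
  shows "T g h \<in> hom G G"
proof -
  have "T g h = commutator G (commutator G g h)"
    by (simp add: fun_eq_iff commutator3_def)
  then show ?thesis
    using commutator_hom_right [OF commutator_lower_central_2 [OF assms]] by simp
qed

lemma commutator3_inv:
  assumes "g \<in> carrier G" "h \<in> carrier G" "k \<in> carrier G"
  shows "T (inv g) h k = inv (T g h k)" "T g (inv h) k = inv (T g h k)" "T g h (inv k) = inv (T g h k)"
proof -
  have hom_inv: "f (inv u) = inv (f u)" if "f \<in> hom G G" "u \<in> carrier G" for f u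
    using that group_hom.hom_inv [of G G f u] is_group by (simp add: group_hom_def group_hom_axioms_def)
  show "T (inv g) h k = inv (T g h k)" "T g (inv h) k = inv (T g h k)" "T g h (inv k) = inv (T g h k)"
    using hom_inv [OF commutator3_hom_1 [OF assms(2,3)] assms(1)]
      hom_inv [OF commutator3_hom_2 [OF assms(1,3)] assms(2)]
      hom_inv [OF commutator3_hom_3 [OF assms(1,2)] assms(3)] by simp_all
qed

lemma conj_lower_central_3:
  assumes "z \<in> lower_central G 3" "g \<in> carrier G"
  shows "inv g \<otimes> z \<otimes> g = z"
  using assms lower_central_3_central [of z g] lower_central_carrier
  by (simp add: m_assoc inv_cancel_left)

text \<open>The Hall--Witt identity with the central factors freed from conjugation. It is solved for
\<open>[x, y, z]\<close>, the form in which it rewrites a triple commutator into basic ones.\<close>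
lemma commutator3_Jacobi:
  assumes x: "x \<in> carrier G" and y: "y \<in> carrier G" and z: "z \<in> carrier G"
  shows "T x y z = inv (T y z x) \<otimes> inv (T z x y)"
proof -
  have conj: "inv h \<otimes> T g (inv h) k \<otimes> h = inv (T g h k)"
    if "g \<in> carrier G" "h \<in> carrier G" "k \<in> carrier G" for g h k
    using that conj_lower_central_3 [OF commutator3_lower_central, of g "inv h" k h]
    by (simp add: commutator3_inv)
  have "inv (T x y z) \<otimes> (inv (T y z x) \<otimes> inv (T z x y)) = \<one>"
    using Hall_Witt [OF assms] assms unfolding conj [OF x y z] conj [OF y z x] conj [OF z x y]
    by (simp add: m_assoc)
  then have "inv (inv (T y z x) \<otimes> inv (T z x y)) = inv (T x y z)"
    using assms by (intro inv_equality) simp_all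
  then have "inv (inv (inv (T y z x) \<otimes> inv (T z x y))) = inv (inv (T x y z))"
    by (rule arg_cong)
  then show ?thesis
    using assms by (simp del: inv_mult_group)
qed

end

text \<open>The index pairs and triples of the basic commutators of weight two and three.\<close>
definition basic2 :: "nat \<Rightarrow> (nat \<times> nat) set" where
  "basic2 n = {(a, b). 1 \<le> b \<and> b < a \<and> a \<le> n}"

definition basic3 :: "nat \<Rightarrow> (nat \<times> nat \<times> nat) set" where
  "basic3 n = {(a, b, c). 1 \<le> b \<and> b < a \<and> a \<le> n \<and> b \<le> c \<and> c \<le> n}"

lemma finite_basic2 [simp]: "finite (basic2 n)"
  by (rule finite_subset [of _ "{1..n} \<times> {1..n}"]) (auto simp: basic2_def)

lemma finite_basic3 [simp]: "finite (basic3 n)"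
  by (rule finite_subset [of _ "{1..n} \<times> {1..n} \<times> {1..n}"]) (auto simp: basic3_def)

locale class3_generated = class3_group +
  fixes n :: nat and x :: "nat \<Rightarrow> 'a"
  assumes x: "x \<in> {1..n} \<rightarrow> carrier G" and generated: "carrier G = generate G (x ` {1..n})"
begin

lemma x_closed [simp]: "1 \<le> i \<Longrightarrow> i \<le> n \<Longrightarrow> x i \<in> carrier G"
  using x by auto

definition basic_comm2 where "basic_comm2 = (\<lambda>(a, b). commutator G (x a) (x b))"
definition basic_comm3 where "basic_comm3 = (\<lambda>(a, b, c). T (x a) (x b) (x c))"

lemma basic_comm3_lower_central: "s \<in> basic3 n \<Longrightarrow> basic_comm3 s \<in> lower_central G 3"
  by (auto simp: basic3_def basic_comm3_def intro!: commutator3_lower_central)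

lemma basic_comm2_lower_central: "s \<in> basic2 n \<Longrightarrow> basic_comm2 s \<in> lower_central G 2"
  by (auto simp: basic2_def basic_comm2_def intro!: commutator_lower_central_2)

text \<open>Trilinearity of \<open>[g, h, k]\<close> is used through this principle: a homomorphism is checked on the generators,
one argument at a time.\<close>
lemma hom_into_subgroup:
  assumes f: "f \<in> hom G G" and K: "subgroup K G"
    and gens: "\<And>i. 1 \<le> i \<Longrightarrow> i \<le> n \<Longrightarrow> f (x i) \<in> K" and g: "g \<in> carrier G"
  shows "f g \<in> K"
proof -
  interpret f: group_hom G G f
    using f by (simp add: group_hom_def group_hom_axioms_def)
  have "g \<in> generate G (x ` {1..n})"
    using g by (simp only: generated)
  then show ?thesis
    by (rule f.subgroup_contains_image_of_generate [OF _ K, rotated 2]) (use gens x in auto)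
qed

text \<open>If \<open>c < b < a\<close>, the Jacobi identity expresses \<open>[x\<^sub>a, x\<^sub>b, x\<^sub>c]\<close> by \<open>[x\<^sub>b, x\<^sub>c, x\<^sub>a]\<close> and
\<open>[x\<^sub>a, x\<^sub>c, x\<^sub>b]\<close>, which are basic; the remaining cases follow by antisymmetry in the first two arguments.\<close>
lemma commutator3_gens_mem:
  assumes K: "subgroup K G" and basic: "basic_comm3 ` basic3 n \<subseteq> K"
    and a: "1 \<le> a" "a \<le> n" and b: "1 \<le> b" "b \<le> n" and c: "1 \<le> c" "c \<le> n"
  shows "T (x a) (x b) (x c) \<in> K"
proof -
  have basic': "T (x a) (x b) (x c) \<in> K" if "b < a" "b \<le> c" "1 \<le> b" "a \<le> n" "c \<le> n" for a b c
    using basic that by (force simp: basic_comm3_def basic3_def)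
  have inv: "inv y \<in> K" if "y \<in> K" for y
    using that subgroup.m_inv_closed [OF K] by simp
  have less: "T (x a) (x b) (x c) \<in> K"
    if "b < a" "1 \<le> b" "a \<le> n" "1 \<le> c" "c \<le> n" for a b c
  proof (cases "b \<le> c")
    case False
    have "T (x a) (x b) (x c) = inv (T (x b) (x c) (x a)) \<otimes> inv (T (x c) (x a) (x b))"
      using that by (intro commutator3_Jacobi) auto
    also have "T (x c) (x a) (x b) = inv (T (x a) (x c) (x b))"
      using that by (intro commutator3_antisym) auto
    finally have "T (x a) (x b) (x c) = inv (T (x b) (x c) (x a)) \<otimes> T (x a) (x c) (x b)"
      using that by simp
    then show ?thesis
      using basic' [of c b a] basic' [of c a b] that False inv subgroup.m_closed [OF K] by simp
  qed (use basic' that in auto)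
  consider "a = b" | "b < a" | "a < b" by linarith
  then show ?thesis
  proof cases
    case 1
    then show ?thesis using a c subgroup.one_closed [OF K] by (simp add: commutator3_same)
  next
    case 2
    then show ?thesis using less a b c by blast
  next
    case 3
    then have "T (x a) (x b) (x c) = inv (T (x b) (x a) (x c))"
      using a b c by (intro commutator3_antisym) auto
    then show ?thesis using less [of a b c] 3 a b c inv by simp
  qed
qed

lemma lower_central_3_basic: "lower_central G 3 = generate G (basic_comm3 ` basic3 n)"
proof
  let ?K = "generate G (basic_comm3 ` basic3 n)"
  have sub: "basic_comm3 ` basic3 n \<subseteq> lower_central G 3"
    using basic_comm3_lower_central by blast
  then show "?K \<subseteq> lower_central G 3"
    using generate_subgroup_incl lower_central_subgroup by blast
  have K: "subgroup ?K G"
    using sub lower_central_subset by (intro generate_is_subgroup) blast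
  have incl: "basic_comm3 ` basic3 n \<subseteq> ?K"
    by (auto intro: generate.incl)
  have 1: "T (x a) (x b) k \<in> ?K" if "1 \<le> a" "a \<le> n" "1 \<le> b" "b \<le> n" "k \<in> carrier G" for a b k
    by (rule hom_into_subgroup [OF commutator3_hom_3 K])
       (use that commutator3_gens_mem [OF K incl] in auto)
  have 2: "T (x a) h k \<in> ?K" if "1 \<le> a" "a \<le> n" "h \<in> carrier G" "k \<in> carrier G" for a h k
    by (rule hom_into_subgroup [OF commutator3_hom_2 K]) (use that 1 in auto)
  have 3: "T g h k \<in> ?K" if "g \<in> carrier G" "h \<in> carrier G" "k \<in> carrier G" for g h k
    by (rule hom_into_subgroup [OF commutator3_hom_1 K]) (use that 2 in auto)
  have 4: "commutator G u k \<in> ?K" if u: "u \<in> lower_central G 2" and k: "k \<in> carrier G" for u k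
  proof -
    let ?C = "{commutator G g h |g h. g \<in> carrier G \<and> h \<in> carrier G}"
    interpret c: group_hom \<Gamma>\<^sub>2 G "\<lambda>u. commutator G u k"
      using commutator_hom_left [OF k] subgroup_imp_group [OF lower_central_subgroup]
      by (simp add: group_hom_def group_hom_axioms_def)
    have C: "?C \<subseteq> lower_central G 2"
      using commutator_lower_central_2 by blast
    show ?thesis
    proof (rule c.subgroup_contains_image_of_generate [OF _ K, of ?C])
      show "(\<lambda>u. commutator G u k) ` ?C \<subseteq> ?K"
        using 3 k by (auto simp: commutator3_def)
      show "u \<in> generate \<Gamma>\<^sub>2 ?C"
        using u generate_consistent [OF C lower_central_subgroup] lower_central_2 by blast
    qed (use C in simp)
  qed
  show "lower_central G 3 \<subseteq> ?K"
    unfolding lower_central_3 by (rule generate_subgroup_incl [OF _ K]) (use 4 in blast)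
qed

text \<open>Modulo \<open>\<gamma>\<^sub>3\<close> the commutator is bilinear, so \<open>[g, h]\<close> reduces to commutators of generators. The
correction terms are triple commutators, which the right hand side contains by \<open>lower_central_3_basic\<close>.\<close>
lemma lower_central_2_basic: "lower_central G 2 = generate G (basic_comm2 ` basic2 n \<union> basic_comm3 ` basic3 n)"
proof
  let ?K = "generate G (basic_comm2 ` basic2 n \<union> basic_comm3 ` basic3 n)"
  have sub: "basic_comm2 ` basic2 n \<union> basic_comm3 ` basic3 n \<subseteq> lower_central G 2"
    using basic_comm3_lower_central basic_comm2_lower_central lower_central_3_subset_2 by blast
  then show "?K \<subseteq> lower_central G 2"
    using generate_subgroup_incl lower_central_subgroup by blast
  have K: "subgroup ?K G"
    using sub lower_central_subset by (intro generate_is_subgroup) blast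
  have 3: "lower_central G 3 \<subseteq> ?K"
    unfolding lower_central_3_basic by (rule mono_generate) blast
  have inv: "inv y \<in> ?K" if "y \<in> ?K" for y
    using that subgroup.m_inv_closed [OF K] by simp
  note mult = subgroup.m_closed [OF K]
  have swap: "commutator G h g \<in> ?K" if "commutator G g h \<in> ?K" "g \<in> carrier G" "h \<in> carrier G" for g h
    using inv [OF that(1)] that by (simp add: inv_commutator)
  have left: "commutator G g h \<in> ?K"
    if h: "h \<in> carrier G" and gens: "\<And>i. 1 \<le> i \<Longrightarrow> i \<le> n \<Longrightarrow> commutator G (x i) h \<in> ?K"
      and g: "g \<in> carrier G" for g h
  proof -
    have prod: "commutator G (g \<otimes> g') h \<in> ?K"
      if "commutator G g h \<in> ?K" "commutator G g' h \<in> ?K" "g \<in> carrier G" "g' \<in> carrier G" for g g'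
      using that h 3 commutator3_lower_central [of g h g'] by (auto simp: commutator_mult_left intro!: mult)
    have "g \<in> generate G (x ` {1..n})"
      using g by (simp only: generated)
    then have "g \<in> carrier G \<and> commutator G g h \<in> ?K"
    proof (induction rule: generate.induct)
      case one
      then show ?case
        using h subgroup.one_closed [OF K] commutator_eq_one_iff [of \<one> h] by simp
    next
      case (incl g)
      then show ?case using gens x by auto
    next
      case (inv g)
      then have g: "g \<in> carrier G" and gK: "commutator G g h \<in> ?K" using gens x by auto
      have "\<one> = commutator G g h \<otimes> T g h (inv g) \<otimes> commutator G (inv g) h"
        using g h commutator_mult_left [of g "inv g" h] commutator_eq_one_iff [of \<one> h] by simp
      then have "inv (commutator G (inv g) h) = commutator G g h \<otimes> T g h (inv g)"
        using g h by (intro inv_equality) auto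
      moreover have "commutator G g h \<otimes> T g h (inv g) \<in> ?K"
        using gK g h 3 commutator3_lower_central [of g h "inv g"] by (auto intro!: mult)
      ultimately have "inv (inv (commutator G (inv g) h)) \<in> ?K"
        using \<open>\<And>y. y \<in> ?K \<Longrightarrow> inv y \<in> ?K\<close> by simp
      then show ?case using g h by simp
    next
      case (eng g g')
      then show ?case using prod by simp
    qed
    then show ?thesis by simp
  qed
  have gens: "commutator G (x a) (x b) \<in> ?K" if "1 \<le> a" "a \<le> n" "1 \<le> b" "b \<le> n" for a b
  proof -
    have basic: "commutator G (x a) (x b) \<in> ?K" if "1 \<le> b" "b < a" "a \<le> n" for a b
      using that by (intro generate.incl) (force simp: basic_comm2_def basic2_def)
    consider "a = b" | "b < a" | "a < b" by linarith
    then show ?thesis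
      using that basic swap [OF basic, of a b] subgroup.one_closed [OF K]
      by cases (simp_all add: commutator_self)
  qed
  have "commutator G g h \<in> ?K" if "g \<in> carrier G" "h \<in> carrier G" for g h
  proof (rule left)
    fix i assume i: "1 \<le> i" "i \<le> n"
    show "commutator G (x i) h \<in> ?K"
      by (rule swap, rule left) (use i that gens in auto)
  qed (use that in auto)
  then show "lower_central G 2 \<subseteq> ?K"
    unfolding lower_central_2 by (intro generate_subgroup_incl [OF _ K]) blast
qed

end

section \<open>Coordinates on the lower central factors\<close>

text \<open>The free nilpotent group enters the argument only through two homomorphisms provided by its universal
property: \<open>\<mu>\<close> into the Magnus group, which separates the basic commutators, and \<open>\<theta>\<close>, which inverts each
generator and governs the reversal of words.\<close>
locale free_class3 = class3_generated +
  fixes \<mu> :: "'a \<Rightarrow> series3" and \<theta> :: "'a \<Rightarrow> 'a"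
  assumes two_le_n: "2 \<le> n"
    and \<mu>_hom: "\<mu> \<in> hom G magnus" and \<mu>_x: "\<And>i. i \<in> {1..n} \<Longrightarrow> \<mu> (x i) = magnus_gen i"
    and \<theta>_hom: "\<theta> \<in> hom G G" and \<theta>_x: "\<And>i. i \<in> {1..n} \<Longrightarrow> \<theta> (x i) = inv x i"
begin

lemma \<mu>_group_hom: "group_hom G magnus \<mu>"
  using \<mu>_hom by (simp add: group_hom_def group_hom_axioms_def group_magnus)

lemma \<mu>_mult: "g \<in> carrier G \<Longrightarrow> h \<in> carrier G \<Longrightarrow> \<mu> (g \<otimes> h) = \<mu> g \<otimes>\<^bsub>magnus\<^esub> \<mu> h"
  using \<mu>_hom by (rule hom_mult)

lemma \<mu>_commutator:
  "g \<in> carrier G \<Longrightarrow> h \<in> carrier G \<Longrightarrow> \<mu> (commutator G g h) = commutator magnus (\<mu> g) (\<mu> h)"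
  using group_hom.hom_commutator [OF \<mu>_group_hom] .

lemma deg1_\<mu>_lower_central_2: "u \<in> lower_central G 2 \<Longrightarrow> deg1 (\<mu> u) i = 0"
  using group_hom.lower_central_hom [OF \<mu>_group_hom, of 2] lower_central_2_magnus by blast

lemma deg12_\<mu>_lower_central_3:
  assumes "z \<in> lower_central G 3"
  shows "deg1 (\<mu> z) i = 0" "deg2 (\<mu> z) i j = 0"
  using assms group_hom.lower_central_hom [OF \<mu>_group_hom, of 3] lower_central_3_magnus by blast+

text \<open>The exponent sum of \<open>x\<^sub>i\<close>.\<close>
definition expo :: "nat \<Rightarrow> 'a \<Rightarrow> int" where "expo i g = deg1 (\<mu> g) i"

text \<open>For \<open>b < a\<close>, the monomial \<open>X\<^sub>a X\<^sub>b\<close> occurs in \<open>[X\<^sub>a, X\<^sub>b]\<close> with coefficient one and in no other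
Lie bracket belonging to a basic pair.\<close>
definition coord2 :: "nat \<times> nat \<Rightarrow> 'a \<Rightarrow> int" where
  "coord2 = (\<lambda>(a, b) u. deg2 (\<mu> u) a b)"

text \<open>A coefficient that singles out the basic triple \<open>(a, b, c)\<close>. The bracket \<open>[X\<^sub>a, X\<^sub>b, X\<^sub>c]\<close> is
\<open>X\<^sub>a X\<^sub>b X\<^sub>c - X\<^sub>b X\<^sub>a X\<^sub>c - X\<^sub>c X\<^sub>a X\<^sub>b + X\<^sub>c X\<^sub>b X\<^sub>a\<close>. The monomial \<open>X\<^sub>b X\<^sub>a X\<^sub>c\<close>, which starts with the
least index, occurs in no other basic bracket. Its coefficient is \<open>-1\<close> if \<open>b < c\<close>; for \<open>c = b\<close> it would
be \<open>-2\<close>, and \<open>X\<^sub>a X\<^sub>b X\<^sub>b\<close> serves instead.\<close>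
definition coord3 :: "nat \<times> nat \<times> nat \<Rightarrow> 'a \<Rightarrow> int" where
  "coord3 = (\<lambda>(a, b, c) z. if c = b then deg3 (\<mu> z) a b b else - deg3 (\<mu> z) b a c)"

lemma expo_hom: "expo i \<in> hom G integer_group"
  by (rule homI) (simp_all add: expo_def \<mu>_mult)

lemma coord2_hom: "coord2 s \<in> hom \<Gamma>\<^sub>2 integer_group"
  by (rule homI) (simp_all add: coord2_def split_beta \<mu>_mult lower_central_carrier deg1_\<mu>_lower_central_2)

lemma coord3_hom: "coord3 s \<in> hom \<Gamma>\<^sub>3 integer_group"
  by (rule homI)
     (simp_all add: coord3_def split_beta \<mu>_mult lower_central_carrier deg12_\<mu>_lower_central_3)

lemma expo_x: "1 \<le> j \<Longrightarrow> j \<le> n \<Longrightarrow> expo i (x j) = (if i = j then 1 else 0)"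
  by (simp add: expo_def \<mu>_x)

lemma expo_lower_central_2: "u \<in> lower_central G 2 \<Longrightarrow> expo i u = 0"
  by (simp add: expo_def deg1_\<mu>_lower_central_2)

lemma expo_mult: "g \<in> carrier G \<Longrightarrow> h \<in> carrier G \<Longrightarrow> expo i (g \<otimes> h) = expo i g + expo i h"
  using hom_mult [OF expo_hom] by simp

lemma coord2_lower_central_3: "z \<in> lower_central G 3 \<Longrightarrow> coord2 s z = 0"
  by (simp add: coord2_def split_beta deg12_\<mu>_lower_central_3)

lemma coord2_basic_comm2:
  assumes "s \<in> basic2 n" "t \<in> basic2 n"
  shows "coord2 s (basic_comm2 t) = (if s = t then 1 else 0)"
  using assms
  by (auto simp: basic2_def basic_comm2_def coord2_def \<mu>_commutator \<mu>_x deg_commutator)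

lemma deg3_\<mu>_commutator3:
  assumes "1 \<le> a" "a \<le> n" "1 \<le> b" "b \<le> n" "1 \<le> c" "c \<le> n"
  shows "deg3 (\<mu> (T (x a) (x b) (x c))) i j k =
    of_bool (i = a \<and> j = b \<and> k = c) - of_bool (i = b \<and> j = a \<and> k = c)
    - of_bool (i = c \<and> j = a \<and> k = b) + of_bool (i = c \<and> j = b \<and> k = a)"
  using assms
  by (simp add: commutator3_def \<mu>_commutator \<mu>_x deg3_commutator deg_commutator of_bool_conj algebra_simps
      del: of_bool_eq_iff)

lemma coord3_basic_comm3:
  assumes "s \<in> basic3 n" "t \<in> basic3 n"
  shows "coord3 s (basic_comm3 t) = (if s = t then 1 else 0)"
  using assms
  by (auto simp: basic3_def basic_comm3_def coord3_def deg3_\<mu>_commutator3)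

lemma lower_central_2_if_expo_zero:
  assumes g: "g \<in> carrier G" and zero: "\<And>i. i \<in> {1..n} \<Longrightarrow> expo i g = 0"
  shows "g \<in> lower_central G 2"
proof (rule dual_coordinates_kernel [where I = "{1..n}" and b = x and d = expo])
  show "comm_group (G Mod lower_central G 2)"
    by (rule comm_group_FactGroup_commutators [OF lower_central_normal commutator_lower_central_2])
  show "carrier G = generate G (x ` {1..n} \<union> lower_central G 2)"
  proof
    show "carrier G \<subseteq> generate G (x ` {1..n} \<union> lower_central G 2)"
      unfolding generated by (rule mono_generate) simp
    show "generate G (x ` {1..n} \<union> lower_central G 2) \<subseteq> carrier G"
      using x lower_central_subset by (intro generate_incl) auto
  qed
qed (use g zero x expo_x in \<open>auto simp: lower_central_normal expo_hom expo_lower_central_2\<close>)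

lemma basic_comm2_closed: "basic_comm2 \<in> basic2 n \<rightarrow> carrier \<Gamma>\<^sub>2"
  using basic_comm2_lower_central by auto

lemma basic_comm3_closed: "basic_comm3 \<in> basic3 n \<rightarrow> carrier \<Gamma>\<^sub>3"
  using basic_comm3_lower_central by auto

lemma \<Gamma>\<^sub>2_generated: "carrier \<Gamma>\<^sub>2 = generate \<Gamma>\<^sub>2 (basic_comm2 ` basic2 n \<union> lower_central G 3)"
proof -
  have sub: "basic_comm2 ` basic2 n \<union> lower_central G 3 \<subseteq> lower_central G 2"
    using basic_comm2_lower_central lower_central_3_subset_2 by blast
  have "lower_central G 2 \<subseteq> generate G (basic_comm2 ` basic2 n \<union> lower_central G 3)"
    unfolding lower_central_2_basic using basic_comm3_lower_central by (intro mono_generate) blast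
  then have "generate G (basic_comm2 ` basic2 n \<union> lower_central G 3) = lower_central G 2"
    using generate_subgroup_incl [OF sub lower_central_subgroup] by blast
  then show ?thesis
    using generate_consistent [OF sub lower_central_subgroup] by simp
qed

lemma \<Gamma>\<^sub>3_generated: "carrier \<Gamma>\<^sub>3 = generate \<Gamma>\<^sub>3 (basic_comm3 ` basic3 n \<union> {\<one>})"
proof -
  have sub: "basic_comm3 ` basic3 n \<union> {\<one>} \<subseteq> lower_central G 3"
    using basic_comm3_lower_central subgroup.one_closed [OF lower_central_subgroup] by blast
  have "lower_central G 3 \<subseteq> generate G (basic_comm3 ` basic3 n \<union> {\<one>})"
    by (subst lower_central_3_basic, rule mono_generate) blast
  then have "generate G (basic_comm3 ` basic3 n \<union> {\<one>}) = lower_central G 3"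
    using generate_subgroup_incl [OF sub lower_central_subgroup] by blast
  then show ?thesis
    using generate_consistent [OF sub lower_central_subgroup] by simp
qed

lemma lower_central_3_subgroup_\<Gamma>\<^sub>2: "subgroup (lower_central G 3) \<Gamma>\<^sub>2"
  by (rule subgroup_incl [OF lower_central_subgroup lower_central_subgroup lower_central_3_subset_2])

lemma lower_central_3_if_coord2_zero:
  assumes u: "u \<in> lower_central G 2" and zero: "\<And>s. s \<in> basic2 n \<Longrightarrow> coord2 s u = 0"
  shows "u \<in> lower_central G 3"
proof -
  interpret \<Gamma>: comm_group \<Gamma>\<^sub>2 by (rule comm_group_\<Gamma>\<^sub>2)
  show ?thesis
  proof (rule \<Gamma>.dual_coordinates_kernel [where I = "basic2 n" and b = basic_comm2 and d = coord2])
    show "lower_central G 3 \<lhd> \<Gamma>\<^sub>2" "comm_group (\<Gamma>\<^sub>2 Mod lower_central G 3)"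
      using lower_central_3_subgroup_\<Gamma>\<^sub>2 \<Gamma>.subgroup_imp_normal \<Gamma>.abelian_FactGroup by blast+
  qed (use u zero basic_comm2_closed \<Gamma>\<^sub>2_generated coord2_hom coord2_lower_central_3 coord2_basic_comm2 in simp_all)
qed

lemma one_if_coord3_zero:
  assumes z: "z \<in> lower_central G 3" and zero: "\<And>s. s \<in> basic3 n \<Longrightarrow> coord3 s z = 0"
  shows "z = \<one>"
proof -
  interpret \<Gamma>: comm_group \<Gamma>\<^sub>3 by (rule comm_group_\<Gamma>\<^sub>3)
  have one: "coord3 s \<one> = 0" for s
    using hom_one [OF coord3_hom \<Gamma>.is_group, of s] by simp
  have "{\<one>} \<lhd> \<Gamma>\<^sub>3" "comm_group (\<Gamma>\<^sub>3 Mod {\<one>})"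
    using \<Gamma>.triv_subgroup \<Gamma>.subgroup_imp_normal \<Gamma>.abelian_FactGroup by simp_all
  then have "z \<in> {\<one>}"
    by (rule \<Gamma>.dual_coordinates_kernel [where I = "basic3 n" and b = basic_comm3 and d = coord3])
       (use one z zero basic_comm3_closed \<Gamma>\<^sub>3_generated coord3_hom coord3_basic_comm3 in simp_all)
  then show ?thesis by simp
qed

lemma \<Gamma>\<^sub>2_Mod_free_abelian: "\<Gamma>\<^sub>2 Mod lower_central G 3 \<cong> free_Abelian_group {..<card (basic2 n)}"
proof -
  interpret \<Gamma>: comm_group \<Gamma>\<^sub>2 by (rule comm_group_\<Gamma>\<^sub>2)
  show ?thesis
    by (rule \<Gamma>.dual_coordinates_free_abelian [where b = basic_comm2 and d = coord2])
       (use lower_central_3_subgroup_\<Gamma>\<^sub>2 basic_comm2_closed \<Gamma>\<^sub>2_generated coord2_hom coord2_lower_central_3 coord2_basic_comm2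
        in simp_all)
qed

lemma \<Gamma>\<^sub>3_free_abelian: "\<Gamma>\<^sub>3 \<cong> free_Abelian_group {..<card (basic3 n)}"
proof -
  interpret \<Gamma>: comm_group \<Gamma>\<^sub>3 by (rule comm_group_\<Gamma>\<^sub>3)
  have "coord3 s \<one> = 0" for s
    using hom_one [OF coord3_hom \<Gamma>.is_group, of s] by simp
  then have "\<Gamma>\<^sub>3 Mod {\<one>} \<cong> free_Abelian_group {..<card (basic3 n)}"
    by (intro \<Gamma>.dual_coordinates_free_abelian [where b = basic_comm3 and d = coord3])
       (use basic_comm3_closed \<Gamma>\<^sub>3_generated coord3_hom coord3_basic_comm3 \<Gamma>.triv_subgroup in simp_all)
  moreover interpret i: group_hom \<Gamma>\<^sub>3 \<Gamma>\<^sub>3 id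
    by unfold_locales (auto simp: hom_def)
  have "kernel \<Gamma>\<^sub>3 \<Gamma>\<^sub>3 id = {\<one>}"
    using \<Gamma>.one_closed by (auto simp: kernel_def)
  then have "\<Gamma>\<^sub>3 Mod {\<one>} \<cong> \<Gamma>\<^sub>3"
    using i.FactGroup_iso by simp
  then have "\<Gamma>\<^sub>3 \<cong> \<Gamma>\<^sub>3 Mod {\<one>}"
    using group.iso_sym normal.factorgroup_is_group \<Gamma>.subgroup_imp_normal \<Gamma>.triv_subgroup by fastforce
  ultimately show ?thesis
    using iso_trans by blast
qed

text \<open>A central element has a Magnus series commuting with all \<open>X\<^sub>i\<close>. As there are at least two variables, its
linear part vanishes, and then so does its quadratic part; the coordinate criteria push it down
to \<open>\<gamma>\<^sub>3\<close>.\<close>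
lemma center_eq: "center G = lower_central G 3"
proof
  show "lower_central G 3 \<subseteq> center G"
    by (auto simp: center_def lower_central_carrier intro: lower_central_3_central)
  show "center G \<subseteq> lower_central G 3"
  proof
    fix z assume "z \<in> center G"
    then have z: "z \<in> carrier G" and comm: "\<And>g. g \<in> carrier G \<Longrightarrow> z \<otimes> g = g \<otimes> z"
      by (auto simp: center_def)
    have m: "\<mu> z \<otimes>\<^bsub>magnus\<^esub> magnus_gen i = magnus_gen i \<otimes>\<^bsub>magnus\<^esub> \<mu> z" if "i \<in> {1..n}" for i
      using comm [of "x i"] z that by (simp flip: \<mu>_mult \<mu>_x)
    have "expo j z = 0" if j: "j \<in> {1..n}" for j
    proof -
      \<comment> \<open>Any index other than \<open>j\<close>; the coefficient of \<open>X\<^sub>j X\<^sub>i\<close> then isolates the linear coefficient at \<open>j\<close>.\<close>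
      define i :: nat where "i = (if j = 1 then 2 else 1)"
      have i: "i \<in> {1..n}" "i \<noteq> j"
        using two_le_n j by (auto simp: i_def)
      show ?thesis
        using arg_cong [OF m [OF i(1)], of "\<lambda>f. deg2 f j i"] i(2) by (simp add: expo_def)
    qed
    then have z2: "z \<in> lower_central G 2"
      using z by (rule lower_central_2_if_expo_zero [rotated])
    show "z \<in> lower_central G 3"
    proof (rule lower_central_3_if_coord2_zero [OF z2])
      fix s assume "s \<in> basic2 n"
      then obtain a b where s: "s = (a, b)" "1 \<le> b" "b < a" "a \<le> n"
        by (auto simp: basic2_def)
      then have "b \<in> {1..n}" by simp
      then show "coord2 s z = 0"
        using s arg_cong [OF m [of b], of "\<lambda>f. deg3 f a b b"]
        by (simp add: coord2_def deg1_\<mu>_lower_central_2 [OF z2])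
    qed
  qed
qed

end

section \<open>Palindromes\<close>

text \<open>Peel off the first and the last letter, which are equal.\<close>
lemma palindromic_list_cases:
  assumes "rev w = w"
  obtains u where "w = u @ rev u" | u a where "w = u @ a # rev u"
proof -
  have "(\<exists>u. w = u @ rev u) \<or> (\<exists>u a. w = u @ a # rev u)"
    using assms
  proof (induction w rule: length_induct)
    case (1 w)
    show ?case
    proof (cases w)
      case (Cons a v)
      show ?thesis
      proof (cases v rule: rev_cases)
        case Nil
        then have "w = [] @ a # rev []" using Cons by simp
        then show ?thesis by (intro disjI2 exI) assumption
      next
        case (snoc v' b)
        then have v: "rev w = b # rev v' @ [a]" "w = a # v' @ [b]"
          using Cons by simp_all
        then have eq: "b # rev v' @ [a] = a # v' @ [b]"
          using "1.prems" by metis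
        then have "b = a"
          by (rule list.inject [THEN iffD1, THEN conjunct1])
        with v(2) eq have w: "w = a # v' @ [a]" "rev v' = v'"
          by simp_all
        have "(\<exists>u. v' = u @ rev u) \<or> (\<exists>u c. v' = u @ c # rev u)"
          by (rule "1.IH" [rule_format]) (use w in auto)
        then consider u where "v' = u @ rev u" | u c where "v' = u @ c # rev u"
          by blast
        then show ?thesis
        proof cases
          case 1
          then have "w = (a # u) @ rev (a # u)" using w by simp
          then show ?thesis by (intro disjI1 exI) assumption
        next
          case 2
          then have "w = (a # u) @ c # rev (a # u)" using w by simp
          then show ?thesis by (intro disjI2 exI) assumption
        qed
      qed
    qed simp
  qed
  then show thesis using that by blast
qed

context free_class3 begin

lemma \<theta>_group_hom: "group_hom G G \<theta>"
  using \<theta>_hom by (simp add: group_hom_def group_hom_axioms_def)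

lemma \<theta>_closed [simp]: "g \<in> carrier G \<Longrightarrow> \<theta> g \<in> carrier G"
  using \<theta>_hom by (rule hom_in_carrier)

lemma \<theta>_lower_central: "u \<in> lower_central G m \<Longrightarrow> \<theta> u \<in> lower_central G m"
  using group_hom.lower_central_hom [OF \<theta>_group_hom] by blast

lemma expo_\<theta>:
  assumes g: "g \<in> carrier G"
  shows "expo i (\<theta> g) = - expo i g"
proof (rule hom_eq_on_generate [where f = "\<lambda>g. expo i (\<theta> g)" and g = "\<lambda>g. - expo i g"])
  show "(\<lambda>g. expo i (\<theta> g)) \<in> hom G integer_group"
    by (rule homI) (simp_all add: hom_mult [OF \<theta>_hom] expo_mult)
  show "(\<lambda>g. - expo i g) \<in> hom G integer_group"
    by (rule homI) (simp_all add: expo_mult)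
  show "expo i (\<theta> s) = - expo i s" if "s \<in> x ` {1..n}" for s
    using that group_hom.hom_inv [OF integer_hom_group_hom [OF is_group expo_hom]] by (auto simp: \<theta>_x)
  show "g \<in> generate G (x ` {1..n})"
    using g by (simp only: generated)
qed (use x in auto)

lemma letter_val_x_closed: "fst a \<in> {1..n} \<Longrightarrow> letter_val G x a \<in> carrier G"
  using letter_val_closed [OF x] .

lemma word_val_x_closed: "w \<in> words n \<Longrightarrow> word_val G x w \<in> carrier G"
  using word_val_closed [OF x] .

lemma word_val_surj:
  assumes "g \<in> carrier G"
  shows "\<exists>w\<in>words n. word_val G x w = g"
proof -
  have "g \<in> generate G (x ` {1..n})"
    using assms by (simp only: generated)
  then show ?thesis
  proof (induction rule: generate.induct)
    case one
    then show ?case by (intro bexI [of _ "[]"]) auto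
  next
    case (incl g)
    then obtain i where "i \<in> {1..n}" "g = x i" by blast
    then show ?case by (intro bexI [of _ "[(i, True)]"]) (auto simp: letter_val_def)
  next
    case (inv g)
    then obtain i where "i \<in> {1..n}" "g = x i" by blast
    then show ?case by (intro bexI [of _ "[(i, False)]"]) (auto simp: letter_val_def)
  next
    case (eng g h)
    then obtain u v where "u \<in> words n" "v \<in> words n" "word_val G x u = g" "word_val G x v = h" by blast
    then show ?case
      by (intro bexI [of _ "u @ v"]) (auto simp: word_val_append [OF x])
  qed
qed

text \<open>Reversal is an antihomomorphism fixing the letters, and \<open>u \<mapsto> \<theta>(u)\<^sup>-\<^sup>1\<close> is one as well.\<close>
lemma word_val_rev:
  "w \<in> words n \<Longrightarrow> word_val G x (rev w) = inv (\<theta> (word_val G x w))"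
proof (induction w)
  case Nil
  then show ?case using group_hom.hom_one [OF \<theta>_group_hom] by simp
next
  case (Cons a w)
  then have a: "fst a \<in> {1..n}" "letter_val G x a \<in> carrier G" and w: "w \<in> words n" "word_val G x w \<in> carrier G"
    using letter_val_x_closed word_val_x_closed by auto
  have "\<theta> (letter_val G x a) = inv (letter_val G x a)"
    using a group_hom.hom_inv [OF \<theta>_group_hom, of "x (fst a)"] by (auto simp: letter_val_def \<theta>_x)
  then have "inv (\<theta> (word_val G x (a # w))) = inv (\<theta> (word_val G x w)) \<otimes> letter_val G x a"
    using a w by (simp add: hom_mult [OF \<theta>_hom] inv_mult_group)
  moreover have "word_val G x (rev w @ [a]) = word_val G x (rev w) \<otimes> letter_val G x a"
    using a w by (subst word_val_append [OF x]) simp_all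
  ultimately show ?case
    using Cons w by simp
qed

definition palindromic :: "'a \<Rightarrow> bool" where
  "palindromic g \<longleftrightarrow> (\<exists>w\<in>words n. rev w = w \<and> g = word_val G x w)"

text \<open>The element \<open>z\<close> with \<open>x\<^sub>i z = u x\<^sub>i \<theta>(u)\<^sup>-\<^sup>1\<close>.\<close>
definition twist :: "nat \<Rightarrow> 'a \<Rightarrow> 'a" where
  "twist i u = inv x i \<otimes> u \<otimes> x i \<otimes> inv (\<theta> u)"

text \<open>In \<open>x\<^sub>i z\<close> the exponent sum of \<open>x\<^sub>i\<close> is one and all others are zero, whereas a word and its reversal have
equal exponent sums. Parity thus forces a palindromic word for \<open>x\<^sub>i z\<close> to have odd length, with middle
letter \<open>x\<^sub>i\<close> or \<open>x\<^sub>i\<^sup>-\<^sup>1\<close>. The first half \<open>g\<close>, replaced by \<open>g x\<^sub>i\<^sup>-\<^sup>1\<close> in the second case, then has exponent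
sums zero, that is, it lies in \<open>\<gamma>\<^sub>2\<close>.\<close>
lemma palindromic_iff_twist_carrier:
  assumes i: "i \<in> {1..n}" and z: "z \<in> lower_central G 3"
  shows "palindromic (x i \<otimes> z) \<longleftrightarrow> z \<in> twist i ` lower_central G 2"
proof
  have xi: "x i \<in> carrier G" and zc: "z \<in> carrier G" using i z lower_central_carrier by auto
  have eq_twist: "z = twist i u" if "x i \<otimes> z = u \<otimes> x i \<otimes> inv (\<theta> u)" "u \<in> carrier G" for u
  proof -
    have "inv x i \<otimes> (x i \<otimes> z) = twist i u"
      unfolding that(1) twist_def using that(2) xi by (simp add: m_assoc)
    then show ?thesis using xi zc by (simp add: inv_cancel_left)
  qed
  assume "palindromic (x i \<otimes> z)"
  then obtain w where w: "w \<in> words n" "rev w = w" "x i \<otimes> z = word_val G x w"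
    by (auto simp: palindromic_def)
  have ez: "expo j (x i \<otimes> z) = of_bool (j = i)" for j
    using i z zc lower_central_3_subset_2
    by (auto simp: expo_mult expo_x expo_lower_central_2)
  have expo_inv: "expo j (inv g) = - expo j g" if "g \<in> carrier G" for g j
    using that group_hom.hom_inv [OF integer_hom_group_hom [OF is_group expo_hom]] by simp
  from w(2) show "z \<in> twist i ` lower_central G 2"
  proof (cases rule: palindromic_list_cases)
    case (1 u)
    define g where "g = word_val G x u"
    have u: "u \<in> words n" "g \<in> carrier G"
      using w 1 word_val_x_closed by (auto simp: g_def)
    have "x i \<otimes> z = g \<otimes> inv (\<theta> g)"
      using w(3) 1 u by (simp add: word_val_append [OF x] word_val_rev g_def)
    then have "expo i (x i \<otimes> z) = 2 * expo i g"
      using u by (simp add: expo_mult expo_inv expo_\<theta>)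
    then have "2 * expo i g = 1" using ez by simp
    then show ?thesis by presburger
  next
    case (2 u a)
    define g where "g = word_val G x u"
    have u: "u \<in> words n" "g \<in> carrier G" and a: "fst a \<in> {1..n}" "letter_val G x a \<in> carrier G"
      using w 2 word_val_x_closed letter_val_x_closed by (auto simp: g_def)
    have val: "x i \<otimes> z = g \<otimes> (letter_val G x a \<otimes> inv (\<theta> g))"
      using w(3) 2 u a by (simp add: word_val_append [OF x] word_val_rev g_def)
    have ea: "expo j (letter_val G x a) = (if snd a then 1 else -1) * of_bool (j = fst a)" for j
      using a by (auto simp: letter_val_def expo_inv expo_x)
    have "expo j (x i \<otimes> z) = 2 * expo j g + expo j (letter_val G x a)" for j
      using u a unfolding val by (simp add: expo_mult expo_inv expo_\<theta>)
    then have e: "of_bool (j = i) = 2 * expo j g + (if snd a then 1 else -1) * of_bool (j = fst a)" for j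
      using ez ea by metis
    have ai: "fst a = i"
    proof (rule ccontr)
      assume "fst a \<noteq> i"
      then have "2 * expo i g = 1" using e [of i] by simp
      then show False by presburger
    qed
    show ?thesis
    proof (cases "snd a")
      case True
      have "expo j g = 0" for j
        using e [of j] ai True by (cases "j = i") auto
      then have "g \<in> lower_central G 2"
        using u lower_central_2_if_expo_zero by blast
      moreover have "letter_val G x a = x i"
        using True ai by (simp add: letter_val_def)
      then have "z = twist i g"
        using val u xi by (intro eq_twist) (simp_all add: m_assoc)
      ultimately show ?thesis by blast
    next
      case False
      have xa: "letter_val G x a = inv x i"
        using False ai by (simp add: letter_val_def)
      have "expo j (g \<otimes> inv x i) = 0" for j
        using e [of j] ai False u i xi by (cases "j = i") (auto simp: expo_mult expo_inv expo_x)
      then have "g \<otimes> inv x i \<in> lower_central G 2"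
        using u xi lower_central_2_if_expo_zero by simp
      moreover have "\<theta> (g \<otimes> inv x i) = \<theta> g \<otimes> x i"
        using u xi i group_hom.hom_inv [OF \<theta>_group_hom xi] by (simp add: hom_mult [OF \<theta>_hom] \<theta>_x)
      then have "z = twist i (g \<otimes> inv x i)"
        using val u xi xa by (intro eq_twist) (simp_all add: free_reduction)
      ultimately show ?thesis by blast
    qed
  qed
next
  have xi: "x i \<in> carrier G" using i by simp
  assume "z \<in> twist i ` lower_central G 2"
  then obtain g where g: "g \<in> lower_central G 2" "z = twist i g" by blast
  then have gc: "g \<in> carrier G" using lower_central_carrier by blast
  then obtain u where u: "u \<in> words n" "word_val G x u = g"
    using word_val_surj by blast
  have "x i \<otimes> z = g \<otimes> (x i \<otimes> inv (\<theta> g))"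
    using gc xi by (simp add: g(2) twist_def free_reduction)
  also have "\<dots> = word_val G x (u @ (i, True) # rev u)"
    using u i by (simp add: word_val_append [OF x] word_val_rev letter_val_def)
  finally show "palindromic (x i \<otimes> z)"
    unfolding palindromic_def using u i by (intro bexI [of _ "u @ (i, True) # rev u"]) simp_all
qed

text \<open>Conjugation by \<open>x\<^sub>i\<close> and \<open>u \<mapsto> \<theta>(u)\<^sup>-\<^sup>1\<close> both map \<open>\<gamma>\<^sub>2\<close> to itself, and in the abelian group \<open>\<gamma>\<^sub>2\<close>
inversion and products of homomorphisms are homomorphisms.\<close>
lemma twist_hom:
  assumes i: "i \<in> {1..n}"
  shows "twist i \<in> hom \<Gamma>\<^sub>2 G"
proof (rule homI)
  have xi: "x i \<in> carrier G" using i by simp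
  fix u v assume "u \<in> carrier \<Gamma>\<^sub>2" "v \<in> carrier \<Gamma>\<^sub>2"
  then have uv: "u \<in> lower_central G 2" "v \<in> lower_central G 2" by auto
  then have c: "u \<in> carrier G" "v \<in> carrier G" using lower_central_carrier by blast+
  note inv = subgroup.m_inv_closed [OF lower_central_subgroup]
  have conj: "inv x i \<otimes> v \<otimes> x i \<in> lower_central G 2"
    using lower_central_normal [of 2] xi uv by (metis inv_closed inv_inv normal_inv_iff)
  have \<theta>: "inv (\<theta> u) \<in> lower_central G 2" "inv (\<theta> v) \<in> lower_central G 2"
    using uv by (auto intro: inv \<theta>_lower_central)
  have "twist i (u \<otimes> v) = (inv x i \<otimes> u \<otimes> x i) \<otimes> ((inv x i \<otimes> v \<otimes> x i \<otimes> inv (\<theta> v)) \<otimes> inv (\<theta> u))"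
    using c xi by (simp add: twist_def hom_mult [OF \<theta>_hom] free_reduction)
  also have "(inv x i \<otimes> v \<otimes> x i \<otimes> inv (\<theta> v)) \<otimes> inv (\<theta> u) = inv (\<theta> u) \<otimes> (inv x i \<otimes> v \<otimes> x i \<otimes> inv (\<theta> v))"
    using conj \<theta> subgroup.m_closed [OF lower_central_subgroup] by (intro lower_central_2_commutes) auto
  also have "(inv x i \<otimes> u \<otimes> x i) \<otimes> (inv (\<theta> u) \<otimes> (inv x i \<otimes> v \<otimes> x i \<otimes> inv (\<theta> v))) = twist i u \<otimes> twist i v"
    using c xi by (simp add: twist_def m_assoc)
  finally show "twist i (u \<otimes>\<^bsub>\<Gamma>\<^sub>2\<^esub> v) = twist i u \<otimes> twist i v"
    by simp
qed (use i lower_central_carrier in \<open>auto simp: twist_def\<close>)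

text \<open>Inverting one argument of a triple commutator inverts it, and \<open>\<theta>\<close> inverts all three.\<close>
lemma \<theta>_lower_central_3:
  assumes z: "z \<in> lower_central G 3"
  shows "\<theta> z = inv z"
proof (rule hom_eq_on_generate [where G = \<Gamma>\<^sub>3 and H = G and f = \<theta> and g = "\<lambda>z. inv z"])
  interpret \<Gamma>: comm_group \<Gamma>\<^sub>3 by (rule comm_group_\<Gamma>\<^sub>3)
  show "group \<Gamma>\<^sub>3" by (rule \<Gamma>.is_group)
  show "\<theta> \<in> hom \<Gamma>\<^sub>3 G"
    by (rule homI) (simp_all add: lower_central_carrier hom_mult [OF \<theta>_hom])
  show "(\<lambda>z. inv z) \<in> hom \<Gamma>\<^sub>3 G"
  proof (rule homI)
    fix u v assume uv: "u \<in> carrier \<Gamma>\<^sub>3" "v \<in> carrier \<Gamma>\<^sub>3"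
    then have "inv u \<in> lower_central G 3" "inv v \<in> carrier G"
      using subgroup.m_inv_closed [OF lower_central_subgroup] lower_central_carrier by auto
    then have "inv v \<otimes> inv u = inv u \<otimes> inv v"
      using lower_central_3_central by metis
    then show "inv (u \<otimes>\<^bsub>\<Gamma>\<^sub>3\<^esub> v) = inv u \<otimes> inv v"
      using uv lower_central_carrier by (simp add: inv_mult_group)
  qed (simp add: lower_central_carrier)
  show "\<theta> s = inv s" if "s \<in> basic_comm3 ` basic3 n \<union> {\<one>}" for s
  proof (cases "s = \<one>")
    case True
    then show ?thesis using group_hom.hom_one [OF \<theta>_group_hom] by simp
  next
    case False
    with that obtain a b c where s: "(a, b, c) \<in> basic3 n" "s = T (x a) (x b) (x c)"
      by (auto simp: basic_comm3_def)
    then have abc: "a \<in> {1..n}" "b \<in> {1..n}" "c \<in> {1..n}" by (auto simp: basic3_def)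
    then have "\<theta> s = T (\<theta> (x a)) (\<theta> (x b)) (\<theta> (x c))"
      using s group_hom.hom_commutator [OF \<theta>_group_hom] by (simp add: commutator3_def)
    then show ?thesis
      using abc s by (simp add: \<theta>_x commutator3_inv)
  qed
  show "z \<in> generate \<Gamma>\<^sub>3 (basic_comm3 ` basic3 n \<union> {\<one>})"
    using z \<Gamma>\<^sub>3_generated by simp
  show "basic_comm3 ` basic3 n \<union> {\<one>} \<subseteq> carrier \<Gamma>\<^sub>3"
    using basic_comm3_closed \<Gamma>.one_closed by auto
qed (rule is_group)

lemma twist_lower_central_3:
  assumes "i \<in> {1..n}" "z \<in> lower_central G 3"
  shows "twist i z = z \<otimes> z"
  using assms lower_central_carrier
  by (simp add: twist_def conj_lower_central_3 \<theta>_lower_central_3)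

text \<open>The displacement of \<open>x\<^sub>i\<close> under the first kind of generating automorphism.\<close>
definition pal_gen :: "nat \<Rightarrow> nat \<times> nat \<Rightarrow> 'a" where
  "pal_gen i = (\<lambda>(a, b). T (x a) (x b) (x i) \<otimes> T (x a) (x b) (x b) \<otimes> T (x a) (x b) (x a))"

text \<open>The commutator of the inverses is conjugate to the commutator itself:
\<open>[x\<^sub>a\<^sup>-\<^sup>1, x\<^sub>b\<^sup>-\<^sup>1] = h [x\<^sub>a, x\<^sub>b] h\<^sup>-\<^sup>1\<close> with \<open>h = x\<^sub>b x\<^sub>a\<close>. The two therefore differ by
\<open>[x\<^sub>a, x\<^sub>b, h]\<close>, which is expanded by linearity.\<close>
lemma \<theta>_commutator:
  assumes a: "a \<in> {1..n}" and b: "b \<in> {1..n}"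
  shows "commutator G (x a) (x b) \<otimes> inv (\<theta> (commutator G (x a) (x b))) =
    T (x a) (x b) (x b) \<otimes> T (x a) (x b) (x a)"
proof -
  have c: "x a \<in> carrier G" "x b \<in> carrier G" using a b by auto
  define u where "u = commutator G (x a) (x b)"
  define h where "h = x b \<otimes> x a"
  have u: "u \<in> lower_central G 2" "u \<in> carrier G" and h: "h \<in> carrier G"
    using c commutator_lower_central_2 by (auto simp: u_def h_def)
  have \<theta>u: "\<theta> u \<in> lower_central G 2" "\<theta> u \<in> carrier G"
    using u \<theta>_lower_central by auto
  have "\<theta> u = commutator G (inv x a) (inv x b)"
    using c a b group_hom.hom_commutator [OF \<theta>_group_hom] by (simp add: u_def \<theta>_x)
  then have u_eq: "u = \<theta> u \<otimes> commutator G (\<theta> u) h"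
    using c by (simp add: u_def h_def commutator_def free_reduction)
  have "commutator G u h = commutator G (\<theta> u \<otimes> commutator G (\<theta> u) h) h"
    using u_eq by simp
  also have "\<dots> = commutator G (\<theta> u) h"
    using \<theta>u h commutator_lower_central_3 [OF \<theta>u(1) h] lower_central_3_subset_2
    by (simp add: commutator_hom_left_mult subset_eq commutator_lower_central_3_one)
  finally have "u = \<theta> u \<otimes> commutator G u h"
    using u_eq by simp
  then have "inv (\<theta> u) \<otimes> u = commutator G u h"
    using \<theta>u u h by (metis commutator_closed inv_cancel_left(2))
  moreover have "u \<otimes> inv (\<theta> u) = inv (\<theta> u) \<otimes> u"
    using u \<theta>u subgroup.m_inv_closed [OF lower_central_subgroup] by (intro lower_central_2_commutes) auto
  ultimately show ?thesis
    using hom_mult [OF commutator_hom_right [OF u(1)], of "x b" "x a"] c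
    by (simp add: u_def h_def commutator3_def)
qed

lemma twist_basic_comm2:
  assumes "i \<in> {1..n}" "s \<in> basic2 n"
  shows "twist i (basic_comm2 s) = pal_gen i s"
proof -
  obtain a b where s: "s = (a, b)" "a \<in> {1..n}" "b \<in> {1..n}"
    using assms by (auto simp: basic2_def)
  then have c: "x a \<in> carrier G" "x b \<in> carrier G" "x i \<in> carrier G" using assms by auto
  define u where "u = commutator G (x a) (x b)"
  have u: "u \<in> carrier G" using c by (simp add: u_def)
  have "twist i u = u \<otimes> commutator G u (x i) \<otimes> inv (\<theta> u)"
    using u c by (simp add: twist_def commutator_def [of G u] free_reduction)
  also have "u \<otimes> commutator G u (x i) = T (x a) (x b) (x i) \<otimes> u"
    using lower_central_3_central [OF commutator3_lower_central u, of "x a" "x b" "x i"] c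
    by (simp add: u_def commutator3_def)
  also have "T (x a) (x b) (x i) \<otimes> u \<otimes> inv (\<theta> u) = T (x a) (x b) (x i) \<otimes> (u \<otimes> inv (\<theta> u))"
    using c u by (simp add: m_assoc)
  also have "u \<otimes> inv (\<theta> u) = T (x a) (x b) (x b) \<otimes> T (x a) (x b) (x a)"
    unfolding u_def using s by (intro \<theta>_commutator)
  finally show ?thesis
    using s c by (simp add: u_def basic_comm2_def pal_gen_def m_assoc)
qed

definition Pal :: "nat \<Rightarrow> 'a set" where
  "Pal i = generate G (pal_gen i ` basic2 n \<union> (\<lambda>s. basic_comm3 s \<otimes> basic_comm3 s) ` basic3 n)"

text \<open>The homomorphism \<open>twist i\<close> is evaluated on the generators of \<open>\<gamma>\<^sub>2\<close>.\<close>
lemma twist_image: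
  assumes i: "i \<in> {1..n}"
  shows "twist i ` lower_central G 2 = Pal i"
proof -
  interpret \<Gamma>: comm_group \<Gamma>\<^sub>2 by (rule comm_group_\<Gamma>\<^sub>2)
  interpret t: group_hom \<Gamma>\<^sub>2 G "twist i"
    using twist_hom [OF i] by (simp add: group_hom_def group_hom_axioms_def)
  have sub: "basic_comm2 ` basic2 n \<union> basic_comm3 ` basic3 n \<subseteq> lower_central G 2"
    using basic_comm2_lower_central basic_comm3_lower_central lower_central_3_subset_2 by blast
  have "lower_central G 2 = generate \<Gamma>\<^sub>2 (basic_comm2 ` basic2 n \<union> basic_comm3 ` basic3 n)"
    using generate_consistent [OF sub lower_central_subgroup] lower_central_2_basic by simp
  then have "twist i ` lower_central G 2 = generate G (twist i ` (basic_comm2 ` basic2 n \<union> basic_comm3 ` basic3 n))"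
    using t.generate_img [of "basic_comm2 ` basic2 n \<union> basic_comm3 ` basic3 n"] sub by simp
  also have "twist i ` (basic_comm2 ` basic2 n \<union> basic_comm3 ` basic3 n) =
      pal_gen i ` basic2 n \<union> (\<lambda>s. basic_comm3 s \<otimes> basic_comm3 s) ` basic3 n"
    unfolding image_Un image_image
    using i twist_basic_comm2 twist_lower_central_3 basic_comm3_lower_central by (intro arg_cong2 [of _ _ _ _ "(\<union>)"] image_cong) auto
  finally show ?thesis
    by (simp add: Pal_def)
qed

lemma palindromic_iff:
  assumes "i \<in> {1..n}" "z \<in> lower_central G 3"
  shows "palindromic (x i \<otimes> z) \<longleftrightarrow> z \<in> Pal i"
  using palindromic_iff_twist_carrier [OF assms] twist_image [OF assms(1)] by simp

end

section \<open>A basis adapted to the palindromic elements\<close>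

text \<open>The basic triple that the palindromic element belonging to a pair replaces. It must have coefficient
one in \<open>[x\<^sub>a, x\<^sub>b, x\<^sub>i] [x\<^sub>a, x\<^sub>b, x\<^sub>b] [x\<^sub>a, x\<^sub>b, x\<^sub>a]\<close>. For \<open>i = b\<close> the factor \<open>[x\<^sub>a, x\<^sub>b, x\<^sub>b]\<close> occurs
twice, so the other one is taken.\<close>
definition pivot :: "nat \<Rightarrow> nat \<times> nat \<Rightarrow> nat \<times> nat \<times> nat" where
  "pivot i p = (fst p, snd p, if i = snd p then fst p else snd p)"

lemma pivot_inj: "inj_on (pivot i) A"
  by (auto simp: inj_on_def pivot_def prod_eq_iff)

lemma pivot_basic3: "p \<in> basic2 n \<Longrightarrow> pivot i p \<in> basic3 n"
  by (auto simp: pivot_def basic2_def basic3_def)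

definition nonpivots :: "nat \<Rightarrow> nat \<Rightarrow> (nat \<times> nat \<times> nat) set" where
  "nonpivots n i = basic3 n - pivot i ` basic2 n"

context free_class3 begin

lemma coord3_mult:
  "z \<in> lower_central G 3 \<Longrightarrow> w \<in> lower_central G 3 \<Longrightarrow> coord3 s (z \<otimes> w) = coord3 s z + coord3 s w"
  using hom_mult [OF coord3_hom, of z w] by simp

lemma pal_gen_lower_central:
  assumes "i \<in> {1..n}" "p \<in> basic2 n"
  shows "pal_gen i p \<in> lower_central G 3"
  using assms subgroup.m_closed [OF lower_central_subgroup]
  by (auto simp: pal_gen_def basic2_def commutator3_lower_central)

text \<open>The pivot of \<open>(a, b)\<close> uses the indices \<open>a\<close> and \<open>b\<close>, one of them twice. A commutator
\<open>[x\<^sub>c, x\<^sub>d, x\<^sub>k]\<close> with \<open>d < c\<close> has the same indices only if \<open>(c, d) = (a, b)\<close>, and the pivot was chosen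
different from \<open>[x\<^sub>a, x\<^sub>b, x\<^sub>i]\<close>.\<close>
lemma coord3_pivot_pal_gen:
  assumes i: "i \<in> {1..n}" and p: "p \<in> basic2 n" and q: "q \<in> basic2 n"
  shows "coord3 (pivot i p) (pal_gen i q) = (if p = q then 1 else 0)"
proof -
  obtain a b a' b' where pq: "p = (a, b)" "q = (a', b')" by (cases p, cases q)
  have ab: "1 \<le> b" "b < a" "a \<le> n" "1 \<le> b'" "b' < a'" "a' \<le> n"
    using p q pq by (auto simp: basic2_def)
  have lc: "T (x a') (x b') (x c) \<in> lower_central G 3" if "c \<in> {1..n}" for c
    using ab that by (intro commutator3_lower_central) auto
  have sum: "coord3 s (pal_gen i q) =
      coord3 s (T (x a') (x b') (x i)) + coord3 s (T (x a') (x b') (x b')) + coord3 s (T (x a') (x b') (x a'))" for s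
    using ab i lc subgroup.m_closed [OF lower_central_subgroup]
    by (simp add: pal_gen_def pq coord3_mult)
  have deg: "deg3 (\<mu> (T (x a') (x b') (x c))) j k l =
     of_bool (j = a' \<and> k = b' \<and> l = c) - of_bool (j = b' \<and> k = a' \<and> l = c)
    - of_bool (j = c \<and> k = a' \<and> l = b') + of_bool (j = c \<and> k = b' \<and> l = a')" if "c \<in> {1..n}" for c j k l
    using ab that by (intro deg3_\<mu>_commutator3) auto
  show ?thesis
  proof (cases "i = b")
    case True
    then show ?thesis
      using ab i unfolding sum by (auto simp: pq pivot_def coord3_def deg)
  next
    case False
    then show ?thesis
      using ab i unfolding sum by (auto simp: pq pivot_def coord3_def deg)
  qed
qed

text \<open>The adapted basis of \<open>\<gamma>\<^sub>3\<close>, indexed by the same triples: pivots give way to palindromic elements. A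
pivot for \<open>(a, b)\<close> starts with \<open>a, b\<close>, from which the pair is recovered.\<close>
definition adapted :: "nat \<Rightarrow> nat \<times> nat \<times> nat \<Rightarrow> 'a" where
  "adapted i s = (if s \<in> nonpivots n i then basic_comm3 s else pal_gen i (fst s, fst (snd s)))"

text \<open>The dual coordinates. Clearing the pivots of \<open>z\<close> by palindromic elements costs the sum that is
subtracted at the remaining triples.\<close>
definition adapted_coord :: "nat \<Rightarrow> nat \<times> nat \<times> nat \<Rightarrow> 'a \<Rightarrow> int" where
  "adapted_coord i s z = coord3 s z -
     (if s \<in> nonpivots n i then \<Sum>p\<in>basic2 n. coord3 (pivot i p) z * coord3 s (pal_gen i p) else 0)"

lemma adapted_pivot: "p \<in> basic2 n \<Longrightarrow> adapted i (pivot i p) = pal_gen i p"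
  by (auto simp: adapted_def nonpivots_def) (simp add: pivot_def)

lemma pivot_cases:
  assumes "s \<in> basic3 n"
  obtains "s \<in> nonpivots n i" | p where "p \<in> basic2 n" "s = pivot i p"
  using assms unfolding nonpivots_def by blast

lemma adapted_lower_central: "i \<in> {1..n} \<Longrightarrow> s \<in> basic3 n \<Longrightarrow> adapted i s \<in> lower_central G 3"
  by (rule pivot_cases [of s i]) (simp_all add: adapted_pivot pal_gen_lower_central, simp add: adapted_def basic_comm3_lower_central)

lemma adapted_coord_hom: "adapted_coord i s \<in> hom \<Gamma>\<^sub>3 integer_group"
  by (rule homI) (simp_all add: adapted_coord_def coord3_mult sum.distrib algebra_simps)

lemma adapted_dual:
  assumes i: "i \<in> {1..n}" and s: "s \<in> basic3 n" and t: "t \<in> basic3 n"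
  shows "adapted_coord i s (adapted i t) = (if s = t then 1 else 0)"
proof (rule pivot_cases [OF t, of i])
  assume t': "t \<in> nonpivots n i"
  then have "coord3 (pivot i p) (basic_comm3 t) = 0" if "p \<in> basic2 n" for p
    using that t coord3_basic_comm3 [OF pivot_basic3 [OF that] t] by (auto simp: nonpivots_def)
  then show ?thesis
    using t' s t by (simp add: adapted_def adapted_coord_def coord3_basic_comm3)
next
  fix q assume q: "q \<in> basic2 n" "t = pivot i q"
  then have t': "t \<notin> nonpivots n i" by (auto simp: nonpivots_def)
  show ?thesis
  proof (rule pivot_cases [OF s, of i])
    assume s': "s \<in> nonpivots n i"
    have "(\<Sum>p\<in>basic2 n. coord3 (pivot i p) (pal_gen i q) * coord3 s (pal_gen i p)) =
        (\<Sum>p\<in>basic2 n. if p = q then coord3 s (pal_gen i p) else 0)"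
      using i q by (intro sum.cong) (auto simp: coord3_pivot_pal_gen)
    also have "\<dots> = coord3 s (pal_gen i q)"
      using q by simp
    finally show ?thesis
      using s' t' q by (auto simp: adapted_coord_def adapted_pivot)
  next
    fix p assume p: "p \<in> basic2 n" "s = pivot i p"
    then have "s \<notin> nonpivots n i" by (auto simp: nonpivots_def)
    moreover have "s = t \<longleftrightarrow> p = q"
      using p q inj_onD [OF pivot_inj [of i "basic2 n"], of p q] by auto
    ultimately show ?thesis
      using i p q by (simp add: adapted_coord_def adapted_pivot coord3_pivot_pal_gen)
  qed
qed

lemma one_if_adapted_coord_zero:
  assumes z: "z \<in> lower_central G 3" and zero: "\<And>s. s \<in> basic3 n \<Longrightarrow> adapted_coord i s z = 0"
  shows "z = \<one>"
proof (rule one_if_coord3_zero [OF z])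
  have piv: "coord3 (pivot i p) z = 0" if "p \<in> basic2 n" for p
    using zero [OF pivot_basic3 [OF that]] that by (auto simp: adapted_coord_def nonpivots_def)
  show "coord3 s z = 0" if "s \<in> basic3 n" for s
    using zero [OF that] piv by (simp add: adapted_coord_def split: if_splits)
qed

lemma Pal_subgroup: 
  assumes "i \<in> {1..n}"
  shows "subgroup (Pal i) G" "Pal i \<subseteq> lower_central G 3" "subgroup (Pal i) \<Gamma>\<^sub>3"
proof -
  have sub: "pal_gen i ` basic2 n \<union> (\<lambda>s. basic_comm3 s \<otimes> basic_comm3 s) ` basic3 n \<subseteq> lower_central G 3"
    using assms pal_gen_lower_central basic_comm3_lower_central subgroup.m_closed [OF lower_central_subgroup]
    by auto
  then show "Pal i \<subseteq> lower_central G 3"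
    unfolding Pal_def by (rule generate_subgroup_incl [OF _ lower_central_subgroup])
  show "subgroup (Pal i) G"
    unfolding Pal_def using sub lower_central_subset by (intro generate_is_subgroup) blast
  then show "subgroup (Pal i) \<Gamma>\<^sub>3"
    using \<open>Pal i \<subseteq> lower_central G 3\<close> lower_central_subgroup by (intro subgroup_incl)
qed

text \<open>In adapted coordinates the generators of \<open>Pal i\<close> are the basis elements at pivots and the doubles of
the basic commutators. Conversely, an element with even coordinates outside the pivots has the same
coordinates as a product of such generators, hence equals it.\<close>
lemma Pal_iff_even:
  assumes i: "i \<in> {1..n}" and z: "z \<in> lower_central G 3"
  shows "z \<in> Pal i \<longleftrightarrow> (\<forall>s\<in>nonpivots n i. even (adapted_coord i s z))"
proof
  interpret \<Gamma>: comm_group \<Gamma>\<^sub>3 by (rule comm_group_\<Gamma>\<^sub>3)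
  let ?S = "pal_gen i ` basic2 n \<union> (\<lambda>s. basic_comm3 s \<otimes> basic_comm3 s) ` basic3 n"
  have sub: "?S \<subseteq> lower_central G 3"
    using i pal_gen_lower_central basic_comm3_lower_central subgroup.m_closed [OF lower_central_subgroup]
    by auto
  show "\<forall>s\<in>nonpivots n i. even (adapted_coord i s z)" if "z \<in> Pal i"
  proof
    fix s assume s: "s \<in> nonpivots n i"
    interpret d: group_hom \<Gamma>\<^sub>3 integer_group "adapted_coord i s"
      using adapted_coord_hom by (simp add: group_hom_def group_hom_axioms_def)
    have "adapted_coord i s z \<in> {k. even k}"
    proof (rule d.subgroup_contains_image_of_generate)
      show "?S \<subseteq> carrier \<Gamma>\<^sub>3" using sub by simp
      show "subgroup {k. even k} integer_group"
        by (rule subgroup.intro) auto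
      show "z \<in> generate \<Gamma>\<^sub>3 ?S"
        using that generate_consistent [OF sub lower_central_subgroup] by (simp add: Pal_def)
      have "adapted_coord i s (pal_gen i p) = 0" if "p \<in> basic2 n" for p
        using adapted_dual [OF i _ pivot_basic3 [OF that], of s i] s that
        by (auto simp: nonpivots_def adapted_pivot split: if_splits)
      moreover have "even (adapted_coord i s (basic_comm3 t \<otimes> basic_comm3 t))" if "t \<in> basic3 n" for t
        using d.hom_mult [of "basic_comm3 t" "basic_comm3 t"] basic_comm3_lower_central [OF that] by simp
      ultimately show "adapted_coord i s ` ?S \<subseteq> {k. even k}"
        by auto
    qed
    then show "even (adapted_coord i s z)" by simp
  qed
  show "z \<in> Pal i" if even: "\<forall>s\<in>nonpivots n i. even (adapted_coord i s z)"
  proof -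
    note P = Pal_subgroup [OF i]
    have "adapted i s [^]\<^bsub>\<Gamma>\<^sub>3\<^esub> adapted_coord i s z \<in> Pal i" if s: "s \<in> basic3 n" for s
    proof (rule pivot_cases [OF s, of i])
      assume s': "s \<in> nonpivots n i"
      then obtain m where m: "adapted_coord i s z = 2 * m"
        using even by (auto elim: evenE)
      have b: "basic_comm3 s \<in> carrier \<Gamma>\<^sub>3" using basic_comm3_lower_central [OF s] by simp
      have "basic_comm3 s [^]\<^bsub>\<Gamma>\<^sub>3\<^esub> (2 * m) = (basic_comm3 s [^]\<^bsub>\<Gamma>\<^sub>3\<^esub> (2::int)) [^]\<^bsub>\<Gamma>\<^sub>3\<^esub> m"
        using \<Gamma>.int_pow_pow [OF b] by simp
      also have "basic_comm3 s [^]\<^bsub>\<Gamma>\<^sub>3\<^esub> (2::int) = basic_comm3 s \<otimes> basic_comm3 s"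
        using \<Gamma>.int_pow_mult [OF b, of 1 1] \<Gamma>.int_pow_1 [OF b] by simp
      also have "(basic_comm3 s \<otimes> basic_comm3 s) [^]\<^bsub>\<Gamma>\<^sub>3\<^esub> m \<in> Pal i"
        using s by (intro \<Gamma>.subgroup_int_pow_closed P) (auto simp: Pal_def intro: generate.incl)
      finally show ?thesis
        using s' m by (simp add: adapted_def)
    next
      fix p assume p: "p \<in> basic2 n" "s = pivot i p"
      then have "adapted i s \<in> Pal i"
        by (auto simp: adapted_pivot Pal_def intro: generate.incl)
      then show ?thesis
        by (intro \<Gamma>.subgroup_int_pow_closed P)
    qed
    then obtain y where y: "y \<in> Pal i" "\<And>s. s \<in> basic3 n \<Longrightarrow> adapted_coord i s y = adapted_coord i s z"
      by (rule \<Gamma>.dual_coordinates_prescribed [of "basic3 n" "adapted i" "adapted_coord i" "Pal i"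
          "\<lambda>s. adapted_coord i s z", rotated 5])
         (use adapted_lower_central [OF i] adapted_coord_hom adapted_dual [OF i] P in auto)
    have y': "y \<in> lower_central G 3" using y P by blast
    have "z \<otimes>\<^bsub>\<Gamma>\<^sub>3\<^esub> inv\<^bsub>\<Gamma>\<^sub>3\<^esub> y = \<one>"
    proof (rule one_if_adapted_coord_zero)
      show "z \<otimes>\<^bsub>\<Gamma>\<^sub>3\<^esub> inv\<^bsub>\<Gamma>\<^sub>3\<^esub> y \<in> lower_central G 3"
        using \<Gamma>.m_closed [of z "inv\<^bsub>\<Gamma>\<^sub>3\<^esub> y"] \<Gamma>.inv_closed [of y] y' z by simp
      fix s assume s: "s \<in> basic3 n"
      interpret d: group_hom \<Gamma>\<^sub>3 integer_group "adapted_coord i s"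
        using adapted_coord_hom by (simp add: group_hom_def group_hom_axioms_def)
      show "adapted_coord i s (z \<otimes>\<^bsub>\<Gamma>\<^sub>3\<^esub> inv\<^bsub>\<Gamma>\<^sub>3\<^esub> y) = 0"
        using d.hom_mult [of z "inv\<^bsub>\<Gamma>\<^sub>3\<^esub> y"] d.hom_inv [of y] y(2) [OF s] y' z \<Gamma>.inv_closed [of y] by simp
    qed
    then have "z = y"
      using \<Gamma>.inv_solve_right' [of \<one> z y] y' z \<Gamma>.one_closed \<Gamma>.l_one [of y] by simp
    then show ?thesis using y by simp
  qed
qed

end

section \<open>Ranks\<close>

lemma card_nonpivots: "card (nonpivots n i) + card (basic2 n) = card (basic3 n)"
proof -
  have "pivot i ` basic2 n \<subseteq> basic3 n"
    using pivot_basic3 by blast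
  then have "card (nonpivots n i) = card (basic3 n) - card (basic2 n)"
    unfolding nonpivots_def by (simp add: card_Diff_subset card_image pivot_inj)
  moreover have "card (basic2 n) \<le> card (basic3 n)"
    using \<open>pivot i ` basic2 n \<subseteq> basic3 n\<close> finite_basic3 by (metis card_image card_mono pivot_inj)
  ultimately show ?thesis by simp
qed

lemma card_basic2: "2 * card (basic2 n) = n * (n - 1)"
proof -
  have "basic2 n = (\<Union>a\<in>{..n}. (\<lambda>b. (a, b)) ` {1..<a})"
    by (auto simp: basic2_def)
  also have "card \<dots> = (\<Sum>a\<le>n. a - 1)"
    by (subst card_UN_disjoint) (auto simp: card_image inj_on_def)
  finally have "card (basic2 n) = (\<Sum>a\<le>n. a - 1)" .
  moreover have "2 * (\<Sum>a\<le>n. a - 1) = n * (n - 1)"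
  proof (induction n)
    case (Suc n)
    then show ?case by (cases n) (simp_all add: algebra_simps)
  qed simp
  ultimately show ?thesis by simp
qed

text \<open>For each least index \<open>b\<close> there are \<open>n - b\<close> choices of \<open>a\<close> and \<open>n - b + 1\<close> choices of \<open>c\<close>.\<close>
lemma card_basic3: "3 * card (basic3 n) + n = n ^ 3"
proof -
  have split: "basic3 n = (\<Union>b\<in>{1..n}. (\<lambda>(a, c). (a, b, c)) ` ({b<..n} \<times> {b..n}))"
    by (auto simp: basic3_def image_iff)
  have "card (basic3 n) = (\<Sum>b\<in>{1..n}. (n - b) * (Suc n - b))"
    unfolding split by (subst card_UN_disjoint) (auto simp: card_image inj_on_def)
  also have "\<dots> = (\<Sum>k<n. k * Suc k)"
    by (rule sum.reindex_bij_witness [of _ "\<lambda>k. n - k" "\<lambda>b. n - b"]) (auto simp: Suc_diff_le)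
  finally have "card (basic3 n) = (\<Sum>k<n. k * Suc k)" .
  moreover have "3 * (\<Sum>k<n. k * Suc k) + n = n ^ 3"
    by (induction n) (auto simp: algebra_simps power3_eq_cube)
  ultimately show ?thesis by simp
qed

lemma real_card_basic2: "real (card (basic2 n)) = real n * (real n - 1) / 2"
proof -
  have "2 * real (card (basic2 n)) = real (n * (n - 1))"
    using card_basic2 [of n] by (metis of_nat_mult of_nat_numeral)
  also have "\<dots> = real n * (real n - 1)"
    by (cases n) (simp_all add: algebra_simps)
  finally show ?thesis by simp
qed

lemma real_card_basic3: "real (card (basic3 n)) = real n * ((real n)\<^sup>2 - 1) / 3"
proof -
  have "3 * real (card (basic3 n)) + real n = real n ^ 3"
    using card_basic3 [of n] by (metis of_nat_add of_nat_mult of_nat_numeral of_nat_power)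
  then show ?thesis
    by (simp add: power2_eq_square power3_eq_cube algebra_simps)
qed

section \<open>Central automorphisms\<close>

lemma autoD:
  assumes "\<phi> \<in> auto G"
  shows "\<phi> \<in> hom G G" "\<phi> \<in> extensional (carrier G)" "bij_betw \<phi> (carrier G) (carrier G)"
    "\<And>g. g \<in> carrier G \<Longrightarrow> \<phi> g \<in> carrier G"
  using assms by (auto simp: auto_def Bij_def intro: hom_in_carrier)

lemma AutoGroup_simps:
  "carrier (AutoGroup G) = auto G"
  "\<one>\<^bsub>AutoGroup G\<^esub> = (\<lambda>g\<in>carrier G. g)"
  "\<phi> \<in> auto G \<Longrightarrow> \<psi> \<in> auto G \<Longrightarrow> \<phi> \<otimes>\<^bsub>AutoGroup G\<^esub> \<psi> = compose (carrier G) \<phi> \<psi>"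
  by (auto simp: AutoGroup_def BijGroup_def auto_def)

lemma (in group) central_autos_subgroup: "subgroup (central_autos G) (AutoGroup G)"
proof -
  interpret A: group "AutoGroup G" by (rule AutoGroup)
  show ?thesis
  proof (rule subgroup.intro)
    show "central_autos G \<subseteq> carrier (AutoGroup G)"
      by (auto simp: central_autos_def AutoGroup_simps)
    show "\<one>\<^bsub>AutoGroup G\<^esub> \<in> central_autos G"
      using id_in_auto by (simp add: central_autos_def AutoGroup_simps)
  next
    fix \<phi> \<psi> assume *: "\<phi> \<in> central_autos G" "\<psi> \<in> central_autos G"
    then have a: "\<phi> \<in> auto G" "\<psi> \<in> auto G" by (auto simp: central_autos_def)
    then have "\<phi> \<otimes>\<^bsub>AutoGroup G\<^esub> \<psi> \<in> auto G"
      using A.m_closed by (simp add: AutoGroup_simps)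
    moreover have "center G #> (\<phi> \<otimes>\<^bsub>AutoGroup G\<^esub> \<psi>) g = center G #> g" if "g \<in> carrier G" for g
      using * that a autoD(4) [OF a(2) that] by (simp add: AutoGroup_simps compose_def central_autos_def)
    ultimately show "\<phi> \<otimes>\<^bsub>AutoGroup G\<^esub> \<psi> \<in> central_autos G"
      by (simp add: central_autos_def)
  next
    fix \<phi> assume *: "\<phi> \<in> central_autos G"
    define \<psi> where "\<psi> = inv\<^bsub>AutoGroup G\<^esub> \<phi>"
    have \<phi>: "\<phi> \<in> carrier (AutoGroup G)" using * by (simp add: central_autos_def AutoGroup_simps)
    then have \<psi>: "\<psi> \<in> auto G"
      using A.inv_closed by (simp add: \<psi>_def AutoGroup_simps)
    have eq: "\<phi> \<otimes>\<^bsub>AutoGroup G\<^esub> \<psi> = \<one>\<^bsub>AutoGroup G\<^esub>"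
      unfolding \<psi>_def by (rule A.r_inv [OF \<phi>])
    have "\<phi> (\<psi> g) = g" if "g \<in> carrier G" for g
      using fun_cong [OF eq, of g] \<phi> \<psi> that by (simp add: AutoGroup_simps compose_def)
    moreover have "center G #> \<phi> h = center G #> h" if "h \<in> carrier G" for h
      using * that by (simp add: central_autos_def)
    ultimately have "center G #> \<psi> g = center G #> g" if "g \<in> carrier G" for g
      using that autoD(4) [OF \<psi> that] by fastforce
    then show "inv\<^bsub>AutoGroup G\<^esub> \<phi> \<in> central_autos G"
      using \<psi> by (simp add: central_autos_def flip: \<psi>_def)
  qed
qed

context free_class3 begin

lemma endo_eqI:
  assumes "f \<in> hom G G" "h \<in> hom G G" "\<And>j. j \<in> {1..n} \<Longrightarrow> f (x j) = h (x j)" "g \<in> carrier G"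
  shows "f g = h g"
proof (rule hom_eq_on_generate [OF is_group is_group assms(1,2)])
  show "g \<in> generate G (x ` {1..n})"
    using assms(4) by (simp only: generated)
qed (use x assms(3) in auto)

lemma auto_eqI:
  assumes "\<phi> \<in> auto G" "\<psi> \<in> auto G" "\<And>j. j \<in> {1..n} \<Longrightarrow> \<phi> (x j) = \<psi> (x j)"
  shows "\<phi> = \<psi>"
  by (rule extensionalityI [OF autoD(2) [OF assms(1)] autoD(2) [OF assms(2)]])
     (rule endo_eqI [OF autoD(1) [OF assms(1)] autoD(1) [OF assms(2)] assms(3)])

text \<open>The central factor that \<open>g\<close> picks up when each \<open>x\<^sub>i\<close> picks up \<open>z\<^sub>i\<close>.\<close>
definition shift :: "(nat \<Rightarrow> 'a) \<Rightarrow> 'a \<Rightarrow> 'a" where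
  "shift z g = finprod \<Gamma>\<^sub>3 (\<lambda>i. z i [^]\<^bsub>\<Gamma>\<^sub>3\<^esub> expo i g) {1..n}"

definition transvection :: "(nat \<Rightarrow> 'a) \<Rightarrow> 'a \<Rightarrow> 'a" where
  "transvection z = (\<lambda>g\<in>carrier G. g \<otimes> shift z g)"

lemma fam_mem:
  assumes "z \<in> {1..n} \<rightarrow> lower_central G 3" "j \<in> {1..n}"
  shows "z j \<in> lower_central G 3" "z j \<in> carrier G"
  using assms lower_central_carrier by blast+

lemma shift_fam:
  assumes "z \<in> {1..n} \<rightarrow> lower_central G 3"
  shows "(\<lambda>i. z i [^]\<^bsub>\<Gamma>\<^sub>3\<^esub> expo i g) \<in> {1..n} \<rightarrow> carrier \<Gamma>\<^sub>3"
proof -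
  interpret \<Gamma>: comm_group \<Gamma>\<^sub>3 by (rule comm_group_\<Gamma>\<^sub>3)
  show ?thesis
  proof
    fix i assume "i \<in> {1..n}"
    then have "z i \<in> carrier \<Gamma>\<^sub>3" using assms by (simp add: Pi_iff)
    then show "z i [^]\<^bsub>\<Gamma>\<^sub>3\<^esub> expo i g \<in> carrier \<Gamma>\<^sub>3" by (rule \<Gamma>.int_pow_closed)
  qed
qed

lemma shift_closed:
  assumes "z \<in> {1..n} \<rightarrow> lower_central G 3"
  shows "shift z g \<in> lower_central G 3"
  using comm_monoid.finprod_closed [OF comm_group.axioms(1) [OF comm_group_\<Gamma>\<^sub>3] shift_fam [OF assms]]
  by (simp add: shift_def)

lemma shift_mult:
  assumes z: "z \<in> {1..n} \<rightarrow> lower_central G 3" and gh: "g \<in> carrier G" "h \<in> carrier G"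
  shows "shift z (g \<otimes> h) = shift z g \<otimes> shift z h"
proof -
  interpret \<Gamma>: comm_group \<Gamma>\<^sub>3 by (rule comm_group_\<Gamma>\<^sub>3)
  have "shift z (g \<otimes> h) =
      finprod \<Gamma>\<^sub>3 (\<lambda>i. z i [^]\<^bsub>\<Gamma>\<^sub>3\<^esub> expo i g \<otimes>\<^bsub>\<Gamma>\<^sub>3\<^esub> z i [^]\<^bsub>\<Gamma>\<^sub>3\<^esub> expo i h) {1..n}"
    unfolding shift_def
  proof (rule \<Gamma>.finprod_cong')
    fix i assume "i \<in> {1..n}"
    then have "z i \<in> carrier \<Gamma>\<^sub>3" using z by (simp add: Pi_iff)
    then show "z i [^]\<^bsub>\<Gamma>\<^sub>3\<^esub> expo i (g \<otimes> h) = z i [^]\<^bsub>\<Gamma>\<^sub>3\<^esub> expo i g \<otimes>\<^bsub>\<Gamma>\<^sub>3\<^esub> z i [^]\<^bsub>\<Gamma>\<^sub>3\<^esub> expo i h"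
      unfolding expo_mult [OF gh] by (rule \<Gamma>.int_pow_mult)
  next
    show "(\<lambda>i. z i [^]\<^bsub>\<Gamma>\<^sub>3\<^esub> expo i g \<otimes>\<^bsub>\<Gamma>\<^sub>3\<^esub> z i [^]\<^bsub>\<Gamma>\<^sub>3\<^esub> expo i h) \<in> {1..n} \<rightarrow> carrier \<Gamma>\<^sub>3"
      using shift_fam [OF z, of g] shift_fam [OF z, of h] \<Gamma>.m_closed unfolding Pi_iff by blast
  qed simp
  also have "\<dots> = shift z g \<otimes>\<^bsub>\<Gamma>\<^sub>3\<^esub> shift z h"
    unfolding shift_def by (rule \<Gamma>.finprod_multf [OF shift_fam [OF z] shift_fam [OF z]])
  finally show ?thesis by simp
qed

lemma shift_x:
  assumes z: "z \<in> {1..n} \<rightarrow> lower_central G 3" and j: "j \<in> {1..n}"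
  shows "shift z (x j) = z j"
proof -
  interpret \<Gamma>: comm_group \<Gamma>\<^sub>3 by (rule comm_group_\<Gamma>\<^sub>3)
  have zc: "z \<in> {1..n} \<rightarrow> carrier \<Gamma>\<^sub>3" using z by simp
  have "shift z (x j) = finprod \<Gamma>\<^sub>3 (\<lambda>i. if j = i then z i else \<one>\<^bsub>\<Gamma>\<^sub>3\<^esub>) {1..n}"
    unfolding shift_def
  proof (rule \<Gamma>.finprod_cong')
    fix i assume i: "i \<in> {1..n}"
    then have "z i \<in> carrier \<Gamma>\<^sub>3" using zc by blast
    then show "z i [^]\<^bsub>\<Gamma>\<^sub>3\<^esub> expo i (x j) = (if j = i then z i else \<one>\<^bsub>\<Gamma>\<^sub>3\<^esub>)"
      using j \<Gamma>.int_pow_1 by (simp add: expo_x del: one_closed)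
  next
    show "(\<lambda>i. if j = i then z i else \<one>\<^bsub>\<Gamma>\<^sub>3\<^esub>) \<in> {1..n} \<rightarrow> carrier \<Gamma>\<^sub>3"
      using zc \<Gamma>.one_closed by (simp add: Pi_iff)
  qed simp
  also have "\<dots> = z j"
    by (rule \<Gamma>.finprod_singleton [OF j _ zc]) simp
  finally show ?thesis .
qed

lemma shift_lower_central_2:
  assumes u: "u \<in> lower_central G 2"
  shows "shift z u = \<one>"
proof -
  interpret \<Gamma>: comm_group \<Gamma>\<^sub>3 by (rule comm_group_\<Gamma>\<^sub>3)
  have "shift z u = finprod \<Gamma>\<^sub>3 (\<lambda>i. \<one>\<^bsub>\<Gamma>\<^sub>3\<^esub>) {1..n}"
    unfolding shift_def
    by (rule \<Gamma>.finprod_cong') (use \<Gamma>.one_closed expo_lower_central_2 [OF u] in auto)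
  then show ?thesis
    using \<Gamma>.finprod_one by simp
qed

lemma transvection_hom:
  assumes z: "z \<in> {1..n} \<rightarrow> lower_central G 3"
  shows "transvection z \<in> hom G G"
proof (rule homI)
  fix g h assume gh: "g \<in> carrier G" "h \<in> carrier G"
  have c: "shift z g \<in> carrier G" "shift z h \<in> carrier G"
    using shift_closed [OF z] lower_central_carrier by auto
  have "transvection z (g \<otimes> h) = g \<otimes> (h \<otimes> shift z g) \<otimes> shift z h"
    using gh c by (simp add: transvection_def shift_mult [OF z gh] m_assoc)
  also have "h \<otimes> shift z g = shift z g \<otimes> h"
    using gh shift_closed [OF z] by (simp add: lower_central_3_central)
  finally show "transvection z (g \<otimes> h) = transvection z g \<otimes> transvection z h"
    using gh c by (simp add: transvection_def m_assoc)
qed (use shift_closed [OF z] lower_central_carrier in \<open>auto simp: transvection_def\<close>)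

lemma transvection_x:
  assumes "z \<in> {1..n} \<rightarrow> lower_central G 3" "j \<in> {1..n}"
  shows "transvection z (x j) = x j \<otimes> z j"
  using assms shift_x [OF assms] by (simp add: transvection_def)

lemma transvection_lower_central_2: "u \<in> lower_central G 2 \<Longrightarrow> transvection z u = u"
  using lower_central_carrier [of u 2] by (simp add: transvection_def shift_lower_central_2)

lemma transvection_compose_x:
  assumes z: "z \<in> {1..n} \<rightarrow> lower_central G 3" and w: "w \<in> {1..n} \<rightarrow> lower_central G 3" and j: "j \<in> {1..n}"
  shows "transvection z (transvection w (x j)) = x j \<otimes> z j \<otimes> w j"
proof -
  have wj: "w j \<in> lower_central G 3" "w j \<in> carrier G"
    by (rule fam_mem [OF w j])+
  then have "transvection z (w j) = w j"
    using lower_central_3_subset_2 transvection_lower_central_2 by blast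
  then show ?thesis
    using hom_mult [OF transvection_hom [OF z], of "x j" "w j"] wj j
    by (simp add: transvection_x [OF w j] transvection_x [OF z j])
qed

lemma transvection_inverse:
  assumes z: "z \<in> {1..n} \<rightarrow> lower_central G 3" and w: "w \<in> {1..n} \<rightarrow> lower_central G 3"
    and zw: "\<And>j. j \<in> {1..n} \<Longrightarrow> z j \<otimes> w j = \<one>" and g: "g \<in> carrier G"
  shows "transvection z (transvection w g) = g"
proof -
  have "(transvection z \<circ> transvection w) g = id g"
  proof (rule endo_eqI [of "transvection z \<circ> transvection w" id, OF _ _ _ g])
    show "transvection z \<circ> transvection w \<in> hom G G"
      by (rule Group.hom_compose [OF transvection_hom [OF w] transvection_hom [OF z]])
    show "id \<in> hom G G" by (simp add: hom_def)
    fix j assume j: "j \<in> {1..n}"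
    then have "z j \<in> carrier G" "w j \<in> carrier G"
      using fam_mem z w by blast+
    then show "(transvection z \<circ> transvection w) (x j) = id (x j)"
      using j zw [OF j] by (simp add: transvection_compose_x [OF z w j] m_assoc)
  qed
  then show ?thesis by simp
qed

text \<open>The transvection with the inverse family is a two-sided inverse.\<close>
lemma transvection_auto:
  assumes z: "z \<in> {1..n} \<rightarrow> lower_central G 3"
  shows "transvection z \<in> auto G"
proof -
  define w where "w j = inv z j" for j
  have w: "w \<in> {1..n} \<rightarrow> lower_central G 3"
    using z subgroup.m_inv_closed [OF lower_central_subgroup] unfolding w_def Pi_iff by blast
  have zc: "z j \<in> carrier G" if "j \<in> {1..n}" for j
    by (rule fam_mem(2) [OF z that])
  have closed: "transvection y g \<in> carrier G" if "g \<in> carrier G" "y \<in> {1..n} \<rightarrow> lower_central G 3" for g y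
    by (rule hom_in_carrier [OF transvection_hom [OF that(2)] that(1)])
  have "bij_betw (transvection z) (carrier G) (carrier G)"
  proof (rule bij_betw_byWitness [where f' = "transvection w"])
    show "\<forall>g\<in>carrier G. transvection w (transvection z g) = g"
      using transvection_inverse [OF w z] zc by (simp add: w_def)
    show "\<forall>g\<in>carrier G. transvection z (transvection w g) = g"
      using transvection_inverse [OF z w] zc by (simp add: w_def)
  qed (use closed z w in auto)
  then show ?thesis
    using transvection_hom [OF z] by (simp add: auto_def Bij_def transvection_def)
qed

lemma transvection_central:
  assumes z: "z \<in> {1..n} \<rightarrow> lower_central G 3"
  shows "transvection z \<in> central_autos G"
proof -
  have "center G #> transvection z g = center G #> g" if g: "g \<in> carrier G" for g
  proof -
    have s: "shift z g \<in> lower_central G 3" "shift z g \<in> carrier G"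
      using shift_closed [OF z] lower_central_carrier by auto
    have "lower_central G 3 #> (shift z g \<otimes> g) = (lower_central G 3 #> shift z g) #> g"
      using s g by (intro coset_mult_assoc [symmetric] lower_central_subset)
    also have "lower_central G 3 #> shift z g = lower_central G 3"
      using s by (intro coset_join2 lower_central_subgroup)
    finally show ?thesis
      using g s lower_central_3_central [OF s(1) g] by (simp add: transvection_def center_eq)
  qed
  then show ?thesis
    using transvection_auto [OF z] by (simp add: central_autos_def)
qed

text \<open>For a central automorphism the displacements \<open>x\<^sub>j\<^sup>-\<^sup>1 \<phi>(x\<^sub>j)\<close> lie in \<open>\<gamma>\<^sub>3\<close> and determine \<open>\<phi>\<close>.\<close>
definition displacement :: "('a \<Rightarrow> 'a) \<Rightarrow> nat \<Rightarrow> 'a" where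
  "displacement \<phi> j = inv x j \<otimes> \<phi> (x j)"

lemma central_auto_x:
  assumes \<phi>: "\<phi> \<in> central_autos G" and j: "j \<in> {1..n}"
  shows "displacement \<phi> j \<in> lower_central G 3" "\<phi> (x j) = x j \<otimes> displacement \<phi> j"
proof -
  have xj: "x j \<in> carrier G" using j by simp
  have \<phi>x: "\<phi> (x j) \<in> carrier G"
    using \<phi> autoD(4) [OF _ xj] by (simp add: central_autos_def)
  have "\<phi> (x j) \<in> lower_central G 3 #> \<phi> (x j)"
    by (rule rcos_self [OF \<phi>x lower_central_subgroup])
  also have "\<dots> = lower_central G 3 #> x j"
    using \<phi> xj by (simp add: central_autos_def center_eq)
  finally obtain w where w: "w \<in> lower_central G 3" "\<phi> (x j) = w \<otimes> x j"
    by (auto simp: r_coset_def)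
  then have "\<phi> (x j) = x j \<otimes> w"
    using xj lower_central_3_central by simp
  moreover from this have "displacement \<phi> j = w"
    using xj w lower_central_carrier by (simp add: displacement_def inv_cancel_left)
  ultimately show "displacement \<phi> j \<in> lower_central G 3" "\<phi> (x j) = x j \<otimes> displacement \<phi> j"
    using w by auto
qed

lemma displacement_fam: "\<phi> \<in> central_autos G \<Longrightarrow> displacement \<phi> \<in> {1..n} \<rightarrow> lower_central G 3"
  using central_auto_x(1) by blast

lemma displacement_transvection:
  assumes "z \<in> {1..n} \<rightarrow> lower_central G 3" "j \<in> {1..n}"
  shows "displacement (transvection z) j = z j"
proof -
  have "x j \<in> carrier G" "z j \<in> carrier G"
    using assms(2) fam_mem(2) [OF assms] by auto
  then show ?thesis
    unfolding displacement_def transvection_x [OF assms] by (rule inv_cancel_left(2))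
qed

lemma central_auto_eq_transvection:
  assumes "\<phi> \<in> central_autos G" "z \<in> {1..n} \<rightarrow> lower_central G 3" "\<And>j. j \<in> {1..n} \<Longrightarrow> displacement \<phi> j = z j"
  shows "\<phi> = transvection z"
  using assms central_auto_x(2) [OF assms(1)] transvection_auto [OF assms(2)] transvection_x [OF assms(2)]
  by (intro auto_eqI) (simp_all add: central_autos_def)

lemma central_auto_fixes_lower_central_2:
  assumes "\<phi> \<in> central_autos G" "u \<in> lower_central G 2"
  shows "\<phi> u = u"
  using central_auto_eq_transvection [OF assms(1) displacement_fam [OF assms(1)]] transvection_lower_central_2 [OF assms(2)]
  by metis

text \<open>A central automorphism fixes \<open>\<gamma>\<^sub>2\<close> pointwise, because exponent sums vanish there; so \<open>\<phi>\<close> leaves the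
displacement caused by \<open>\<psi>\<close> alone.\<close>
lemma displacement_mult:
  assumes \<phi>: "\<phi> \<in> central_autos G" and \<psi>: "\<psi> \<in> central_autos G" and j: "j \<in> {1..n}"
  shows "displacement (\<phi> \<otimes>\<^bsub>AutoGroup G\<^esub> \<psi>) j = displacement \<phi> j \<otimes> displacement \<psi> j"
proof -
  have a: "\<phi> \<in> auto G" "\<psi> \<in> auto G" using \<phi> \<psi> by (auto simp: central_autos_def)
  have xj: "x j \<in> carrier G" using j by simp
  have d: "displacement \<phi> j \<in> carrier G" "displacement \<psi> j \<in> carrier G" "\<phi> (displacement \<psi> j) = displacement \<psi> j"
    using central_auto_x(1) \<phi> \<psi> j lower_central_carrier lower_central_3_subset_2
      central_auto_fixes_lower_central_2 by blast+
  have "(\<phi> \<otimes>\<^bsub>AutoGroup G\<^esub> \<psi>) (x j) = \<phi> (x j \<otimes> displacement \<psi> j)"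
    using xj central_auto_x(2) [OF \<psi> j] by (simp add: AutoGroup_simps a compose_def)
  also have "\<dots> = \<phi> (x j) \<otimes> displacement \<psi> j"
    using hom_mult [OF autoD(1) [OF a(1)] xj d(2)] d(3) by simp
  also have "\<dots> = x j \<otimes> (displacement \<phi> j \<otimes> displacement \<psi> j)"
    using xj d by (simp add: central_auto_x(2) [OF \<phi> j] m_assoc)
  finally show ?thesis
    using xj d by (simp add: displacement_def [of "\<phi> \<otimes>\<^bsub>AutoGroup G\<^esub> \<psi>"] inv_cancel_left)
qed

lemma transvection_mult:
  assumes z: "z \<in> {1..n} \<rightarrow> lower_central G 3" and w: "w \<in> {1..n} \<rightarrow> lower_central G 3"
  shows "transvection z \<otimes>\<^bsub>AutoGroup G\<^esub> transvection w = transvection (\<lambda>j. z j \<otimes> w j)"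
proof (rule central_auto_eq_transvection)
  show "transvection z \<otimes>\<^bsub>AutoGroup G\<^esub> transvection w \<in> central_autos G"
    by (rule subgroup.m_closed [OF central_autos_subgroup transvection_central [OF z] transvection_central [OF w]])
  show "(\<lambda>j. z j \<otimes> w j) \<in> {1..n} \<rightarrow> lower_central G 3"
    using z w subgroup.m_closed [OF lower_central_subgroup] unfolding Pi_iff by blast
  fix j assume "j \<in> {1..n}"
  then show "displacement (transvection z \<otimes>\<^bsub>AutoGroup G\<^esub> transvection w) j = z j \<otimes> w j"
    using displacement_mult [OF transvection_central [OF z] transvection_central [OF w]] displacement_transvection [OF z] displacement_transvection [OF w]
    by metis
qed

definition single :: "nat \<Rightarrow> 'a \<Rightarrow> 'a \<Rightarrow> 'a" where
  "single i y = transvection (\<lambda>j. if j = i then y else \<one>)"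

lemma single_fam:
  assumes "y \<in> lower_central G 3"
  shows "(\<lambda>j. if j = i then y else \<one>) \<in> {1..n} \<rightarrow> lower_central G 3"
  using assms subgroup.one_closed [OF lower_central_subgroup] by auto

lemma single_central: "y \<in> lower_central G 3 \<Longrightarrow> single i y \<in> central_autos G"
  unfolding single_def by (rule transvection_central [OF single_fam])

lemma displacement_single:
  "y \<in> lower_central G 3 \<Longrightarrow> j \<in> {1..n} \<Longrightarrow> displacement (single i y) j = (if j = i then y else \<one>)"
  unfolding single_def by (rule displacement_transvection [OF single_fam])

lemma single_hom: "single i \<in> hom \<Gamma>\<^sub>3 (AutoGroup G)"
proof (rule homI)
  fix y y' assume "y \<in> carrier \<Gamma>\<^sub>3" "y' \<in> carrier \<Gamma>\<^sub>3"
  then have y: "y \<in> lower_central G 3" "y' \<in> lower_central G 3" by auto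
  have "single i y \<otimes>\<^bsub>AutoGroup G\<^esub> single i y' =
      transvection (\<lambda>j. (if j = i then y else \<one>) \<otimes> (if j = i then y' else \<one>))"
    unfolding single_def by (rule transvection_mult [OF single_fam [OF y(1)] single_fam [OF y(2)]])
  also have "(\<lambda>j. (if j = i then y else \<one>) \<otimes> (if j = i then y' else \<one>)) = (\<lambda>j. if j = i then y \<otimes> y' else \<one>)"
    by auto
  finally show "single i (y \<otimes>\<^bsub>\<Gamma>\<^sub>3\<^esub> y') = single i y \<otimes>\<^bsub>AutoGroup G\<^esub> single i y'"
    by (simp add: single_def)
qed (use single_central in \<open>auto simp: central_autos_def AutoGroup_simps\<close>)

lemma auto_moving_iff:
  assumes i: "i \<in> {1..n}" and y: "y \<in> lower_central G 3"
  shows "\<phi> \<in> auto G \<and> \<phi> (x i) = x i \<otimes> y \<and> (\<forall>j\<in>{1..n} - {i}. \<phi> (x j) = x j) \<longleftrightarrow> \<phi> = single i y"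
proof
  have s: "single i y \<in> auto G" using single_central [OF y] by (simp add: central_autos_def)
  have sx: "single i y (x j) = (if j = i then x i \<otimes> y else x j)" if "j \<in> {1..n}" for j
    unfolding single_def transvection_x [OF single_fam [OF y] that] using that by simp
  show "\<phi> = single i y" if "\<phi> \<in> auto G \<and> \<phi> (x i) = x i \<otimes> y \<and> (\<forall>j\<in>{1..n} - {i}. \<phi> (x j) = x j)"
    using that s sx by (intro auto_eqI) auto
  show "\<phi> \<in> auto G \<and> \<phi> (x i) = x i \<otimes> y \<and> (\<forall>j\<in>{1..n} - {i}. \<phi> (x j) = x j)" if "\<phi> = single i y"
    using that s sx i by auto
qed

definition CentralPal :: "('a \<Rightarrow> 'a) set" where
  "CentralPal = {\<phi> \<in> central_autos G. \<forall>i\<in>{1..n}. palindromic (\<phi> (x i))}"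

lemma CentralPal_eq: "CentralPal = {\<phi> \<in> central_autos G. \<forall>i\<in>{1..n}. displacement \<phi> i \<in> Pal i}"
  unfolding CentralPal_def using palindromic_iff central_auto_x by (intro Collect_cong) metis

abbreviation Central where "Central \<equiv> (AutoGroup G)\<lparr>carrier := central_autos G\<rparr>"

text \<open>The residues modulo two of the adapted coordinates of all displacements, taken outside the pivots,
form a homomorphism \<open>\<Lambda>\<close>. Its kernel is computed by \<open>Pal_iff_even\<close>, and it is onto because the
displacements and their coordinates can be prescribed independently. The bijection \<open>e\<close> enumerates the
\<open>n q\<close> coordinates.\<close>
lemma Central_quotient:
  assumes q: "q = card (basic3 n) - card (basic2 n)"
  shows "CentralPal \<lhd> Central" "Central Mod CentralPal \<cong> product_group {..<n * q} (\<lambda>_. integer_mod_group 2)"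
proof -
  interpret \<Gamma>: comm_group \<Gamma>\<^sub>3 by (rule comm_group_\<Gamma>\<^sub>3)
  define J where "J = Sigma {1..n} (nonpivots n)"
  have q': "card (nonpivots n i) = q" for i
    using card_nonpivots [of n i] q by simp
  have fin: "finite (nonpivots n i)" for i
    by (simp add: nonpivots_def)
  have "finite J" "card J = n * q"
    using fin by (auto simp: J_def q' simp del: atLeastAtMost_iff)
  then obtain e where e: "bij_betw e {..<n * q} J"
    using ex_bij_betw_nat_finite [of J] by (auto simp: atLeast0LessThan)
  let ?P = "product_group {..<n * q} (\<lambda>_. integer_mod_group 2)"
  define \<Lambda> where "\<Lambda> \<phi> = (\<lambda>k\<in>{..<n * q}. case e k of (i, s) \<Rightarrow> adapted_coord i s (displacement \<phi> i) mod 2)" for \<phi>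
  have eJ: "e k \<in> J" if "k < n * q" for k
    using e that by (auto simp: bij_betw_def)
  interpret \<Lambda>: group_hom Central ?P \<Lambda>
  proof (intro group_hom.intro group_hom_axioms.intro homI)
    show "group Central"
      by (rule group.subgroup_imp_group [OF AutoGroup central_autos_subgroup])
    show "group ?P" by simp
    show "\<Lambda> \<phi> \<in> carrier ?P" for \<phi>
      by (auto simp: \<Lambda>_def carrier_integer_mod_group split: prod.split)
    fix \<phi> \<psi> assume "\<phi> \<in> carrier Central" "\<psi> \<in> carrier Central"
    then have *: "\<phi> \<in> central_autos G" "\<psi> \<in> central_autos G" by auto
    show "\<Lambda> (\<phi> \<otimes>\<^bsub>Central\<^esub> \<psi>) = \<Lambda> \<phi> \<otimes>\<^bsub>?P\<^esub> \<Lambda> \<psi>"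
    proof
      fix k
      show "\<Lambda> (\<phi> \<otimes>\<^bsub>Central\<^esub> \<psi>) k = (\<Lambda> \<phi> \<otimes>\<^bsub>?P\<^esub> \<Lambda> \<psi>) k"
      proof (cases "k < n * q")
        case True
        obtain i s where es: "e k = (i, s)" by (rule prod.exhaust)
        then have i: "i \<in> {1..n}" using eJ [OF True] by (auto simp: J_def)
        have "adapted_coord i s (displacement \<phi> i \<otimes> displacement \<psi> i) = adapted_coord i s (displacement \<phi> i) + adapted_coord i s (displacement \<psi> i)"
          using hom_mult [OF adapted_coord_hom, of "displacement \<phi> i" "displacement \<psi> i"] central_auto_x(1) * i by simp
        then show ?thesis
          using True es by (simp add: \<Lambda>_def displacement_mult [OF * i] mod_add_eq)
      qed (simp add: \<Lambda>_def)
    qed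
  qed
  have "\<phi> \<in> kernel Central ?P \<Lambda> \<longleftrightarrow> \<phi> \<in> CentralPal" for \<phi>
  proof (cases "\<phi> \<in> central_autos G")
    case True
    have "\<Lambda> \<phi> = \<one>\<^bsub>?P\<^esub> \<longleftrightarrow> (\<forall>k<n * q. case e k of (i, s) \<Rightarrow> even (adapted_coord i s (displacement \<phi> i)))"
      by (auto simp: \<Lambda>_def fun_eq_iff even_iff_mod_2_eq_zero split: prod.splits)
    also have "\<dots> \<longleftrightarrow> (\<forall>(i, s)\<in>J. even (adapted_coord i s (displacement \<phi> i)))"
      using e unfolding bij_betw_def by (auto simp: image_iff split: prod.splits)
    also have "\<dots> \<longleftrightarrow> (\<forall>i\<in>{1..n}. \<forall>s\<in>nonpivots n i. even (adapted_coord i s (displacement \<phi> i)))"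
      by (auto simp: J_def)
    also have "\<dots> \<longleftrightarrow> (\<forall>i\<in>{1..n}. displacement \<phi> i \<in> Pal i)"
      using Pal_iff_even central_auto_x(1) [OF True] by simp
    finally show ?thesis
      using True by (simp add: kernel_def CentralPal_eq)
  qed (simp add: kernel_def CentralPal_eq)
  then have ker: "kernel Central ?P \<Lambda> = CentralPal" by blast
  then show "CentralPal \<lhd> Central"
    using \<Lambda>.normal_kernel by simp
  have "\<Lambda> ` carrier Central = carrier ?P"
  proof (intro equalityI subsetI)
    fix f assume f: "f \<in> carrier ?P"
    define e' where "e' = inv_into {..<n * q} e"
    have "\<exists>y\<in>lower_central G 3. \<forall>s\<in>basic3 n. adapted_coord i s y = f (e' (i, s))" if i: "i \<in> {1..n}" for i
    proof -
      obtain y where y: "y \<in> carrier \<Gamma>\<^sub>3" "\<And>s. s \<in> basic3 n \<Longrightarrow> adapted_coord i s y = f (e' (i, s))"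
        by (rule \<Gamma>.dual_coordinates_prescribed [of "basic3 n" "adapted i" "adapted_coord i" "carrier \<Gamma>\<^sub>3"
              "\<lambda>s. f (e' (i, s))"])
           (use adapted_lower_central [OF i] adapted_coord_hom adapted_dual [OF i] \<Gamma>.subgroup_self
             \<Gamma>.int_pow_closed in auto)
      from y(1) have "y \<in> lower_central G 3" by simp
      then show ?thesis using y(2) by blast
    qed
    then obtain z where z: "\<And>i. i \<in> {1..n} \<Longrightarrow> z i \<in> lower_central G 3"
      "\<And>i s. i \<in> {1..n} \<Longrightarrow> s \<in> basic3 n \<Longrightarrow> adapted_coord i s (z i) = f (e' (i, s))"
      by metis
    then have zfam: "z \<in> {1..n} \<rightarrow> lower_central G 3" by blast
    have "\<Lambda> (transvection z) = f"
    proof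
      fix k
      show "\<Lambda> (transvection z) k = f k"
      proof (cases "k < n * q")
        case True
        obtain i s where es: "e k = (i, s)" by (rule prod.exhaust)
        then have mem: "i \<in> {1..n}" "s \<in> basic3 n"
          using eJ [OF True] by (auto simp: J_def nonpivots_def)
        have "e' (i, s) = k"
          using e True by (simp add: e'_def bij_betw_def flip: es)
        moreover have "f k \<in> {0..<2}"
          using f True by (auto simp: carrier_integer_mod_group PiE_iff)
        ultimately show ?thesis
          using True es mem z by (simp add: \<Lambda>_def displacement_transvection [OF zfam mem(1)])
      qed (use f in \<open>auto simp: \<Lambda>_def PiE_iff extensional_def\<close>)
    qed
    then show "f \<in> \<Lambda> ` carrier Central"
      using transvection_central [OF zfam] by auto
  qed (use \<Lambda>.hom_closed in auto)
  then show "Central Mod CentralPal \<cong> ?P"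
    using \<Lambda>.FactGroup_iso ker by simp
qed

lemma CentralPal_subgroup: "subgroup CentralPal (AutoGroup G)"
  using group.incl_subgroup [OF AutoGroup central_autos_subgroup normal_imp_subgroup [OF Central_quotient(1)]]
  by blast

text \<open>On transvections moving a single \<open>x\<^sub>i\<close> composition is multiplication in \<open>\<gamma>\<^sub>3\<close>, so those with
displacement in \<open>Pal i\<close> are generated by the ones with displacement a generator of \<open>Pal i\<close>. A general
element is the product over \<open>i\<close> of its components, which is built up one index at a time.\<close>
lemma CentralPal_generated:
  "CentralPal = generate (AutoGroup G)
     (\<Union>i\<in>{1..n}. single i ` (pal_gen i ` basic2 n \<union> (\<lambda>s. basic_comm3 s \<otimes> basic_comm3 s) ` basic3 n))"
  (is "_ = generate _ ?S")
proof
  interpret A: group "AutoGroup G" by (rule AutoGroup)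
  interpret \<Gamma>: comm_group \<Gamma>\<^sub>3 by (rule comm_group_\<Gamma>\<^sub>3)
  let ?s = "\<lambda>i. pal_gen i ` basic2 n \<union> (\<lambda>s. basic_comm3 s \<otimes> basic_comm3 s) ` basic3 n"
  have single_mem: "single i y \<in> CentralPal" if i: "i \<in> {1..n}" and y: "y \<in> Pal i" for i y
  proof -
    have y': "y \<in> lower_central G 3"
      using Pal_subgroup(2) [OF i] y by blast
    then show ?thesis
      using y subgroup.one_closed [OF Pal_subgroup(1)]
      by (auto simp: CentralPal_eq single_central displacement_single)
  qed
  have s_Pal: "?s i \<subseteq> Pal i" for i
    unfolding Pal_def by (blast intro: generate.incl)
  then have "?S \<subseteq> CentralPal"
    using single_mem by blast
  then show "generate (AutoGroup G) ?S \<subseteq> CentralPal"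
    by (rule A.generate_subgroup_incl [OF _ CentralPal_subgroup])
  have H: "subgroup (generate (AutoGroup G) ?S) (AutoGroup G)"
    using \<open>?S \<subseteq> CentralPal\<close> subgroup.subset [OF CentralPal_subgroup] by (intro A.generate_is_subgroup) blast
  show "CentralPal \<subseteq> generate (AutoGroup G) ?S"
  proof
    fix \<phi> assume \<phi>: "\<phi> \<in> CentralPal"
    then have c: "\<phi> \<in> central_autos G" by (simp add: CentralPal_eq)
    have one: "\<one> \<in> lower_central G 3" by (rule subgroup.one_closed [OF lower_central_subgroup])
    have mem: "single i y \<in> generate (AutoGroup G) ?S" if i: "i \<in> {1..n}" and y: "y \<in> Pal i" for i y
    proof -
      interpret s: group_hom \<Gamma>\<^sub>3 "AutoGroup G" "single i"
        using single_hom A.is_group \<Gamma>.is_group by (simp add: group_hom_def group_hom_axioms_def)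
      have sub: "?s i \<subseteq> lower_central G 3"
        using Pal_subgroup(2) [OF i] s_Pal by blast
      show ?thesis
      proof (rule s.subgroup_contains_image_of_generate [OF _ H])
        show "?s i \<subseteq> carrier \<Gamma>\<^sub>3" using sub by simp
        show "single i ` ?s i \<subseteq> generate (AutoGroup G) ?S"
          using i by (blast intro: generate.incl)
        show "y \<in> generate \<Gamma>\<^sub>3 (?s i)"
          using y generate_consistent [OF sub lower_central_subgroup] by (simp add: Pal_def)
      qed
    qed
    have fam: "(\<lambda>j. if j \<le> k then displacement \<phi> j else \<one>) \<in> {1..n} \<rightarrow> lower_central G 3" for k
      using displacement_fam [OF c] one by auto
    have "transvection (\<lambda>j. if j \<le> k then displacement \<phi> j else \<one>) \<in> generate (AutoGroup G) ?S" if "k \<le> n" for k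
      using that
    proof (induction k)
      case 0
      have "\<one>\<^bsub>AutoGroup G\<^esub> = transvection (\<lambda>j. if j \<le> 0 then displacement \<phi> j else \<one>)"
        using id_in_auto transvection_auto [OF fam [of 0]] transvection_x [OF fam, of _ 0]
        by (intro auto_eqI) (auto simp: AutoGroup_simps)
      then show ?case using generate.one by metis
    next
      case (Suc k)
      then have k: "Suc k \<in> {1..n}" by simp
      then have d: "displacement \<phi> (Suc k) \<in> lower_central G 3" "displacement \<phi> (Suc k) \<in> Pal (Suc k)"
        using central_auto_x(1) [OF c] \<phi> by (auto simp: CentralPal_eq)
      have "transvection (\<lambda>j. if j \<le> k then displacement \<phi> j else \<one>) \<otimes>\<^bsub>AutoGroup G\<^esub> single (Suc k) (displacement \<phi> (Suc k)) =
          transvection (\<lambda>j. if j \<le> Suc k then displacement \<phi> j else \<one>)"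
      proof (rule central_auto_eq_transvection [OF _ fam])
        show "transvection (\<lambda>j. if j \<le> k then displacement \<phi> j else \<one>) \<otimes>\<^bsub>AutoGroup G\<^esub> single (Suc k) (displacement \<phi> (Suc k)) \<in> central_autos G"
          using subgroup.m_closed [OF central_autos_subgroup] transvection_central [OF fam] single_central [OF d(1)] by blast
        fix j assume j: "j \<in> {1..n}"
        then have "displacement \<phi> j \<in> carrier G"
          using central_auto_x(1) [OF c] lower_central_carrier by blast
        then show "displacement (transvection (\<lambda>j. if j \<le> k then displacement \<phi> j else \<one>) \<otimes>\<^bsub>AutoGroup G\<^esub> single (Suc k) (displacement \<phi> (Suc k))) j =
            (if j \<le> Suc k then displacement \<phi> j else \<one>)"
          using j d by (auto simp: displacement_mult [OF transvection_central [OF fam] single_central [OF d(1)] j]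
              displacement_transvection [OF fam] displacement_single [OF d(1) j])
      qed
      moreover have "single (Suc k) (displacement \<phi> (Suc k)) \<in> generate (AutoGroup G) ?S"
        by (rule mem [OF k d(2)])
      ultimately show ?case
        using Suc generate.eng by fastforce
    qed
    from this [OF order_refl] show "\<phi> \<in> generate (AutoGroup G) ?S"
      using central_auto_eq_transvection [OF c fam [of n]] by simp
  qed
qed

end

section \<open>The free nilpotent group\<close>

text \<open>Both homomorphisms come from the universal property, as the Magnus group and the free nilpotent group
itself have trivial \<open>\<gamma>\<^sub>4\<close>.\<close>
lemma N3_free_class3:
  assumes "n \<ge> 2"
  obtains \<mu> \<theta> where "free_class3 (N3 n) n (gen n) \<mu> \<theta>"
proof -
  interpret N: group "N3 n" by (rule group_N3)
  obtain \<mu> where \<mu>: "\<mu> \<in> hom (N3 n) magnus" "\<And>i. i \<in> {1..n} \<Longrightarrow> \<mu> (gen n i) = magnus_gen i"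
    using N3_universal [OF group_magnus lower_central_4_magnus, of magnus_gen n] by auto
  obtain \<theta> where \<theta>: "\<theta> \<in> hom (N3 n) (N3 n)" "\<And>i. i \<in> {1..n} \<Longrightarrow> \<theta> (gen n i) = inv\<^bsub>N3 n\<^esub> gen n i"
    using N3_universal [OF group_N3 lower_central_4_N3, of "\<lambda>i. inv\<^bsub>N3 n\<^esub> gen n i" n] gen_closed by blast
  have "free_class3 (N3 n) n (gen n) \<mu> \<theta>"
    by unfold_locales (fact lower_central_4_N3 gen_closed N3_generated assms \<mu> \<theta>)+
  then show thesis by (rule that)
qed

text \<open>The generators of the theorem are listed by their indices, whereas the structural description groups
them by the moved generator.\<close>
lemma Collect_pairs_eq_UN:
  assumes "\<And>a b i. (a, b) \<in> B \<Longrightarrow> i \<in> I \<Longrightarrow> f a b i = h i (a, b)"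
  shows "{f a b i | a b i. (a, b) \<in> B \<and> i \<in> I} = (\<Union>i\<in>I. h i ` B)"
proof (intro equalityI subsetI)
  fix y assume "y \<in> (\<Union>i\<in>I. h i ` B)"
  then obtain i a b where "i \<in> I" "(a, b) \<in> B" "y = f a b i" using assms by auto
  then show "y \<in> {f a b i | a b i. (a, b) \<in> B \<and> i \<in> I}" by blast
next
  fix y assume "y \<in> {f a b i | a b i. (a, b) \<in> B \<and> i \<in> I}"
  then obtain a b i where "(a, b) \<in> B" "i \<in> I" "y = h i (a, b)" using assms by auto
  then show "y \<in> (\<Union>i\<in>I. h i ` B)" by blast
qed

theorem proposition4p3:
  fixes n :: nat
  assumes "n \<ge> 2"
  shows
    "(\<forall>a b i. 1 \<le> b \<and> b < a \<and> a \<le> n \<and> 1 \<le> i \<and> i \<le> n \<longrightarrow>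
        (\<exists>!\<phi>. aut_moving n i (phi_ab_image n a b i) \<phi>)) \<and>
     (\<forall>a b c i. 1 \<le> b \<and> b < a \<and> a \<le> n \<and> b \<le> c \<and> c \<le> n \<and> 1 \<le> i \<and> i \<le> n \<longrightarrow>
        (\<exists>!\<phi>. aut_moving n i (phi_abc_image n a b c i) \<phi>)) \<and>
     central_palindromic_autos n =
       generate (AutoGroup (N3 n))
         ({phi_ab n a b i | a b i. 1 \<le> b \<and> b < a \<and> a \<le> n \<and> 1 \<le> i \<and> i \<le> n} \<union>
          {phi_abc n a b c i | a b c i.
             1 \<le> b \<and> b < a \<and> a \<le> n \<and> b \<le> c \<and> c \<le> n \<and> 1 \<le> i \<and> i \<le> n}) \<and>
     central_palindromic_autos n \<lhd> CentralAutGroup n \<and>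
     fin_free_abelian (gamma3_N3 n) \<and>
     fin_free_abelian (gamma2_N3 n Mod lower_central (N3 n) 3) \<and>
     (\<exists>q::nat.
        real q = real (free_abelian_rank (gamma3_N3 n))
                 - real (free_abelian_rank (gamma2_N3 n Mod lower_central (N3 n) 3)) \<and>
        real q = real n * ((real n)\<^sup>2 - 1) / 3 - real n * (real n - 1) / 2 \<and>
        CentralAutGroup n Mod central_palindromic_autos n
          \<cong> product_group {..<n * q} (\<lambda>_. integer_mod_group 2))"
proof -
  from N3_free_class3 [OF assms] obtain \<mu> \<theta> where "free_class3 (N3 n) n (gen n) \<mu> \<theta>" .
  then interpret free_class3 "N3 n" n "gen n" \<mu> \<theta> .
  have moving: "aut_moving n i (gen n i \<otimes>\<^bsub>N3 n\<^esub> y) \<phi> \<longleftrightarrow> \<phi> = single i y"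
    if "i \<in> {1..n}" "y \<in> lower_central (N3 n) 3" for i y \<phi>
    unfolding aut_moving_def using auto_moving_iff [OF that] .
  have ab: "aut_moving n i (phi_ab_image n a b i) \<phi> \<longleftrightarrow> \<phi> = single i (pal_gen i (a, b))"
    if "(a, b) \<in> basic2 n" "i \<in> {1..n}" for a b i \<phi>
  proof -
    have "a \<in> {1..n}" "b \<in> {1..n}" using that by (auto simp: basic2_def)
    then have "phi_ab_image n a b i = gen n i \<otimes>\<^bsub>N3 n\<^esub> pal_gen i (a, b)"
      using that by (simp add: phi_ab_image_def pal_gen_def m_assoc)
    then show ?thesis
      using moving [OF that(2) pal_gen_lower_central [OF that(2,1)]] by simp
  qed
  have abc: "aut_moving n i (phi_abc_image n a b c i) \<phi> \<longleftrightarrow> \<phi> = single i (basic_comm3 (a, b, c) \<otimes>\<^bsub>N3 n\<^esub> basic_comm3 (a, b, c))"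
    if "(a, b, c) \<in> basic3 n" "i \<in> {1..n}" for a b c i \<phi>
  proof -
    have "basic_comm3 (a, b, c) \<in> lower_central (N3 n) 3" using that basic_comm3_lower_central by blast
    moreover from this have "basic_comm3 (a, b, c) \<otimes>\<^bsub>N3 n\<^esub> basic_comm3 (a, b, c) \<in> lower_central (N3 n) 3"
      by (intro subgroup.m_closed [OF lower_central_subgroup])
    moreover have "phi_abc_image n a b c i = gen n i \<otimes>\<^bsub>N3 n\<^esub> (basic_comm3 (a, b, c) \<otimes>\<^bsub>N3 n\<^esub> basic_comm3 (a, b, c))"
      using calculation lower_central_carrier by (simp add: phi_abc_image_def basic_comm3_def numeral_2_eq_2)
    ultimately show ?thesis
      using moving [OF that(2)] by simp
  qed
  have phi_ab: "phi_ab n a b i = single i (pal_gen i (a, b))" if "(a, b) \<in> basic2 n" "i \<in> {1..n}" for a b i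
    unfolding phi_ab_def ab [OF that] by simp
  have phi_abc: "phi_abc n a b c i = single i (basic_comm3 (a, b, c) \<otimes>\<^bsub>N3 n\<^esub> basic_comm3 (a, b, c))"
    if "(a, b, c) \<in> basic3 n" "i \<in> {1..n}" for a b c i
    unfolding phi_abc_def abc [OF that] by simp
  have "{phi_ab n a b i | a b i. 1 \<le> b \<and> b < a \<and> a \<le> n \<and> 1 \<le> i \<and> i \<le> n} =
      {phi_ab n a b i | a b i. (a, b) \<in> basic2 n \<and> i \<in> {1..n}}"
    by (simp add: basic2_def)
  also have "\<dots> = (\<Union>i\<in>{1..n}. single i ` pal_gen i ` basic2 n)"
    unfolding image_image by (rule Collect_pairs_eq_UN) (rule phi_ab)
  finally have gens_ab: "{phi_ab n a b i | a b i. 1 \<le> b \<and> b < a \<and> a \<le> n \<and> 1 \<le> i \<and> i \<le> n} =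
      (\<Union>i\<in>{1..n}. single i ` pal_gen i ` basic2 n)" .
  have "{phi_abc n a b c i | a b c i. 1 \<le> b \<and> b < a \<and> a \<le> n \<and> b \<le> c \<and> c \<le> n \<and> 1 \<le> i \<and> i \<le> n} =
      {phi_abc n a b c i | a b c i. (a, b, c) \<in> basic3 n \<and> i \<in> {1..n}}"
    by (simp add: basic3_def)
  also have "\<dots> = {phi_abc n a (fst bc) (snd bc) i | a bc i. (a, bc) \<in> basic3 n \<and> i \<in> {1..n}}"
    by simp
  also have "\<dots> = (\<Union>i\<in>{1..n}. single i ` (\<lambda>s. basic_comm3 s \<otimes>\<^bsub>N3 n\<^esub> basic_comm3 s) ` basic3 n)"
    unfolding image_image by (rule Collect_pairs_eq_UN) (use phi_abc in auto)
  finally have gens_abc: "{phi_abc n a b c i | a b c i.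
        1 \<le> b \<and> b < a \<and> a \<le> n \<and> b \<le> c \<and> c \<le> n \<and> 1 \<le> i \<and> i \<le> n} =
      (\<Union>i\<in>{1..n}. single i ` (\<lambda>s. basic_comm3 s \<otimes>\<^bsub>N3 n\<^esub> basic_comm3 s) ` basic3 n)" .
  have pal: "palindrome n g \<longleftrightarrow> palindromic g" for g
    by (simp add: palindrome_def palindromic_def word_value_eq)
  have CP: "central_palindromic_autos n = CentralPal"
    by (auto simp: central_palindromic_autos_def palindromic_autos_def CentralPal_def central_autos_def pal)
  have gen: "central_palindromic_autos n = generate (AutoGroup (N3 n))
         ({phi_ab n a b i | a b i. 1 \<le> b \<and> b < a \<and> a \<le> n \<and> 1 \<le> i \<and> i \<le> n} \<union>
          {phi_abc n a b c i | a b c i.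
             1 \<le> b \<and> b < a \<and> a \<le> n \<and> b \<le> c \<and> c \<le> n \<and> 1 \<le> i \<and> i \<le> n})"
    unfolding gens_ab gens_abc CP CentralPal_generated image_Un UN_Un_distrib ..
  have "group \<Gamma>\<^sub>3" "group (\<Gamma>\<^sub>2 Mod lower_central (N3 n) 3)"
    using comm_group_\<Gamma>\<^sub>2 comm_group_\<Gamma>\<^sub>3 lower_central_3_subgroup_\<Gamma>\<^sub>2
    by (auto simp: comm_group.abelian_FactGroup comm_group.axioms(2))
  then have ranks: "free_abelian_rank (gamma3_N3 n) = card (basic3 n)"
    "free_abelian_rank (gamma2_N3 n Mod lower_central (N3 n) 3) = card (basic2 n)"
    unfolding gamma2_N3_def gamma3_N3_def
    using free_abelian_rank_eqI \<Gamma>\<^sub>3_free_abelian \<Gamma>\<^sub>2_Mod_free_abelian by blast+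
  have free: "fin_free_abelian (gamma3_N3 n)" "fin_free_abelian (gamma2_N3 n Mod lower_central (N3 n) 3)"
    unfolding fin_free_abelian_def gamma2_N3_def gamma3_N3_def
    using \<Gamma>\<^sub>3_free_abelian \<Gamma>\<^sub>2_Mod_free_abelian by blast+
  define q where "q = card (basic3 n) - card (basic2 n)"
  have q: "real q = real (card (basic3 n)) - real (card (basic2 n))"
    using card_nonpivots [of n 0] by (simp add: q_def)
  note quotient = Central_quotient [OF q_def]
  have ex_ab: "\<exists>!\<phi>. aut_moving n i (phi_ab_image n a b i) \<phi>"
    if "1 \<le> b \<and> b < a \<and> a \<le> n \<and> 1 \<le> i \<and> i \<le> n" for a b i
  proof -
    have "(a, b) \<in> basic2 n" "i \<in> {1..n}" using that by (auto simp: basic2_def)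
    from ab [OF this] show ?thesis by simp
  qed
  have ex_abc: "\<exists>!\<phi>. aut_moving n i (phi_abc_image n a b c i) \<phi>"
    if "1 \<le> b \<and> b < a \<and> a \<le> n \<and> b \<le> c \<and> c \<le> n \<and> 1 \<le> i \<and> i \<le> n" for a b c i
  proof -
    have "(a, b, c) \<in> basic3 n" "i \<in> {1..n}" using that by (auto simp: basic3_def)
    from abc [OF this] show ?thesis by simp
  qed
  show ?thesis
  proof (intro conjI exI [of _ q])
    show "central_palindromic_autos n \<lhd> CentralAutGroup n"
      "CentralAutGroup n Mod central_palindromic_autos n \<cong> product_group {..<n * q} (\<lambda>_. integer_mod_group 2)"
      unfolding CP CentralAutGroup_def by (fact quotient)+
    show "real q = real (free_abelian_rank (gamma3_N3 n))
        - real (free_abelian_rank (gamma2_N3 n Mod lower_central (N3 n) 3))"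
      by (simp only: q ranks)
    show "real q = real n * ((real n)\<^sup>2 - 1) / 3 - real n * (real n - 1) / 2"
      by (simp only: q real_card_basic2 real_card_basic3)
  qed (intro allI impI ex_ab ex_abc, assumption | fact free gen)+
qed

end
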